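(* Let $T>0$ and let $F:[0,T]\times\mathbb{R}^n\rightrightarrows\mathbb{R}^n$ be a set-valued mapping satisfying the following four assumptions: (A1) for each $t\in[0,T]$, the operator $F(t,\cdot)$ is maximal monotone; (A2) there exists a nondecreasing absolutely continuous function $\varphi:[0,T]\to\mathbb{R}$ such that $\sup_{z\in\operatorname{dom}F(s,\cdot)}\operatorname{dist}\big(z,\operatorname{dom}F(t,\cdot)\big)\le\varphi(t)-\varphi(s)$ for all $s,t$ with $0\le s\le t\le T$; (A3) for every $r>0$ there exists $\sigma_r\in L_1([0,T],\mathbb{R}_+)$ such that $|F^0(t,x)|\le\sigma_r(t)(1+|x|)$ for all $t\in[0,T]$ and all $x\in\mathbb{B}^n(r)\cap\operatorname{dom}F(t,\cdot)$; (A4) the set-valued mapping $t\mapsto\operatorname{graph}F(t,\cdot)$ is outer semicontinuous on $[0,T]$. Then for every $x_0\in\operatorname{cl}\big(\operatorname{dom}F(0,\cdot)\big)$ there exists a unique solution $x\in AC([0,T],\mathbb{R}^n)$ of the differential inclusion $\dot x(t)\in-F(t,x(t))$, $x(0)=x_0$.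
   Context: $\operatorname{dom}G=\{x: G(x)\neq\emptyset\}$ and $\operatorname{graph}G=\{(x,y): y\in G(x)\}$ for a set-valued map $G$. $\mathbb{B}^n(r)=\{x\in\mathbb{R}^n:|x|\le r\}$, $|\cdot|$ the Euclidean norm, $\operatorname{dist}(x,S)=\inf_{y\in S}|x-y|$. For maximal monotone $F(t,\cdot)$, $F(t,x)$ is closed and convex for $x$ in its domain, and the minimal section is $F^0(t,x)=$ the projection of $0$ onto $F(t,x)$ (its least-norm element). Outer semicontinuity of $t\mapsto\operatorname{graph}F(t,\cdot)$ at $t^*$ means: whenever $t_\ell\to t^*$, $(x_\ell,y_\ell)\in\operatorname{graph}F(t_\ell,\cdot)$ and $(x_\ell,y_\ell)\to(x,y)$, then $(x,y)\in\operatorname{graph}F(t^*,\cdot)$; it holds on $[0,T]$ if it holds at every $t^*\in[0,T]$. A solution is a function $x\in AC([0,T],\mathbb{R}^n)$ with $x(0)=x_0$ such that $x(t)\in\operatorname{dom}F(t,\cdot)$ and $\dot x(t)\in-F(t,x(t))$ for almost all $t\in[0,T]$. *)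

theory Defs
  imports "HOL-Analysis.Analysis"
begin

definition sv_dom :: "('a \<Rightarrow> 'b set) \<Rightarrow> 'a set" where
  "sv_dom G = {x. G x \<noteq> {}}"

definition sv_graph :: "('a \<Rightarrow> 'b set) \<Rightarrow> ('a \<times> 'b) set" where
  "sv_graph G = {(x, y). y \<in> G x}"

definition monotone_set :: "('a::real_inner \<times> 'a) set \<Rightarrow> bool" where
  "monotone_set S = (\<forall>(x, y)\<in>S. \<forall>(x', y')\<in>S. 0 \<le> inner (y - y') (x - x'))"

definition monotone_operator :: "('a::real_inner \<Rightarrow> 'a set) \<Rightarrow> bool" where
  "monotone_operator G = monotone_set (sv_graph G)"

definition maximal_monotone :: "('a::real_inner \<Rightarrow> 'a set) \<Rightarrow> bool" where
  "maximal_monotone G = (monotone_operator G \<and>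
     (\<forall>S. monotone_set S \<and> sv_graph G \<subseteq> S \<longrightarrow> S = sv_graph G))"

definition min_section :: "(real \<Rightarrow> 'a::euclidean_space \<Rightarrow> 'a set) \<Rightarrow> real \<Rightarrow> 'a \<Rightarrow> 'a" where
  "min_section F t x = closest_point (F t x) 0"

definition absolutely_continuous_on_interval ::
    "real \<Rightarrow> real \<Rightarrow> (real \<Rightarrow> 'b::real_normed_vector) \<Rightarrow> bool" where
  "absolutely_continuous_on_interval a b f =
    (\<forall>\<epsilon>>0. \<exists>\<delta>>0. \<forall>I :: (real \<times> real) set.
        finite I \<and> (\<forall>(u, v)\<in>I. a \<le> u \<and> u \<le> v \<and> v \<le> b) \<and>
        (\<forall>p\<in>I. \<forall>q\<in>I. p \<noteq> q \<longrightarrow> snd p \<le> fst q \<or> snd q \<le> fst p) \<and>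
        (\<Sum>(u, v)\<in>I. v - u) < \<delta>
        \<longrightarrow> (\<Sum>(u, v)\<in>I. norm (f v - f u)) < \<epsilon>)"

definition graph_osc_on :: "real \<Rightarrow> (real \<Rightarrow> 'a::euclidean_space \<Rightarrow> 'a set) \<Rightarrow> bool" where
  "graph_osc_on T F =
    (\<forall>t\<in>{0..T}. \<forall>(s :: nat \<Rightarrow> real) (xs :: nat \<Rightarrow> 'a) (ys :: nat \<Rightarrow> 'a) x y.
        (\<forall>l. s l \<in> {0..T}) \<and> s \<longlonglongrightarrow> t \<and>
        (\<forall>l. (xs l, ys l) \<in> sv_graph (F (s l))) \<and> xs \<longlonglongrightarrow> x \<and> ys \<longlonglongrightarrow> y
        \<longrightarrow> (x, y) \<in> sv_graph (F t))"

definition is_solution :: "real \<Rightarrow> (real \<Rightarrow> 'a::euclidean_space \<Rightarrow> 'a set) \<Rightarrow> 'a \<Rightarrow> (real \<Rightarrow> 'a) \<Rightarrow> bool" where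
  "is_solution T F x0 x =
    (absolutely_continuous_on_interval 0 T x \<and> x 0 = x0 \<and>
     (AE t in lborel. t \<in> {0..T} \<longrightarrow>
        x t \<in> sv_dom (F t) \<and>
        (\<exists>v. (x has_vector_derivative v) (at t within {0..T}) \<and> - v \<in> F t (x t))))"

end

theory Submission
  imports Defs "HOL-Complex_Analysis.Great_Picard"
begin

text \<open>
  Uniqueness: for two solutions, \<open>\<bar>x - y\<bar>\<^sup>2\<close> is absolutely continuous with nonpositive derivative
  almost everywhere, by monotonicity.

  Existence: solve the implicit Euler scheme
  \<open>(y\<^sub>k - y\<^sub>k\<^sub>+\<^sub>1) / h \<in> F(\<tau>\<^sub>k, y\<^sub>k\<^sub>+\<^sub>1)\<close> by Minty's theorem. The growth bound in (A3) is only integrable in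
  time, so \<open>\<tau>\<^sub>k\<close> is chosen in the \<open>k\<close>-th grid cell at a point where the bound does not exceed its mean
  over the cell. Together with (A2) this dominates the increments of the scheme by the increments of a
  single indefinite integral \<open>\<Theta> = \<integral> \<theta>\<close>, so a subsequence converges pointwise to an absolutely
  continuous \<open>x\<close>. At a point \<open>t\<close> where \<open>x\<close> is differentiable and the indefinite integral of
  \<open>max 0 (\<theta> - m)\<close> has derivative \<open>0\<close> for some \<open>m\<close> (almost every \<open>t\<close>), sum the discrete monotonicity
  inequality over a short interval \<open>[t, t + d]\<close> against a fixed \<open>(u, v)\<close> in the graph of \<open>F(t, _)\<close>. Where
  \<open>\<theta>\<close> has moderate mean, the graph of \<open>F(\<tau>\<^sub>k, _)\<close> contains points close to \<open>(u, v)\<close>, by (A4) and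
  continuity of resolvents; the other cells contribute \<open>o(d)\<close>. In the limit
  \<open>\<langle>x'(t) + v, x(t) - u\<rangle> \<le> 0\<close>, and maximality gives \<open>- x'(t) \<in> F(t, x(t))\<close>.
\<close>

section \<open>Maximal monotone operators\<close>

text \<open>Outer semicontinuity only locates limits of graph points, and no pointwise convergence
  of the discrete velocities is available, so (A4) cannot be applied to the scheme directly. The
  limit passage needs something in the opposite direction: for a fixed pair of the graph at
  \<open>t\<close>, graphs at nearby times must contain nearby pairs. Resolvents provide it: the
  resolvent of \<open>F s\<close> at \<open>u + v\<close> is one point, and its limits are
  identified by (A4) and uniqueness. This requires bounded resolvents, which are not guaranteed at
  times where the bound of (A3) is large. Such times cannot be avoided, only shown to weigh little
  near almost every \<open>t\<close>; hence the excess of \<theta> over a level \<open>m\<close>. A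
  second obstacle is circular: (A3) gives a bound on each ball separately, while the radius of a
  ball containing the scheme depends on that bound. A reference sequence in the domains, whose
  radius comes from (A2) alone, breaks the circle.\<close>

lemma maximal_monotone_ineq:
  assumes "maximal_monotone G" "v \<in> G u" "v' \<in> G u'"
  shows "0 \<le> inner (v - v') (u - u')"
  using assms unfolding maximal_monotone_def monotone_operator_def monotone_set_def sv_graph_def
  by fastforce

text \<open>Adjoining the single pair \<open>(x, y)\<close> keeps the graph monotone, so by
  maximality the pair was already there. Every use of maximality, as opposed to monotonicity, passes
  through this membership test.\<close>

lemma maximal_monotone_mem:
  assumes G: "maximal_monotone G"
    and "\<And>u v. v \<in> G u \<Longrightarrow> 0 \<le> inner (v - y) (u - x)"
  shows "y \<in> G x"
proof -
  have "0 \<le> inner (y - v) (x - u)" if "v \<in> G u" for u v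
    using assms(2)[OF that] by (simp add: inner_diff_left inner_diff_right)
  then have "monotone_set (insert (x, y) (sv_graph G))"
    using assms(2) maximal_monotone_ineq[OF G]
    by (auto simp: monotone_set_def sv_graph_def)
  then have "insert (x, y) (sv_graph G) = sv_graph G"
    using G unfolding maximal_monotone_def by blast
  then show ?thesis by (auto simp: sv_graph_def)
qed

lemma maximal_monotone_closed:
  assumes G: "maximal_monotone G"
  shows "closed (G x)"
proof -
  have "G x = (\<Inter>(u, v) \<in> sv_graph G. {y. 0 \<le> inner (v - y) (u - x)})"
    using maximal_monotone_mem[OF G, of _ x] maximal_monotone_ineq[OF G]
    by (auto simp: sv_graph_def)
  also have "closed \<dots>"
    by (intro closed_INT ballI) (auto intro!: closed_Collect_le continuous_intros split: prod.splits)
  finally show ?thesis .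
qed

text \<open>\<open>closest_point\<close> is defined by choice, so membership has to come from the
  value being closed and nonempty; this is what closedness of the values is for.\<close>

lemma min_section_mem:
  assumes "maximal_monotone (F t)" "x \<in> sv_dom (F t)"
  shows "min_section F t x \<in> F t x"
  unfolding min_section_def
  by (rule closest_point_in_set) (use assms maximal_monotone_closed in \<open>auto simp: sv_dom_def\<close>)

text \<open>If every point violated one of the inequalities, averaging the points \<open>u i\<close> with weights
  given by the size of the violation would define a continuous self-map of their convex hull, and its
  Brouwer fixed point contradicts monotonicity.\<close>

lemma Debrunner_Flor_finite:
  fixes u v :: "'i \<Rightarrow> 'a::euclidean_space"
  assumes I: "finite I" "I \<noteq> {}"
    and mono: "\<And>i j. i \<in> I \<Longrightarrow> j \<in> I \<Longrightarrow> 0 \<le> inner (v i - v j) (u i - u j)"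
  shows "\<exists>x. \<forall>i\<in>I. inner (v i + c *\<^sub>R (x - y)) (x - u i) \<le> 0"
proof (rule ccontr)
  assume neg: "\<not> ?thesis"
  define f where "f i x = inner (v i + c *\<^sub>R (x - y)) (x - u i)" for i x
  define w where "w i x = max 0 (f i x)" for i x
  define W where "W x = (\<Sum>i\<in>I. w i x)" for x
  have w0: "0 \<le> w i x" for i x by (simp add: w_def)
  have Wpos: "0 < W x" for x
  proof -
    obtain i where "i \<in> I" "0 < f i x" using neg by (auto simp: f_def not_le)
    then show ?thesis unfolding W_def
      by (intro sum_pos2[of I i]) (auto simp: I w0 w_def)
  qed
  define S where "S = convex hull (u ` I)"
  have cW: "continuous_on S (\<lambda>x. \<Sum>i\<in>I. (w i x / W x) *\<^sub>R u i)"
  proof -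
    have cw: "continuous_on S (w i)" for i
      unfolding w_def f_def by (intro continuous_intros)
    have "continuous_on S W" unfolding W_def by (intro continuous_intros cw)
    moreover have "W x \<noteq> 0" for x using Wpos[of x] by simp
    ultimately show ?thesis by (intro continuous_intros cw) auto
  qed
  have sum1: "(\<Sum>i\<in>I. w i x / W x) = 1" for x
    using Wpos[of x] by (simp add: sum_divide_distrib[symmetric] W_def)
  have "(\<Sum>i\<in>I. (w i x / W x) *\<^sub>R u i) \<in> S" for x
    unfolding S_def
  proof (rule convex_sum)
    show "(\<Sum>i\<in>I. w i x / W x) = 1" by (rule sum1)
  qed (use I Wpos[of x] w0 in \<open>auto simp: convex_convex_hull hull_inc\<close>)
  then obtain x where fx: "(\<Sum>i\<in>I. (w i x / W x) *\<^sub>R u i) = x"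
    using brouwer[of S "\<lambda>x. \<Sum>i\<in>I. (w i x / W x) *\<^sub>R u i"] cW I
    by (auto simp: S_def finite_imp_compact_convex_hull convex_convex_hull)
  define l where "l i = w i x / W x" for i
  have l0: "0 \<le> l i" for i using w0 Wpos[of x] by (simp add: l_def)
  have l1: "(\<Sum>i\<in>I. l i) = 1" using sum1 by (simp add: l_def)
  have lx: "(\<Sum>i\<in>I. l i *\<^sub>R u i) = x" using fx by (simp add: l_def)
  have lz: "(\<Sum>i\<in>I. l i *\<^sub>R (x - u i)) = 0"
    by (simp add: scaleR_diff_right sum_subtractf lx flip: scaleR_left.sum) (simp add: l1)
  obtain i0 where i0: "i0 \<in> I" "0 < f i0 x" using neg by (auto simp: f_def not_le)
  \<comment> \<open>The weight \<open>l i\<close> is positive only where \<open>f i x\<close> is, so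
    no summand is negative.\<close>
  have "0 < (\<Sum>i\<in>I. l i * f i x)"
  proof (rule sum_pos2[of I i0])
    show "0 < l i0 * f i0 x" using i0 Wpos[of x] by (simp add: l_def w_def)
    show "0 \<le> l i * f i x" if "i \<in> I" for i
    proof (cases "0 \<le> f i x")
      case True then show ?thesis using l0 by simp
    next
      case False then show ?thesis by (simp add: l_def w_def)
    qed
  qed (use I i0 in auto)
  \<comment> \<open>The perturbation \<open>c *\<^sub>R (x - y)\<close> is paired with the weighted
    mean of the \<open>x - u i\<close>, which is 0 because \<open>x\<close> is the barycentre. So it
    leaves the sum, and only monotonicity of the pairs matters.\<close>
  also have "(\<Sum>i\<in>I. l i * f i x) = (\<Sum>i\<in>I. l i * inner (v i) (x - u i))
      + inner (c *\<^sub>R (x - y)) (\<Sum>i\<in>I. l i *\<^sub>R (x - u i))"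
    by (simp add: f_def inner_add_left distrib_left sum.distrib inner_sum_right sum_distrib_left
        mult.left_commute)
  also have "\<dots> = (\<Sum>i\<in>I. l i * inner (v i) (x - u i))" by (simp add: lz)
  also have "\<dots> = (\<Sum>i\<in>I. \<Sum>j\<in>I. l i * l j * inner (v i) (u j - u i))"
  proof (rule sum.cong[OF refl])
    fix i assume "i \<in> I"
    have "x - u i = (\<Sum>j\<in>I. l j *\<^sub>R (u j - u i))"
      by (simp add: scaleR_diff_right sum_subtractf lx flip: scaleR_left.sum) (simp add: l1)
    then show "l i * inner (v i) (x - u i) = (\<Sum>j\<in>I. l i * l j * inner (v i) (u j - u i))"
      by (simp add: inner_sum_right sum_distrib_left mult.assoc)
  qed
  finally have pos: "0 < (\<Sum>i\<in>I. \<Sum>j\<in>I. l i * l j * inner (v i) (u j - u i))" (is "0 < ?A") .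
  \<comment> \<open>Adding the double sum to its transpose sets \<open>v i - v j\<close> against
    \<open>u i - u j\<close>, where monotonicity decides the sign.\<close>
  have "?A = (\<Sum>i\<in>I. \<Sum>j\<in>I. l i * l j * inner (v j) (u i - u j))"
    by (subst sum.swap) (simp add: mult.commute mult.left_commute)
  then have "2 * ?A = (\<Sum>i\<in>I. \<Sum>j\<in>I. l i * l j * inner (v i) (u j - u i)
      + l i * l j * inner (v j) (u i - u j))"
    by (simp add: sum.distrib)
  also have "\<dots> = (\<Sum>i\<in>I. \<Sum>j\<in>I. - (l i * l j * inner (v i - v j) (u i - u j)))"
    by (intro sum.cong refl) (simp add: inner_diff_left inner_diff_right algebra_simps)
  also have "\<dots> \<le> 0"
    using l0 mono by (intro sum_nonpos) auto
  finally show False using pos by simp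
qed

section \<open>Minty's theorem and resolvent estimates\<close>

text \<open>Moving the base point of the affine term from \<open>x\<close> to \<open>u\<close>
  releases the coercive term, \<open>c\<close> times the square of \<open>norm (x - u)\<close>. It
  gives both the compactness in Minty's theorem and the distance estimate for resolvents.\<close>

lemma inner_affine_diff:
  fixes x y u v :: "'a::real_inner"
  shows "inner (v + c *\<^sub>R (x - y)) (x - u)
    = inner (v + c *\<^sub>R (u - y)) (x - u) + c * norm (x - u) * norm (x - u)"
proof -
  have "v + c *\<^sub>R (x - y) = (v + c *\<^sub>R (u - y)) + c *\<^sub>R (x - u)"
    by (simp add: algebra_simps)
  then have "inner (v + c *\<^sub>R (x - y)) (x - u) = inner (v + c *\<^sub>R (u - y)) (x - u) + c * inner (x - u) (x - u)"
    by (metis inner_add_left inner_scaleR_left)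
  also have "inner (x - u) (x - u) = norm (x - u) * norm (x - u)"
    by (metis dot_square_norm power2_eq_square)
  finally show ?thesis by (simp add: mult.assoc)
qed

text \<open>Each graph pair confines \<open>x\<close> to a closed set, bounded by coercivity.
  Finitely many of these sets meet by the Debrunner-Flor lemma, so all of them meet, and maximality
  turns a common point into the required inclusion. With \<open>c = 1 / h\<close> this is one
  implicit Euler step starting at \<open>y\<close>.\<close>

theorem Minty_surjective:
  fixes G :: "'a::euclidean_space \<Rightarrow> 'a set"
  assumes G: "maximal_monotone G" and c: "0 < c"
  shows "\<exists>x. c *\<^sub>R (y - x) \<in> G x"
proof -
  define Q where "Q p = {x. inner (snd p + c *\<^sub>R (x - y)) (x - fst p) \<le> 0}" for p :: "'a \<times> 'a"
  have cl: "closed (Q p)" for p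
    unfolding Q_def by (intro closed_Collect_le continuous_intros)
  have bd: "bounded (Q p)" for p
  proof -
    obtain u v where p: "p = (u, v)" by fastforce
    have "norm (x - u) \<le> norm (v + c *\<^sub>R (u - y)) / c" if "x \<in> Q p" for x
    proof -
      have "c * norm (x - u) * norm (x - u) = inner (v + c *\<^sub>R (x - y)) (x - u) - inner (v + c *\<^sub>R (u - y)) (x - u)"
        using inner_affine_diff[of v c x y u] by simp
      also have "\<dots> \<le> norm (v + c *\<^sub>R (u - y)) * norm (x - u)"
        using that norm_cauchy_schwarz[of "- (v + c *\<^sub>R (u - y))" "x - u"]
        unfolding norm_minus_cancel inner_minus_left by (simp add: Q_def p)
      finally have "c * norm (x - u) \<le> norm (v + c *\<^sub>R (u - y)) \<or> norm (x - u) = 0"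
        by (auto simp: mult_le_cancel_right)
      then show ?thesis using c by (auto simp: field_simps)
    qed
    then have "Q p \<subseteq> cball u (norm (v + c *\<^sub>R (u - y)) / c)"
      by (auto simp: dist_norm norm_minus_commute)
    then show ?thesis using bounded_cball bounded_subset by blast
  qed
  have "\<Inter>(Q ` sv_graph G) \<noteq> {}"
  proof (rule compact_fip_Heine_Borel)
    show "compact S" if "S \<in> Q ` sv_graph G" for S
      using that cl bd by (auto simp: compact_eq_bounded_closed)
    show "\<Inter>K \<noteq> {}" if K: "finite K" "K \<subseteq> Q ` sv_graph G" for K
    proof (cases "K = {}")
      case False
      obtain P where P: "finite P" "P \<subseteq> sv_graph G" "K = Q ` P"
        using finite_subset_image[OF K] by blast
      have "\<exists>x. \<forall>p\<in>P. inner (snd p + c *\<^sub>R (x - y)) (x - fst p) \<le> 0"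
      proof (rule Debrunner_Flor_finite)
        show "0 \<le> inner (snd p - snd q) (fst p - fst q)" if "p \<in> P" "q \<in> P" for p q
          using that P by (intro maximal_monotone_ineq[OF G]) (auto simp: sv_graph_def)
      qed (use P False in auto)
      then show ?thesis by (auto simp: P Q_def)
    qed auto
  qed
  then obtain x where x: "\<And>p. p \<in> sv_graph G \<Longrightarrow> x \<in> Q p" by auto
  have "c *\<^sub>R (y - x) \<in> G x"
  proof (rule maximal_monotone_mem[OF G])
    fix u v assume "v \<in> G u"
    then have "inner (v + c *\<^sub>R (x - y)) (x - u) \<le> 0"
      using x[of "(u, v)"] by (simp add: Q_def sv_graph_def)
    then have "0 \<le> inner (v + c *\<^sub>R (x - y)) (- (x - u))"
      by (simp only: inner_minus_right)
    also have "v + c *\<^sub>R (x - y) = v - c *\<^sub>R (y - x)" by (simp add: algebra_simps)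
    finally show "0 \<le> inner (v - c *\<^sub>R (y - x)) (u - x)" by simp
  qed
  then show ?thesis ..
qed

text \<open>Monotonicity against \<open>(u, v)\<close> plus the coercive term, after cancelling one
  factor \<open>norm (x - u)\<close>. With \<open>c = 1 / h\<close> it says that an Euler step
  increases the distance to a domain point \<open>u\<close> by at most \<open>h * norm v\<close>;
  all a priori bounds of the scheme come from it.\<close>

lemma resolvent_dist_le:
  fixes G :: "'a::euclidean_space \<Rightarrow> 'a set"
  assumes G: "maximal_monotone G" and c: "0 < c"
    and x: "c *\<^sub>R (y - x) \<in> G x" and v: "v \<in> G u"
  shows "norm (x - u) \<le> norm (y - u) + norm v / c"
proof -
  have "0 \<le> inner (c *\<^sub>R (y - x) - v) (x - u)"
    by (rule maximal_monotone_ineq[OF G x v])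
  also have "c *\<^sub>R (y - x) - v = - (v + c *\<^sub>R (x - y))"
    by (simp add: algebra_simps)
  also have "inner \<dots> (x - u) = inner (- (v + c *\<^sub>R (u - y))) (x - u) - c * norm (x - u) * norm (x - u)"
    unfolding inner_minus_left inner_affine_diff[of v c x y u] by linarith
  also have "- (v + c *\<^sub>R (u - y)) = c *\<^sub>R (y - u) - v"
    by (simp add: algebra_simps)
  finally have "c * norm (x - u) * norm (x - u) \<le> inner (c *\<^sub>R (y - u) - v) (x - u)" by simp
  also have "\<dots> \<le> norm (c *\<^sub>R (y - u) - v) * norm (x - u)" by (rule norm_cauchy_schwarz)
  finally have "c * norm (x - u) \<le> norm (c *\<^sub>R (y - u) - v) \<or> norm (x - u) = 0"
    by (auto simp: mult_le_cancel_right)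
  moreover have "norm (c *\<^sub>R (y - u) - v) \<le> c * norm (y - u) + norm v"
    using norm_triangle_ineq4[of "c *\<^sub>R (y - u)" v] c by simp
  ultimately have "c * norm (x - u) \<le> c * norm (y - u) + norm v"
    using c by (elim disjE) (simp_all add: add_nonneg_nonneg)
  then show ?thesis using c by (simp add: field_simps)
qed

lemma resolvent_unique:
  fixes G :: "'a::euclidean_space \<Rightarrow> 'a set"
  assumes "maximal_monotone G" "z - p \<in> G p" "z - u \<in> G u"
  shows "p = u"
proof -
  have "0 \<le> inner ((z - p) - (z - u)) (p - u)"
    by (rule maximal_monotone_ineq[OF assms])
  also have "(z - p) - (z - u) = - (p - u)" by simp
  also have "inner \<dots> (p - u) = - (norm (p - u))\<^sup>2"
    by (simp only: inner_minus_left power2_norm_eq_inner)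
  finally show ?thesis by simp
qed

section \<open>Differentiation of indefinite integrals\<close>

lemma set_integrable_lborel:
  fixes f :: "real \<Rightarrow> real"
  assumes "integrable lborel f" "A \<in> sets borel"
  shows "set_integrable lborel A f"
  using assms unfolding set_integrable_def by (intro integrable_mult_indicator) auto

lemma Ioc_integral_combine:
  fixes f :: "real \<Rightarrow> real"
  assumes "integrable lborel f" "s \<le> m" "m \<le> u"
  shows "(LINT x:{s<..u}|lborel. f x) = (LINT x:{s<..m}|lborel. f x) + (LINT x:{m<..u}|lborel. f x)"
proof -
  have "{s<..u} = {s<..m} \<union> {m<..u}" using assms by auto
  then show ?thesis
    by (simp add: set_integral_Un set_integrable_lborel assms)
qed

text \<open>A Vitali argument. The measure \<open>N\<close> with density \<open>f\<close> does not
  charge the zero set of \<open>f\<close>, so an open \<open>U\<close> containing that set has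
  \<open>N\<close>-mass below \<open>e * \<eta>\<close>. Every bad point lies in arbitrarily short
  intervals inside \<open>U\<close> on which the mean of \<open>f\<close> exceeds \<open>e\<close>.
  A disjoint subfamily covers the bad points up to a null set, and its total length is at most the
  mass of \<open>U\<close> divided by \<open>e\<close>, hence at most \<open>\<eta>\<close>. The
  intervals only have to contain the point, which gives the straddling form.\<close>

lemma negligible_straddle_positive_density:
  fixes f :: "real \<Rightarrow> real"
  assumes f: "integrable lborel f" and f0: "\<And>x. 0 \<le> f x" and e: "0 < e"
  shows "negligible {t. f t = 0 \<and>
    \<not> (\<exists>d>0. \<forall>s u. s \<le> t \<and> t \<le> u \<and> u - s < d \<longrightarrow> (LINT x:{s<..u}|lborel. f x) \<le> e * (u - s))}"
    (is "negligible ?S")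
  unfolding negligible_outer_le
proof (intro allI impI)
  fix \<eta> :: real assume \<eta>: "0 < \<eta>"
  have [measurable]: "f \<in> borel_measurable borel" using f by auto
  define N where "N = density lborel (\<lambda>x. ennreal (f x))"
  have N_eq: "emeasure N A = (\<integral>\<^sup>+x. ennreal (indicator A x * f x) \<partial>lborel)" if "A \<in> sets borel" for A
    unfolding N_def using that
    by (subst emeasure_density) (auto intro!: nn_integral_cong simp: indicator_def)
  have N_Ioc: "emeasure N {s<..u} = ennreal (LINT x:{s<..u}|lborel. f x)" for s u
    using set_integrable_lborel[OF f, of "{s<..u}"] f0
    by (subst N_eq) (auto simp: set_lebesgue_integral_def set_integrable_def intro!: nn_integral_eq_integral)
  have sN[simp, measurable_cong]: "sets N = sets borel" by (simp add: N_def)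
  have "emeasure N UNIV = ennreal (LINT x|lborel. f x)"
    using f f0 by (subst N_eq) (auto intro!: nn_integral_eq_integral)
  then have fin: "emeasure N (space N) \<noteq> \<infinity>" by (simp add: N_def)
  define A where "A = {t. f t = 0}"
  have A: "A \<in> sets borel" unfolding A_def by measurable
  have "emeasure N A = 0"
    unfolding N_eq[OF A] by (subst nn_integral_0_iff_AE) (auto simp: A_def indicator_def)
  then have "(INF U \<in> {U. A \<subseteq> U \<and> open U}. emeasure N U) = 0"
    using outer_regular[OF sN fin A] by simp
  then have "(INF U \<in> {U. A \<subseteq> U \<and> open U}. emeasure N U) < ennreal (e * \<eta>)"
    using e \<eta> by simp
  then obtain U where U: "A \<subseteq> U" "open U" "emeasure N U < ennreal (e * \<eta>)"
    unfolding INF_less_iff by auto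
  define K where "K = {(s, u). s < u \<and> {s..u} \<subseteq> U \<and> e * (u - s) < (LINT x:{s<..u}|lborel. f x)}"
  \<comment> \<open>The covering theorem speaks of balls, so an interval is recoded by its centre
    and radius.\<close>
  define a where "a i = (fst i + snd i) / 2" for i :: "real \<times> real"
  define r where "r i = (snd i - fst i) / 2" for i :: "real \<times> real"
  have cb: "cball (a i) (r i) = {fst i..snd i}" for i
    by (auto simp: a_def r_def cball_eq_atLeastAtMost field_simps)
  obtain C where C: "countable C" "C \<subseteq> K"
    and disj: "pairwise (\<lambda>i j. disjnt (cball (a i) (r i)) (cball (a j) (r j))) C"
    and neg: "negligible (?S - (\<Union>i \<in> C. cball (a i) (r i)))"
  proof (rule Vitali_covering_theorem_cballs[of K r ?S a])
    show "0 < r i" if "i \<in> K" for i using that by (auto simp: K_def r_def)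
    fix t d :: real assume t: "t \<in> ?S" and d: "0 < d"
    then have "t \<in> U" using U by (auto simp: A_def)
    then obtain d' where d': "0 < d'" "ball t d' \<subseteq> U" using U(2) openE by blast
    have "0 < min d d'" using d d' by simp
    with t have "\<not> (\<forall>s u. s \<le> t \<and> t \<le> u \<and> u - s < min d d' \<longrightarrow> (LINT x:{s<..u}|lborel. f x) \<le> e * (u - s))"
      by blast
    then obtain s u where su: "s \<le> t" "t \<le> u" "u - s < min d d'"
      "e * (u - s) < (LINT x:{s<..u}|lborel. f x)"
      unfolding not_all not_imp not_le by blast
    then have "s \<noteq> u" by (auto simp: set_lebesgue_integral_def)
    moreover have "{s..u} \<subseteq> ball t d'" using su by (auto simp: dist_real_def)
    ultimately have "(s, u) \<in> K" using su d' by (auto simp: K_def)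
    then show "\<exists>i. i \<in> K \<and> t \<in> cball (a i) (r i) \<and> r i < d"
      unfolding cb using su by (intro exI[of _ "(s, u)"]) (auto simp: r_def)
  qed blast
  define V where "V = (\<Union>i \<in> C. {fst i..snd i})"
  have V: "V \<in> sets borel" unfolding V_def by (intro sets.countable_UN' C) auto
  have dis: "disjoint_family_on (\<lambda>i. {fst i..snd i}) C"
    using disj unfolding cb disjoint_family_on_def pairwise_def disjnt_def by auto
  have "ennreal e * emeasure lborel V = ennreal e * (\<integral>\<^sup>+i. emeasure lborel {fst i..snd i} \<partial>count_space C)"
    unfolding V_def by (subst emeasure_UN_countable) (auto simp: C dis)
  also have "\<dots> = (\<integral>\<^sup>+i. ennreal e * emeasure lborel {fst i..snd i} \<partial>count_space C)"
    by (rule nn_integral_cmult[symmetric]) auto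
  also have "\<dots> \<le> (\<integral>\<^sup>+i. emeasure N {fst i..snd i} \<partial>count_space C)"
  proof (rule nn_integral_mono)
    fix i assume "i \<in> space (count_space C)"
    then have i: "i \<in> K" using C by auto
    then have "ennreal e * emeasure lborel {fst i..snd i} = ennreal (e * (snd i - fst i))"
      using e by (auto simp: K_def ennreal_mult)
    also have "\<dots> \<le> emeasure N {fst i<..snd i}"
      using i by (auto simp: N_Ioc K_def intro!: ennreal_leI)
    also have "\<dots> \<le> emeasure N {fst i..snd i}" by (rule emeasure_mono) auto
    finally show "ennreal e * emeasure lborel {fst i..snd i} \<le> emeasure N {fst i..snd i}" .
  qed
  also have "\<dots> = emeasure N V"
    unfolding V_def by (subst emeasure_UN_countable) (auto simp: C dis)
  also have "\<dots> \<le> emeasure N U"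
  proof (rule emeasure_mono)
    have "{fst i..snd i} \<subseteq> U" if "i \<in> C" for i
    proof -
      have "i \<in> K" using C that by blast
      then show ?thesis by (simp add: K_def case_prod_beta)
    qed
    then show "V \<subseteq> U" unfolding V_def by blast
  qed (use U in simp)
  also have "\<dots> \<le> ennreal e * ennreal \<eta>" using U e \<eta> by (simp add: ennreal_mult)
  finally have eV: "emeasure lborel V \<le> ennreal \<eta>"
    using e by (simp add: ennreal_mult_le_mult_iff)
  have VL: "V \<in> lmeasurable"
    using V eV by (intro fmeasurableI) (auto simp: order.strict_trans1)
  have mV: "measure lebesgue V \<le> \<eta>"
    using eV V \<eta> by (simp add: measure_def enn2real_leI)
  let ?T = "(?S - V) \<union> V"
  have neg': "negligible (?S - V)" using neg by (simp add: V_def cb)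
  show "\<exists>T. ?S \<subseteq> T \<and> T \<in> lmeasurable \<and> measure lebesgue T \<le> \<eta>"
  proof (intro exI[of _ ?T] conjI)
    show "?T \<in> lmeasurable" by (intro fmeasurable.Un VL negligible_imp_measurable neg')
    have "measure lebesgue ?T \<le> measure lebesgue (?S - V) + measure lebesgue V"
      by (intro measure_Un_le fmeasurableD VL negligible_imp_measurable neg')
    then show "measure lebesgue ?T \<le> \<eta>"
      using mV negligible_imp_measure0[OF neg'] by simp
  qed auto
qed

text \<open>The exceptional null set depends on \<open>e\<close>. The countably many values
  \<open>1 / Suc n\<close> suffice, because the estimate gets weaker as \<open>e\<close>
  grows.\<close>

lemma AE_straddle_zero:
  fixes f :: "real \<Rightarrow> real"
  assumes f: "integrable lborel f" and f0: "\<And>x. 0 \<le> f x"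
  shows "AE t in lborel. f t = 0 \<longrightarrow> (\<forall>e>0. \<exists>d>0. \<forall>s u. s \<le> t \<and> t \<le> u \<and> u - s < d \<longrightarrow>
    (LINT x:{s<..u}|lborel. f x) \<le> e * (u - s))"
proof -
  define P where "P e t = (\<exists>d>0. \<forall>s u. s \<le> t \<and> t \<le> u \<and> u - s < d \<longrightarrow>
    (LINT x:{s<..u}|lborel. f x) \<le> e * (u - s))" for e t
  have "AE t in lborel. f t = 0 \<longrightarrow> P (1 / Suc n) t" for n
  proof -
    have "negligible {t. f t = 0 \<and> \<not> P (1 / Suc n) t}"
      unfolding P_def by (rule negligible_straddle_positive_density[OF f f0]) simp
    then have "{t. f t = 0 \<and> \<not> P (1 / Suc n) t} \<in> null_sets lebesgue"
      by (simp add: negligible_iff_null_sets)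
    then have "AE t in lebesgue. f t = 0 \<longrightarrow> P (1 / Suc n) t"
      by (rule AE_I') auto
    then show ?thesis by (simp add: AE_completion_iff)
  qed
  then have "AE t in lborel. \<forall>n. f t = 0 \<longrightarrow> P (1 / Suc n) t"
    unfolding AE_all_countable by blast
  then show ?thesis
  proof eventually_elim
    case (elim t)
    have "P e t" if "f t = 0" "0 < e" for e
    proof -
      obtain n where n: "1 / real (Suc n) < e"
        using \<open>0 < e\<close> nat_approx_posE by blast
      have "c / Suc n \<le> e * c" if "0 \<le> c" for c
        using mult_right_mono[of "1 / Suc n" e c] n that by simp
      moreover have "P (1 / Suc n) t" using elim that by blast
      ultimately show ?thesis unfolding P_def
        by (smt (verit, ccfv_SIG) mult_cancel_right2 times_divide_eq_left)
    qed
    then show ?case by (simp add: P_def)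
  qed
qed

text \<open>The zero-set result is applied to the excess of \<open>f\<close> above a rational
  \<open>q\<close> and to its deficit below a rational \<open>p\<close>. Both vanish at
  \<open>t\<close> when \<open>p < f t < q\<close>, so means over short intervals around
  \<open>t\<close> are squeezed between \<open>p\<close> and \<open>q\<close> up to a small error.
  Rational levels keep the exceptional set null.\<close>

theorem AE_Lebesgue_differentiation:
  fixes f :: "real \<Rightarrow> real"
  assumes f: "integrable lborel f"
  shows "AE t in lborel. \<forall>e>0. \<exists>d>0. \<forall>s u. s \<le> t \<and> t \<le> u \<and> u - s < d \<longrightarrow>
    \<bar>(LINT x:{s<..u}|lborel. f x) - f t * (u - s)\<bar> \<le> e * (u - s)"
proof -
  define Z where "Z g t = (\<forall>e>0. \<exists>d>0. \<forall>s u. s \<le> t \<and> t \<le> u \<and> u - s < d \<longrightarrow>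
    (LINT x:{s<..u}|lborel. g x) \<le> e * (u - s))" for g :: "real \<Rightarrow> real" and t
  \<comment> \<open>Cutting off to a bounded interval makes the excess integrable, since a nonzero
    constant is not integrable on the line.\<close>
  define up where "up n q x = indicator {- real n..real n} x * max 0 (f x - q)" for n q x
  define lo where "lo n q x = indicator {- real n..real n} x * max 0 (q - f x)" for n q x
  have [measurable]: "f \<in> borel_measurable borel" using f by auto
  have int: "integrable lborel (up n q)" "integrable lborel (lo n q)" for n q
  proof -
    have b: "integrable lborel (\<lambda>x. \<bar>f x\<bar> + \<bar>q\<bar> * indicator {- real n..real n} x)"
      using f by (intro Bochner_Integration.integrable_add integrable_abs integrable_mult_right) auto
    show "integrable lborel (up n q)" "integrable lborel (lo n q)"
      unfolding up_def lo_def
      by (rule Bochner_Integration.integrable_bound[OF b]; auto simp: indicator_def)+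
  qed
  have "AE t in lborel. up n q t = 0 \<longrightarrow> Z (up n q) t" "AE t in lborel. lo n q t = 0 \<longrightarrow> Z (lo n q) t" for n q
    unfolding Z_def by (intro AE_straddle_zero int; simp add: up_def lo_def)+
  then have "AE t in lborel. (up n q t = 0 \<longrightarrow> Z (up n q) t) \<and> (lo n q t = 0 \<longrightarrow> Z (lo n q) t)" for n q
    by (rule AE_conjI)
  then have "AE t in lborel. \<forall>n. \<forall>q\<in>\<rat>. (up n q t = 0 \<longrightarrow> Z (up n q) t) \<and> (lo n q t = 0 \<longrightarrow> Z (lo n q) t)"
    by (intro AE_all_countable[THEN iffD2] allI AE_ball_countable' countable_rat) auto
  then show ?thesis
  proof eventually_elim
    case (elim t)
    obtain n :: nat where n: "\<bar>t\<bar> < real n" using reals_Archimedean2 by blast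
    show ?case
    proof (intro allI impI)
      fix e :: real assume e: "0 < e"
      obtain q where q: "q \<in> \<rat>" "f t < q" "q < f t + e / 2"
        using Rats_dense_in_real[of "f t" "f t + e / 2"] e by auto
      obtain p where p: "p \<in> \<rat>" "f t - e / 2 < p" "p < f t"
        using Rats_dense_in_real[of "f t - e / 2" "f t"] e by auto
      have "Z (up n q) t" "Z (lo n p) t" using elim q p by (auto simp: up_def lo_def)
      moreover have "0 < e / 2" using e by simp
      ultimately obtain d1 d2 where d: "0 < d1" "0 < d2"
        and d1: "\<And>s u. s \<le> t \<and> t \<le> u \<and> u - s < d1 \<Longrightarrow> (LINT x:{s<..u}|lborel. up n q x) \<le> e / 2 * (u - s)"
        and d2: "\<And>s u. s \<le> t \<and> t \<le> u \<and> u - s < d2 \<Longrightarrow> (LINT x:{s<..u}|lborel. lo n p x) \<le> e / 2 * (u - s)"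
        unfolding Z_def by metis
      show "\<exists>d>0. \<forall>s u. s \<le> t \<and> t \<le> u \<and> u - s < d \<longrightarrow>
        \<bar>(LINT x:{s<..u}|lborel. f x) - f t * (u - s)\<bar> \<le> e * (u - s)"
      proof (intro exI[of _ "Min {d1, d2, real n - \<bar>t\<bar>}"] conjI allI impI)
        show "0 < Min {d1, d2, real n - \<bar>t\<bar>}" using d n by simp
        fix s u assume su: "s \<le> t \<and> t \<le> u \<and> u - s < Min {d1, d2, real n - \<bar>t\<bar>}"
        \<comment> \<open>The third entry of the minimum, \<open>real n - \<bar>t\<bar>\<close>,
          keeps the interval where the cut-off is inactive.\<close>
        then have sub: "{s<..u} \<subseteq> {- real n..real n}" by auto
        have cst: "(LINT x:{s<..u}|lborel. c) = c * (u - s)" for c :: real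
          using su by (simp add: set_lebesgue_integral_def mult.commute)
        have si: "set_integrable lborel {s<..u} (\<lambda>x. c)" for c :: real
          using su by (simp add: set_integrable_def)
        have "(LINT x:{s<..u}|lborel. f x) \<le> (LINT x:{s<..u}|lborel. q + up n q x)"
          using sub by (intro set_integral_mono set_integral_add set_integrable_lborel si f int)
            (auto simp: up_def indicator_def subset_iff)
        also have "\<dots> = q * (u - s) + (LINT x:{s<..u}|lborel. up n q x)"
          by (subst set_integral_add) (auto simp: cst si set_integrable_lborel int)
        also have "\<dots> \<le> q * (u - s) + e / 2 * (u - s)" using d1[of s u] su by simp
        also have "\<dots> \<le> (f t + e / 2) * (u - s) + e / 2 * (u - s)"
          using q su by (intro add_mono mult_right_mono) auto
        finally have 1: "(LINT x:{s<..u}|lborel. f x) \<le> f t * (u - s) + e * (u - s)"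
          by (simp add: algebra_simps)
        have "(LINT x:{s<..u}|lborel. p) \<le> (LINT x:{s<..u}|lborel. f x + lo n p x)"
          using sub by (intro set_integral_mono set_integral_add set_integrable_lborel si f int)
            (auto simp: lo_def indicator_def subset_iff)
        also have "\<dots> = (LINT x:{s<..u}|lborel. f x) + (LINT x:{s<..u}|lborel. lo n p x)"
          by (subst set_integral_add) (auto simp: set_integrable_lborel int f)
        also have "\<dots> \<le> (LINT x:{s<..u}|lborel. f x) + e / 2 * (u - s)" using d2[of s u] su by simp
        finally have "p * (u - s) \<le> (LINT x:{s<..u}|lborel. f x) + e / 2 * (u - s)" by (simp add: cst)
        moreover have "(f t - e / 2) * (u - s) \<le> p * (u - s)"
          using p su by (intro mult_right_mono) auto
        moreover have "e / 2 * (u - s) = e * (u - s) / 2" by simp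
        ultimately have 2: "f t * (u - s) - e * (u - s) \<le> (LINT x:{s<..u}|lborel. f x)"
          unfolding left_diff_distrib[of "f t"] by linarith
        show "\<bar>(LINT x:{s<..u}|lborel. f x) - f t * (u - s)\<bar> \<le> e * (u - s)"
          using 1 2 by linarith
      qed
    qed
  qed
qed

lemma DERIV_of_straddle:
  fixes F :: "real \<Rightarrow> real"
  assumes ab: "a < t" "t < b"
    and F: "\<And>s u. a \<le> s \<Longrightarrow> s \<le> u \<Longrightarrow> u \<le> b \<Longrightarrow> F u - F s = (LINT x:{s<..u}|lborel. f x)"
    and d: "\<forall>e>0. \<exists>d>0. \<forall>s u. s \<le> t \<and> t \<le> u \<and> u - s < d \<longrightarrow>
      \<bar>(LINT x:{s<..u}|lborel. f x) - D * (u - s)\<bar> \<le> e * (u - s)"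
  shows "(F has_real_derivative D) (at t)"
  unfolding has_field_derivative_def has_derivative_at_alt
proof (intro conjI allI impI)
  show "bounded_linear ((*) D)" by (rule bounded_linear_mult_right)
  fix e :: real assume "0 < e"
  then obtain d where d: "0 < d" and
    D: "\<And>s u. s \<le> t \<Longrightarrow> t \<le> u \<Longrightarrow> u - s < d \<Longrightarrow>
      \<bar>(LINT x:{s<..u}|lborel. f x) - D * (u - s)\<bar> \<le> e * (u - s)"
    using d by metis
  have "norm (F y - F t - D * (y - t)) \<le> e * norm (y - t)"
    if y: "norm (y - t) < Min {d, t - a, b - t}" for y
  proof (cases "t \<le> y")
    case True
    then show ?thesis using D[of t y] F[of t y] y ab by auto
  next
    case False
    then have "\<bar>(F t - F y) - D * (t - y)\<bar> \<le> e * (t - y)"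
      using D[of y t] F[of y t] y ab by auto
    moreover have "D * (y - t) = - (D * (t - y))" by (simp add: algebra_simps)
    ultimately show ?thesis using False by (simp add: abs_if split: if_splits)
  qed
  then show "\<exists>d>0. \<forall>y. norm (y - t) < d \<longrightarrow> norm (F y - F t - D * (y - t)) \<le> e * norm (y - t)"
    using d ab by (intro exI[of _ "Min {d, t - a, b - t}"]) auto
qed

section \<open>Absolutely continuous functions\<close>

lemma absolutely_continuous_indexed:
  fixes f :: "real \<Rightarrow> 'b::real_normed_vector"
  assumes f: "absolutely_continuous_on_interval a b f" and e: "0 < e"
  obtains \<delta> where "0 < \<delta>" "\<And>(J :: 'i set) u v. finite J \<Longrightarrow> (\<And>i. i \<in> J \<Longrightarrow> a \<le> u i \<and> u i \<le> v i \<and> v i \<le> b) \<Longrightarrow>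
    (\<And>i j. i \<in> J \<Longrightarrow> j \<in> J \<Longrightarrow> i \<noteq> j \<Longrightarrow> u i < v i \<Longrightarrow> u j < v j \<Longrightarrow> v i \<le> u j \<or> v j \<le> u i) \<Longrightarrow>
    (\<Sum>i\<in>J. v i - u i) < \<delta> \<Longrightarrow> (\<Sum>i\<in>J. norm (f (v i) - f (u i))) < e"
proof -
  obtain \<delta> where \<delta>: "0 < \<delta>" and D: "\<And>I :: (real \<times> real) set.
        finite I \<and> (\<forall>(u, v)\<in>I. a \<le> u \<and> u \<le> v \<and> v \<le> b) \<and>
        (\<forall>p\<in>I. \<forall>q\<in>I. p \<noteq> q \<longrightarrow> snd p \<le> fst q \<or> snd q \<le> fst p) \<and>
        (\<Sum>(u, v)\<in>I. v - u) < \<delta> \<Longrightarrow> (\<Sum>(u, v)\<in>I. norm (f v - f u)) < e"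
    using f e unfolding absolutely_continuous_on_interval_def by blast
  show thesis
  proof (rule that[OF \<delta>])
    fix J :: "'i set" and u v
    assume J: "finite J" and uv: "\<And>i. i \<in> J \<Longrightarrow> a \<le> u i \<and> u i \<le> v i \<and> v i \<le> b"
      and ord: "\<And>i j. i \<in> J \<Longrightarrow> j \<in> J \<Longrightarrow> i \<noteq> j \<Longrightarrow> u i < v i \<Longrightarrow> u j < v j \<Longrightarrow> v i \<le> u j \<or> v j \<le> u i"
      and sm: "(\<Sum>i\<in>J. v i - u i) < \<delta>"
    define J' where "J' = {i \<in> J. u i < v i}"
    have inj: "inj_on (\<lambda>i. (u i, v i)) J'"
      using ord by (intro inj_onI) (fastforce simp: J'_def)
    have e1: "(\<Sum>i\<in>J. v i - u i) = (\<Sum>i\<in>J'. v i - u i)"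
      using uv J by (intro sum.mono_neutral_right) (force simp: J'_def)+
    have e2: "(\<Sum>i\<in>J. norm (f (v i) - f (u i))) = (\<Sum>i\<in>J'. norm (f (v i) - f (u i)))"
    proof (intro sum.mono_neutral_right ballI)
      fix i assume "i \<in> J - J'"
      then have "u i = v i" using uv[of i] by (auto simp: J'_def)
      then show "norm (f (v i) - f (u i)) = 0" by simp
    qed (use J in \<open>auto simp: J'_def\<close>)
    let ?I = "(\<lambda>i. (u i, v i)) ` J'"
    have "(\<Sum>(u, v)\<in>?I. norm (f v - f u)) < e"
    proof (rule D, intro conjI ballI impI)
      show "finite ?I" using J by (simp add: J'_def)
      show "(\<Sum>(u, v)\<in>?I. v - u) < \<delta>" using sm by (simp add: e1 sum.reindex[OF inj])
      show "case p of (u, v) \<Rightarrow> a \<le> u \<and> u \<le> v \<and> v \<le> b" if "p \<in> ?I" for p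
        using that uv by (auto simp: J'_def)
      show "snd p \<le> fst q \<or> snd q \<le> fst p" if pq: "p \<in> ?I" "q \<in> ?I" "p \<noteq> q" for p q
      proof -
        obtain i where i: "i \<in> J'" "p = (u i, v i)" using pq(1) by blast
        obtain j where j: "j \<in> J'" "q = (u j, v j)" using pq(2) by blast
        note ij = i j
        have "i \<noteq> j" using pq(3) ij by auto
        then show ?thesis using ord[of i j] ij by (simp add: J'_def)
      qed
    qed
    then show "(\<Sum>i\<in>J. norm (f (v i) - f (u i))) < e"
      by (simp add: e2 sum.reindex[OF inj])
  qed
qed

lemma absolutely_continuous_imp_continuous_on:
  fixes f :: "real \<Rightarrow> 'b::real_normed_vector"
  assumes f: "absolutely_continuous_on_interval a b f"
  shows "continuous_on {a..b} f"
  unfolding continuous_on_iff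
proof (intro ballI allI impI)
  fix x e :: real assume x: "x \<in> {a..b}" and e: "0 < e"
  obtain \<delta> where \<delta>: "0 < \<delta>" and D: "\<And>(J :: unit set) u v. finite J \<Longrightarrow> (\<And>i. i \<in> J \<Longrightarrow> a \<le> u i \<and> u i \<le> v i \<and> v i \<le> b) \<Longrightarrow>
    (\<And>i j. i \<in> J \<Longrightarrow> j \<in> J \<Longrightarrow> i \<noteq> j \<Longrightarrow> u i < v i \<Longrightarrow> u j < v j \<Longrightarrow> v i \<le> u j \<or> v j \<le> u i) \<Longrightarrow>
    (\<Sum>i\<in>J. v i - u i) < \<delta> \<Longrightarrow> (\<Sum>i\<in>J. norm (f (v i) - f (u i))) < e"
    by (fact absolutely_continuous_indexed[OF f e, where 'i = unit])
  have "dist (f y) (f x) < e" if y: "y \<in> {a..b}" "dist y x < \<delta>" for y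
  proof -
    have "(\<Sum>i\<in>{()}. norm (f (max x y) - f (min x y))) < e"
      by (rule D) (use x y in \<open>auto simp: dist_real_def\<close>)
    then show ?thesis
      by (cases "x \<le> y") (simp_all add: dist_norm norm_minus_commute)
  qed
  then show "\<exists>d>0. \<forall>x'\<in>{a..b}. dist x' x < d \<longrightarrow> dist (f x') (f x) < e" using \<delta> by blast
qed

lemma absolutely_continuous_add:
  fixes f g :: "real \<Rightarrow> 'b::real_normed_vector"
  assumes f: "absolutely_continuous_on_interval a b f" and g: "absolutely_continuous_on_interval a b g"
  shows "absolutely_continuous_on_interval a b (\<lambda>x. f x + g x)"
  unfolding absolutely_continuous_on_interval_def
proof (intro allI impI)
  fix e :: real assume e: "0 < e"
  define P where "P \<delta> I = (finite I \<and> (\<forall>(u, v)\<in>I. a \<le> u \<and> u \<le> v \<and> v \<le> b) \<and>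
        (\<forall>p\<in>I. \<forall>q\<in>I. p \<noteq> q \<longrightarrow> snd p \<le> fst q \<or> snd q \<le> fst p) \<and>
        (\<Sum>(u, v)\<in>I. v - u) < \<delta>)" for \<delta> and I :: "(real \<times> real) set"
  have e2: "0 < e / 2" using e by simp
  obtain d1 where d1: "0 < d1" "\<And>I. P d1 I \<Longrightarrow> (\<Sum>(u, v)\<in>I. norm (f v - f u)) < e / 2"
    using f e2 unfolding absolutely_continuous_on_interval_def P_def by blast
  obtain d2 where d2: "0 < d2" "\<And>I. P d2 I \<Longrightarrow> (\<Sum>(u, v)\<in>I. norm (g v - g u)) < e / 2"
    using g e2 unfolding absolutely_continuous_on_interval_def P_def by blast
  have "(\<Sum>(u, v)\<in>I. norm (f v + g v - (f u + g u))) < e" if "P (min d1 d2) I" for I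
  proof -
    have "P d1 I" "P d2 I" using that by (auto simp: P_def)
    moreover have "(\<Sum>(u, v)\<in>I. norm (f v + g v - (f u + g u)))
        \<le> (\<Sum>(u, v)\<in>I. norm (f v - f u)) + (\<Sum>(u, v)\<in>I. norm (g v - g u))"
      unfolding sum.distrib[symmetric] case_prod_beta
      by (intro sum_mono) (simp add: norm_diff_triangle_ineq)
    ultimately show ?thesis using d1 d2 by fastforce
  qed
  then show "\<exists>\<delta>>0. \<forall>I :: (real \<times> real) set. finite I \<and> (\<forall>(u, v)\<in>I. a \<le> u \<and> u \<le> v \<and> v \<le> b) \<and>
        (\<forall>p\<in>I. \<forall>q\<in>I. p \<noteq> q \<longrightarrow> snd p \<le> fst q \<or> snd q \<le> fst p) \<and>
        (\<Sum>(u, v)\<in>I. v - u) < \<delta> \<longrightarrow> (\<Sum>(u, v)\<in>I. norm (f v + g v - (f u + g u))) < e"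
    using d1(1) d2(1) unfolding P_def by (intro exI[of _ "min d1 d2"]) auto
qed

text \<open>Split \<open>f\<close> at a level \<open>m\<close>: it is at most \<open>m\<close> plus
  the excess \<open>max 0 (f x - m)\<close>. The integral of the excess over the whole line is small
  for large \<open>m\<close> by dominated convergence, and the constant \<open>m\<close> only sees
  the total length.\<close>

lemma absolutely_continuous_of_dominated:
  fixes F :: "real \<Rightarrow> 'b::real_normed_vector"
  assumes f: "integrable lborel f" and f0: "\<And>x. 0 \<le> f x"
    and F: "\<And>s u. a \<le> s \<Longrightarrow> s \<le> u \<Longrightarrow> u \<le> b \<Longrightarrow> norm (F u - F s) \<le> (LINT x:{s<..u}|lborel. f x)"
  shows "absolutely_continuous_on_interval a b F"
  unfolding absolutely_continuous_on_interval_def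
proof (intro allI impI)
  fix e :: real assume e: "0 < e"
  have [measurable]: "f \<in> borel_measurable borel" using f by auto
  define g where "g m x = max 0 (f x - real m)" for m x
  have g0: "0 \<le> g m x" for m x by (simp add: g_def)
  have gi: "integrable lborel (g m)" for m
    unfolding g_def by (rule Bochner_Integration.integrable_bound[OF f]) (auto simp: f0)
  have "(\<lambda>m. LINT x|lborel. g m x) \<longlonglongrightarrow> (LINT x|(lborel :: real measure). 0)"
  proof (rule integral_dominated_convergence[where w = f])
    show "AE x in lborel. (\<lambda>m. g m x) \<longlonglongrightarrow> 0"
    proof (rule AE_I2)
      fix x
      obtain k :: nat where "f x < real k" using reals_Archimedean2 by blast
      then have "eventually (\<lambda>m. g m x = 0) sequentially"
        by (intro eventually_sequentiallyI[of k]) (simp add: g_def)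
      then show "(\<lambda>m. g m x) \<longlonglongrightarrow> 0" by (rule tendsto_eventually)
    qed
    show "AE x in lborel. norm (g m x) \<le> f x" for m by (auto simp: g_def f0)
  qed (use f in \<open>auto simp: g_def\<close>)
  then have "(\<lambda>m. LINT x|lborel. g m x) \<longlonglongrightarrow> 0" by simp
  then have "eventually (\<lambda>m. (LINT x|lborel. g m x) < e / 2) sequentially"
    using e by (intro order_tendstoD) auto
  then obtain m where m: "(LINT x|lborel. g m x) < e / 2"
    by (auto simp: eventually_sequentially)
  show "\<exists>\<delta>>0. \<forall>I :: (real \<times> real) set. finite I \<and> (\<forall>(u, v)\<in>I. a \<le> u \<and> u \<le> v \<and> v \<le> b) \<and>
        (\<forall>p\<in>I. \<forall>q\<in>I. p \<noteq> q \<longrightarrow> snd p \<le> fst q \<or> snd q \<le> fst p) \<and>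
        (\<Sum>(u, v)\<in>I. v - u) < \<delta> \<longrightarrow> (\<Sum>(u, v)\<in>I. norm (F v - F u)) < e"
  proof (intro exI[of _ "e / (2 * (real m + 1))"] conjI allI impI)
    \<comment> \<open>Total length below this value costs at most \<open>e / 2\<close> through the
      constant \<open>m\<close>, and the excess costs less than the other half; the
      \<open>+ 1\<close> takes care of \<open>m = 0\<close>.\<close>
    show "0 < e / (2 * (real m + 1))" using e by simp
    fix I :: "(real \<times> real) set"
    assume I: "finite I \<and> (\<forall>(u, v)\<in>I. a \<le> u \<and> u \<le> v \<and> v \<le> b) \<and>
        (\<forall>p\<in>I. \<forall>q\<in>I. p \<noteq> q \<longrightarrow> snd p \<le> fst q \<or> snd q \<le> fst p) \<and>
        (\<Sum>(u, v)\<in>I. v - u) < e / (2 * (real m + 1))"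
    have dis: "disjoint_family_on (\<lambda>p. {fst p<..snd p}) I"
      unfolding disjoint_family_on_def
    proof (intro ballI impI)
      fix p q assume "p \<in> I" "q \<in> I" "p \<noteq> q"
      then have "snd p \<le> fst q \<or> snd q \<le> fst p" using I by blast
      then show "{fst p<..snd p} \<inter> {fst q<..snd q} = {}" by auto
    qed
    have "(\<Sum>(u, v)\<in>I. norm (F v - F u)) \<le> (\<Sum>p\<in>I. real m * (snd p - fst p) + (LINT x:{fst p<..snd p}|lborel. g m x))"
      unfolding case_prod_beta
    proof (rule sum_mono)
      fix p assume p: "p \<in> I"
      obtain u v where uv: "p = (u, v)" by fastforce
      have "a \<le> u" "u \<le> v" "v \<le> b" using I p uv by auto
      then have "norm (F v - F u) \<le> (LINT x:{u<..v}|lborel. f x)" by (rule F)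
      also have "\<dots> \<le> (LINT x:{u<..v}|lborel. real m + g m x)"
      proof (rule set_integral_mono)
        show "set_integrable lborel {u<..v} (\<lambda>x. real m + g m x)"
          using \<open>u \<le> v\<close> by (rule_tac set_integral_add(1)) (auto simp: set_integrable_lborel gi, simp add: set_integrable_def)
      qed (auto simp: g_def set_integrable_lborel f)
      also have "\<dots> = (LINT x:{u<..v}|lborel. real m) + (LINT x:{u<..v}|lborel. g m x)"
        using \<open>u \<le> v\<close> by (rule_tac set_integral_add(2)) (auto simp: set_integrable_lborel gi, simp add: set_integrable_def)
      also have "(LINT x:{u<..v}|lborel. real m) = real m * (v - u)"
        using \<open>u \<le> v\<close> by (simp add: set_lebesgue_integral_def mult.commute)
      finally show "norm (F (snd p) - F (fst p)) \<le> real m * (snd p - fst p) + (LINT x:{fst p<..snd p}|lborel. g m x)"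
        by (simp add: uv)
    qed
    also have "\<dots> = real m * (\<Sum>(u, v)\<in>I. v - u) + (\<Sum>p\<in>I. LINT x:{fst p<..snd p}|lborel. g m x)"
      by (simp add: sum.distrib sum_distrib_left case_prod_beta)
    also have "(\<Sum>p\<in>I. LINT x:{fst p<..snd p}|lborel. g m x) = (LINT x:(\<Union>p\<in>I. {fst p<..snd p})|lborel. g m x)"
      using I dis by (intro set_integral_finite_Union[symmetric] set_integrable_lborel gi) auto
    also have "\<dots> \<le> (LINT x|lborel. g m x)"
      unfolding set_lebesgue_integral_def
      using I g0 by (intro integral_mono integrable_mult_indicator gi) (auto simp: indicator_def intro!: sets.finite_UN)
    also have "real m * (\<Sum>(u, v)\<in>I. v - u) \<le> real m * (e / (2 * (real m + 1)))"
      using I by (intro mult_left_mono) auto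
    also have "\<dots> \<le> e / 2" using e by (simp add: field_simps)
    finally show "(\<Sum>(u, v)\<in>I. norm (F v - F u)) < e" using m by simp
  qed
qed

section \<open>Densities of monotone absolutely continuous functions\<close>

text \<open>Cover \<open>K\<close> by the cells of a grid so fine that they stay inside an open set
  of Lebesgue measure below \<delta>. Compactness leaves finitely many cells, as the definition of
  absolute continuity demands, and their \<open>N\<close>-measures are increments of
  \<open>g\<close>. Cells are half-open, so that they are disjoint and of the form on which
  \<open>N\<close> is known; the clamping to \<open>{a..b}\<close> handles cells that stick
  out.\<close>

lemma emeasure_null_of_absolutely_continuous:
  fixes g :: "real \<Rightarrow> real"
  assumes ab: "a \<le> b" and g: "absolutely_continuous_on_interval a b g"
    and sN: "sets N = sets borel"
    and N: "\<And>s t. s \<le> t \<Longrightarrow> emeasure N {s<..t} = ennreal (g (max a (min b t)) - g (max a (min b s)))"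
    and K: "compact K" "emeasure lborel K = 0"
  shows "emeasure N K = 0"
proof -
  define c where "c t = max a (min b t)" for t
  have cm: "a \<le> c s" "c s \<le> c t" "c t \<le> b" if "s \<le> t" for s t
    using that ab by (auto simp: c_def)
  have cd: "c t - c s \<le> t - s" if "s \<le> t" for s t
    using that ab by (auto simp: c_def)
  have "emeasure N K \<le> ennreal e" if e: "0 < e" for e
  proof -
    obtain \<delta> where \<delta>: "0 < \<delta>" and D: "\<And>(J :: int set) u v. finite J \<Longrightarrow> (\<And>i. i \<in> J \<Longrightarrow> a \<le> u i \<and> u i \<le> v i \<and> v i \<le> b) \<Longrightarrow>
      (\<And>i j. i \<in> J \<Longrightarrow> j \<in> J \<Longrightarrow> i \<noteq> j \<Longrightarrow> u i < v i \<Longrightarrow> u j < v j \<Longrightarrow> v i \<le> u j \<or> v j \<le> u i) \<Longrightarrow>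
      (\<Sum>i\<in>J. v i - u i) < \<delta> \<Longrightarrow> (\<Sum>i\<in>J. norm (g (v i) - g (u i))) < e"
      by (fact absolutely_continuous_indexed[OF g e, where 'i = int])
    have Kb: "K \<in> sets borel" using K by (simp add: borel_compact)
    obtain U where U: "open U" "K \<subseteq> U" "emeasure lborel (U - K) < \<delta>"
      using outer_regular_lborel[OF Kb \<delta>] by blast
    have "emeasure lborel U \<le> emeasure lborel K + emeasure lborel (U - K)"
      using U Kb by (subst plus_emeasure) (auto intro!: emeasure_mono)
    then have mU: "emeasure lborel U < \<delta>" using U K by simp
    obtain r where r: "0 < r" "(\<Union>x\<in>K. ball x r) \<subseteq> U"
      using compact_subset_open_imp_ball_epsilon_subset[OF K(1) U(1,2)] by blast
    \<comment> \<open>Cells shorter than \<open>r\<close> that meet \<open>K\<close> remain within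
      the \<open>r\<close>-neighbourhood of \<open>K\<close>, hence in \<open>U\<close>.\<close>
    define h where "h = r / 2"
    have h: "0 < h" using r by (simp add: h_def)
    define cell where "cell k = {h * of_int k<..h * (of_int k + 1)}" for k :: int
    have cell_iff: "x \<in> cell k \<longleftrightarrow> k = \<lceil>x / h\<rceil> - 1" for x k
    proof -
      have "x \<in> cell k \<longleftrightarrow> of_int k < x / h \<and> x / h \<le> of_int k + 1"
        using h by (simp add: cell_def pos_less_divide_eq pos_divide_le_eq mult.commute)
      also have "\<dots> \<longleftrightarrow> k = \<lceil>x / h\<rceil> - 1" by linarith
      finally show ?thesis .
    qed
    define J where "J = (\<lambda>x. \<lceil>x / h\<rceil> - 1) ` K"
    have "bounded K" using K(1) compact_imp_bounded by blast
    then obtain B where B: "\<And>x. x \<in> K \<Longrightarrow> \<bar>x\<bar> \<le> B" unfolding bounded_real by blast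
    have "J \<subseteq> {\<lceil>- B / h\<rceil> - 1..\<lceil>B / h\<rceil> - 1}"
    proof
      fix k assume "k \<in> J"
      then obtain x where x: "x \<in> K" "k = \<lceil>x / h\<rceil> - 1" by (auto simp: J_def)
      have "- B / h \<le> x / h" "x / h \<le> B / h"
        using B[OF x(1)] h by (auto simp: divide_simps)
      then show "k \<in> {\<lceil>- B / h\<rceil> - 1..\<lceil>B / h\<rceil> - 1}"
        using ceiling_mono[of "- B / h" "x / h"] ceiling_mono[of "x / h" "B / h"] x by simp
    qed
    then have J: "finite J" using finite_subset by blast
    have sub: "cell k \<subseteq> U" if k: "k \<in> J" for k
    proof
      fix y assume y: "y \<in> cell k"
      obtain x where x: "x \<in> K" "x \<in> cell k" using k cell_iff by (auto simp: J_def)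
      have "dist x y < r"
        using x y r by (auto simp: cell_def dist_real_def h_def algebra_simps)
      then have "y \<in> ball x r" by simp
      then show "y \<in> U" using r(2) x(1) by blast
    qed
    have dis: "disjoint_family_on cell J"
      unfolding disjoint_family_on_def
    proof (intro ballI impI)
      fix i j :: int assume "i \<noteq> j"
      then show "cell i \<inter> cell j = {}" by (metis cell_iff disjoint_iff)
    qed
    have mc: "cell k \<in> sets borel" for k by (simp add: cell_def)
    have "ennreal (\<Sum>k\<in>J. h) = (\<Sum>k\<in>J. emeasure lborel (cell k))"
      using h by (subst sum_ennreal[symmetric]) (auto simp: cell_def algebra_simps intro!: sum.cong)
    also have "\<dots> = emeasure lborel (\<Union>(cell ` J))"
      using J mc by (intro sum_emeasure dis) auto
    also have "\<dots> \<le> emeasure lborel U"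
      using sub U by (intro emeasure_mono) auto
    also note mU
    finally have "ennreal (\<Sum>k\<in>J. h) < ennreal \<delta>" .
    moreover have "0 \<le> (\<Sum>k\<in>J. h)" using h by (intro sum_nonneg) simp
    ultimately have sJ: "(\<Sum>k\<in>J. h) < \<delta>" by (simp only: ennreal_less_iff)
    let ?u = "\<lambda>k. c (h * of_int k)" and ?v = "\<lambda>k. c (h * (of_int k + 1))"
    have le: "h * of_int k \<le> h * (of_int k + 1)" for k :: int using h by simp
    have sg: "(\<Sum>k\<in>J. norm (g (?v k) - g (?u k))) < e"
    proof (rule D[OF J])
      show "a \<le> ?u k \<and> ?u k \<le> ?v k \<and> ?v k \<le> b" for k using cm[OF le[of k]] by simp
      have "?v k - ?u k \<le> h" for k using cd[OF le[of k]] by (simp add: algebra_simps)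
      then have "(\<Sum>k\<in>J. ?v k - ?u k) \<le> (\<Sum>k\<in>J. h)" by (intro sum_mono)
      then show "(\<Sum>k\<in>J. ?v k - ?u k) < \<delta>" using sJ by simp
      fix i j :: int assume "i \<noteq> j"
      then have "i + 1 \<le> j \<or> j + 1 \<le> i" by linarith
      then have "real_of_int i + 1 \<le> real_of_int j \<or> real_of_int j + 1 \<le> real_of_int i"
        by linarith
      then have "h * (real_of_int i + 1) \<le> h * real_of_int j \<or> h * (real_of_int j + 1) \<le> h * real_of_int i"
        using h by simp
      then show "?v i \<le> ?u j \<or> ?v j \<le> ?u i"
        using cm(2) by blast
    qed
    have "emeasure N K \<le> emeasure N (\<Union>(cell ` J))"
    proof (rule emeasure_mono)
      show "K \<subseteq> \<Union>(cell ` J)" unfolding J_def using cell_iff by blast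
      show "\<Union>(cell ` J) \<in> sets N" unfolding sN using J mc by (intro sets.finite_UN) auto
    qed
    also have "\<dots> = (\<Sum>k\<in>J. emeasure N (cell k))"
      using J mc sN by (intro sum_emeasure[symmetric] dis) auto
    also have "\<dots> = (\<Sum>k\<in>J. ennreal (g (?v k) - g (?u k)))"
      unfolding cell_def by (intro sum.cong refl) (simp add: N[OF le] c_def)
    also have "\<dots> \<le> (\<Sum>k\<in>J. ennreal (norm (g (?v k) - g (?u k))))"
      by (intro sum_mono ennreal_leI) auto
    also have "\<dots> = ennreal (\<Sum>k\<in>J. norm (g (?v k) - g (?u k)))"
      by (rule sum_ennreal) auto
    also have "\<dots> \<le> ennreal e" using sg by (intro ennreal_leI) auto
    finally show ?thesis .
  qed
  note le_e = this
  have "emeasure N K \<le> 0"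
    by (rule ennreal_le_epsilon) (simp add: le_e)
  then show ?thesis by simp
qed

text \<open>Extend \<open>g\<close> by constants to \<open>G\<close> on the line and form its
  Stieltjes measure, which is finite. By inner regularity it suffices to test Lebesgue null sets on
  their compact subsets, where the previous lemma applies. So the measure is absolutely continuous
  and its Radon-Nikodym derivative is the density; passing from \<open>ennreal\<close> to real
  values changes it only on a null set.\<close>

theorem absolutely_continuous_mono_density:
  fixes g :: "real \<Rightarrow> real"
  assumes ab: "a \<le> b" and g: "absolutely_continuous_on_interval a b g" and mono: "mono_on {a..b} g"
  obtains f where "integrable lborel f" "\<And>x. 0 \<le> f x"
    "\<And>s t. a \<le> s \<Longrightarrow> s \<le> t \<Longrightarrow> t \<le> b \<Longrightarrow> g t - g s = (LINT x:{s<..t}|lborel. f x)"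
proof -
  define G where "G t = g (max a (min b t))" for t
  have Gm: "G s \<le> G t" if "s \<le> t" for s t
    unfolding G_def using that ab by (intro mono_onD[OF mono]) auto
  have "continuous_on UNIV G"
    unfolding G_def
    by (rule continuous_on_compose2[OF absolutely_continuous_imp_continuous_on[OF g]])
      (use ab in \<open>auto intro!: continuous_intros\<close>)
  then have Gc: "continuous (at_right x) G" for x
    by (simp add: continuous_on_eq_continuous_within continuous_at_imp_continuous_within)
  define N where "N = interval_measure G"
  have sN: "sets N = sets borel" by (simp add: N_def)
  have N: "emeasure N {s<..t} = ennreal (G t - G s)" if "s \<le> t" for s t
    unfolding N_def by (rule emeasure_interval_measure_Ioc[OF that]) (auto intro: Gm Gc)
  have "emeasure N UNIV \<le> ennreal (g b - g a)"
  proof -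
    have U: "UNIV = (\<Union>n. {- real n<..real n})"
    proof (intro set_eqI iffI UNIV_I)
      fix x :: real
      obtain n :: nat where "\<bar>x\<bar> < real n" using reals_Archimedean2 by blast
      then show "x \<in> (\<Union>n. {- real n<..real n})" by (intro UN_I[of n]) auto
    qed
    have "emeasure N UNIV = (SUP n. emeasure N {- real n<..real n})"
      unfolding U by (rule SUP_emeasure_incseq[symmetric]) (auto simp: sN incseq_def)
    also have "\<dots> \<le> ennreal (g b - g a)"
    proof (rule SUP_least)
      fix n :: nat
      have "G (real n) \<le> g b" "g a \<le> G (- real n)"
        unfolding G_def using ab by (intro mono_onD[OF mono]; auto)+
      then show "emeasure N {- real n<..real n} \<le> ennreal (g b - g a)"
        by (subst N) (auto intro!: ennreal_leI)
    qed
    finally show ?thesis .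
  qed
  then have finN: "emeasure N UNIV \<noteq> \<infinity>" by (auto simp: top_unique)
  then have finN': "emeasure N (space N) \<noteq> \<infinity>" by (simp add: N_def)
  have ac: "absolutely_continuous lborel N"
    unfolding absolutely_continuous_def
  proof
    fix A assume A: "A \<in> null_sets (lborel :: real measure)"
    then have Ab: "A \<in> sets borel" by auto
    have "emeasure N K = 0" if "K \<subseteq> A" "compact K" for K
    proof (rule emeasure_null_of_absolutely_continuous[OF ab g sN _ that(2)])
      show "emeasure lborel K = 0"
        using A that(1) borel_compact[OF that(2)]
        by (metis emeasure_eq_0 null_setsD1 null_setsD2 sets_lborel)
    qed (simp add: N G_def)
    then have "emeasure N A = 0"
      unfolding inner_regular[OF sN finN' Ab] bot_ennreal[symmetric] by (auto intro!: SUP_eq_const simp: bot_ennreal)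
    then show "A \<in> null_sets N" using Ab sN by auto
  qed
  obtain h where h[measurable]: "h \<in> borel_measurable lborel" and hN: "density lborel h = N"
    using sigma_finite_measure.Radon_Nikodym[OF lborel.sigma_finite_measure_axioms ac] sN by auto
  have hA: "emeasure N A = (\<integral>\<^sup>+x. h x * indicator A x \<partial>lborel)" if "A \<in> sets borel" for A
    unfolding hN[symmetric] using that by (subst emeasure_density) auto
  have ih: "(\<integral>\<^sup>+x. h x \<partial>lborel) \<noteq> \<infinity>" using finN hA[of UNIV] by simp
  then have hfin: "AE x in lborel. h x \<noteq> \<infinity>" by (intro nn_integral_noteq_infinite) auto
  define f where "f x = enn2real (h x)" for x
  have [measurable]: "f \<in> borel_measurable borel" unfolding f_def using h by measurable
  have f0: "0 \<le> f x" for x by (simp add: f_def)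
  have hf: "AE x in lborel. ennreal (f x) = h x"
    using hfin by eventually_elim (simp add: f_def less_top)
  have "(\<integral>\<^sup>+x. ennreal (f x) \<partial>lborel) = (\<integral>\<^sup>+x. h x \<partial>lborel)"
    using hf by (intro nn_integral_cong_AE)
  then have fi: "integrable lborel f"
    using ih f0 by (intro integrableI_nonneg) (auto simp: less_top)
  have "g t - g s = (LINT x:{s<..t}|lborel. f x)" if "a \<le> s" "s \<le> t" "t \<le> b" for s t
  proof -
    have "ennreal (LINT x:{s<..t}|lborel. f x) = (\<integral>\<^sup>+x. ennreal (indicator {s<..t} x *\<^sub>R f x) \<partial>lborel)"
      unfolding set_lebesgue_integral_def
      using f0 by (intro nn_integral_eq_integral[symmetric] integrable_mult_indicator fi) auto
    also have "\<dots> = (\<integral>\<^sup>+x. h x * indicator {s<..t} x \<partial>lborel)"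
      using hf by (intro nn_integral_cong_AE) (auto simp: indicator_def)
    also have "\<dots> = ennreal (G t - G s)" using N[OF that(2)] hA by simp
    finally have "(LINT x:{s<..t}|lborel. f x) = G t - G s"
      using Gm[OF that(2)] f0 by (subst (asm) ennreal_inj) (auto simp: set_lebesgue_integral_def intro!: integral_nonneg_AE)
    then show ?thesis using that by (simp add: G_def)
  qed
  then show thesis using that fi f0 by blast
qed

section \<open>From derivatives almost everywhere to monotonicity\<close>

lemma AE_less_endpoints:
  assumes "AE t in lborel. t \<in> {a<..<b} \<longrightarrow> P t"
  shows "AE t in lborel. t \<in> {a..b::real} \<longrightarrow> P t"
proof -
  have "AE t in lborel. t \<noteq> c" for c :: real by (rule AE_lborel_singleton)
  from this[of a] this[of b] assms show ?thesis by eventually_elim auto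
qed

text \<open>A gauge argument. At a point with nonpositive derivative the gauge is so small that
  straddling intervals have increment at most \<open>e\<close> times their length. At a point of the
  exceptional null set the gauge is an open \<open>U\<close> of measure below \<delta>, so absolute
  continuity bounds the total increment over all intervals tagged there. A fine tagged division adds
  up both kinds.\<close>

lemma absolutely_continuous_deriv_nonpos:
  fixes w :: "real \<Rightarrow> real"
  assumes ab: "a \<le> b" and w: "absolutely_continuous_on_interval a b w"
    and d: "AE t in lborel. t \<in> {a..b} \<longrightarrow> (\<exists>D\<le>0. (w has_real_derivative D) (at t within {a..b}))"
  shows "w b \<le> w a"
proof (rule field_le_epsilon)
  fix \<eta> :: real assume \<eta>: "0 < \<eta>"
  \<comment> \<open>One \<open>e\<close> pays for the exceptional tags, \<open>e * (b - a)\<close>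
    for the regular ones.\<close>
  define e where "e = \<eta> / (1 + (b - a))"
  have e: "0 < e" using \<eta> ab by (simp add: e_def)
  have "e * (1 + (b - a)) = \<eta>" using ab by (simp add: e_def)
  then have e_eq: "e + e * (b - a) = \<eta>" by (simp add: distrib_left)
  obtain \<delta> where \<delta>: "0 < \<delta>" and D: "\<And>(J :: (real \<times> real set) set) u v. finite J \<Longrightarrow> (\<And>i. i \<in> J \<Longrightarrow> a \<le> u i \<and> u i \<le> v i \<and> v i \<le> b) \<Longrightarrow>
      (\<And>i j. i \<in> J \<Longrightarrow> j \<in> J \<Longrightarrow> i \<noteq> j \<Longrightarrow> u i < v i \<Longrightarrow> u j < v j \<Longrightarrow> v i \<le> u j \<or> v j \<le> u i) \<Longrightarrow>
      (\<Sum>i\<in>J. v i - u i) < \<delta> \<Longrightarrow> (\<Sum>i\<in>J. norm (w (v i) - w (u i))) < e"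
    by (fact absolutely_continuous_indexed[OF w e, where 'i = "real \<times> real set"])
  obtain N where N: "N \<in> null_sets lborel"
    and good: "\<And>t. t \<in> {a..b} \<Longrightarrow> t \<notin> N \<Longrightarrow> \<exists>D\<le>0. (w has_real_derivative D) (at t within {a..b})"
    using d by (auto elim!: AE_E3)
  have "N \<in> sets borel" using N by auto
  then obtain U where U: "open U" "N \<subseteq> U" "emeasure lborel (U - N) < \<delta>"
    using outer_regular_lborel[OF _ \<delta>] by blast
  have "emeasure lborel U \<le> emeasure lborel N + emeasure lborel (U - N)"
    using U \<open>N \<in> sets borel\<close> by (subst plus_emeasure) (auto intro!: emeasure_mono)
  then have mU: "emeasure lborel U < \<delta>" using U N by (simp add: null_setsD1)
  have "\<exists>r>0. \<forall>x y. a \<le> x \<and> x \<le> t \<and> t \<le> y \<and> y \<le> b \<and> t - x < r \<and> y - t < r \<longrightarrow> w y - w x \<le> e * (y - x)"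
    if t: "t \<in> {a..b}" "t \<notin> N" for t
  proof -
    obtain D where D0: "D \<le> 0" and D: "(w has_real_derivative D) (at t within {a..b})"
      using good t by blast
    obtain r where r: "0 < r" and R: "\<And>y. y \<in> {a..b} \<Longrightarrow> norm (y - t) < r \<Longrightarrow> norm (w y - w t - D * (y - t)) \<le> e * norm (y - t)"
      using D e unfolding has_field_derivative_def has_derivative_within_alt by blast
    have "w y - w x \<le> e * (y - x)"
      if xy: "a \<le> x" "x \<le> t" "t \<le> y" "y \<le> b" "t - x < r" "y - t < r" for x y
    proof -
      have "\<bar>w y - w t - D * (y - t)\<bar> \<le> e * (y - t)" "\<bar>w x - w t - D * (x - t)\<bar> \<le> e * (t - x)"
        using R[of y] R[of x] xy by auto
      moreover have "D * (y - t) \<le> 0" "0 \<le> D * (x - t)"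
        using D0 xy by (auto simp: mult_nonpos_nonneg mult_nonpos_nonpos)
      ultimately have "w y - w x \<le> e * (y - t) + e * (t - x)" by linarith
      then show ?thesis by (simp add: algebra_simps)
    qed
    then show ?thesis using r by blast
  qed
  then obtain r where r: "\<And>t. t \<in> {a..b} \<Longrightarrow> t \<notin> N \<Longrightarrow> 0 < r t"
    and R: "\<And>t x y. t \<in> {a..b} \<Longrightarrow> t \<notin> N \<Longrightarrow> a \<le> x \<Longrightarrow> x \<le> t \<Longrightarrow> t \<le> y \<Longrightarrow> y \<le> b \<Longrightarrow> t - x < r t \<Longrightarrow> y - t < r t \<Longrightarrow> w y - w x \<le> e * (y - x)"
    by metis
  define \<gamma> where "\<gamma> t = (if t \<in> N then U else if t \<in> {a..b} then ball t (r t) else UNIV)" for t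
  have "gauge \<gamma>"
    unfolding gauge_def \<gamma>_def using U r by auto
  then obtain p where p: "p tagged_division_of {a..b}" "\<gamma> fine p"
    using fine_division_exists_real by blast
  have pK: "x \<in> K \<and> K = {Inf K..Sup K} \<and> Inf K \<le> Sup K \<and> a \<le> Inf K \<and> Sup K \<le> b \<and> K \<subseteq> \<gamma> x \<and> x \<in> {a..b}"
    if xK: "(x, K) \<in> p" for x K
  proof -
    have "x \<in> K" "K \<subseteq> {a..b}" using tagged_division_ofD(2,3)[OF p(1) xK] by auto
    moreover obtain c d where "K = {c..d}" using tagged_division_ofD(4)[OF p(1) xK] by auto
    moreover have "K \<subseteq> \<gamma> x" using p(2) xK by (auto simp: fine_def)
    ultimately show ?thesis by auto
  qed
  have fp: "finite p" using p(1) by blast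
  \<comment> \<open>Degenerate intervals tagged in \<open>N\<close> are left in the complement of
    \<open>J\<close>; their increment is 0.\<close>
  define J where "J = {q \<in> p. fst q \<in> N \<and> Inf (snd q) < Sup (snd q)}"
  have J: "finite J" "J \<subseteq> p" using fp by (auto simp: J_def)
  have disj: "{Inf K<..<Sup K} \<inter> {Inf L<..<Sup L} = {}" if "(x, K) \<in> p" "(y, L) \<in> p" "(x, K) \<noteq> (y, L)" for x K y L
  proof -
    have "interior K \<inter> interior L = {}" using tagged_division_ofD(5)[OF p(1) that(1,2)] that(3) by blast
    moreover have "interior K = {Inf K<..<Sup K}" "interior L = {Inf L<..<Sup L}"
      using pK[OF that(1)] pK[OF that(2)] interior_atLeastAtMost_real by metis+
    ultimately show ?thesis by simp
  qed
  have "(\<Sum>q\<in>J. norm (w (Sup (snd q)) - w (Inf (snd q)))) < e"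
  proof (rule D[OF J(1)])
    show "a \<le> Inf (snd q) \<and> Inf (snd q) \<le> Sup (snd q) \<and> Sup (snd q) \<le> b" if "q \<in> J" for q
      using that pK[of "fst q" "snd q"] J by auto
    show "Sup (snd i) \<le> Inf (snd j) \<or> Sup (snd j) \<le> Inf (snd i)"
      if "i \<in> J" "j \<in> J" "i \<noteq> j" "Inf (snd i) < Sup (snd i)" "Inf (snd j) < Sup (snd j)" for i j
    proof (rule ccontr)
      assume "\<not> ?thesis"
      then have "max (Inf (snd i)) (Inf (snd j)) < min (Sup (snd i)) (Sup (snd j))" using that by auto
      then obtain z where "max (Inf (snd i)) (Inf (snd j)) < z" "z < min (Sup (snd i)) (Sup (snd j))"
        using dense by blast
      moreover have "{Inf (snd i)<..<Sup (snd i)} \<inter> {Inf (snd j)<..<Sup (snd j)} = {}"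
        using disj[of "fst i" "snd i" "fst j" "snd j"] that J by auto
      ultimately show False by auto
    qed
    have dis: "disjoint_family_on (\<lambda>q. {Inf (snd q)<..<Sup (snd q)}) J"
      unfolding disjoint_family_on_def using disj J by (metis prod.collapse subsetD)
    have "ennreal (\<Sum>q\<in>J. Sup (snd q) - Inf (snd q)) = (\<Sum>q\<in>J. emeasure lborel {Inf (snd q)<..<Sup (snd q)})"
      by (subst sum_ennreal[symmetric]) (auto simp: J_def intro!: sum.cong)
    also have "\<dots> = emeasure lborel (\<Union>q\<in>J. {Inf (snd q)<..<Sup (snd q)})"
      using J by (intro sum_emeasure dis) auto
    also have "\<dots> \<le> emeasure lborel U"
    proof (rule emeasure_mono)
      have "{Inf (snd q)<..<Sup (snd q)} \<subseteq> U" if "q \<in> J" for q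
      proof -
        have "{Inf (snd q)<..<Sup (snd q)} \<subseteq> {Inf (snd q)..Sup (snd q)}" by auto
        also have "\<dots> \<subseteq> U" using pK[of "fst q" "snd q"] that J by (auto simp: \<gamma>_def J_def)
        finally show ?thesis .
      qed
      then show "(\<Union>q\<in>J. {Inf (snd q)<..<Sup (snd q)}) \<subseteq> U" by blast
    qed (use U in simp)
    also note mU
    finally have "ennreal (\<Sum>q\<in>J. Sup (snd q) - Inf (snd q)) < ennreal \<delta>" .
    moreover have "0 \<le> (\<Sum>q\<in>J. Sup (snd q) - Inf (snd q))"
      by (rule sum_nonneg) (simp add: J_def)
    ultimately show "(\<Sum>q\<in>J. Sup (snd q) - Inf (snd q)) < \<delta>"
      by (simp only: ennreal_less_iff)
  qed
  moreover have "(\<Sum>q\<in>J. w (Sup (snd q)) - w (Inf (snd q))) \<le> (\<Sum>q\<in>J. norm (w (Sup (snd q)) - w (Inf (snd q))))"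
    by (intro sum_mono) auto
  moreover have "(\<Sum>q\<in>p - J. w (Sup (snd q)) - w (Inf (snd q))) \<le> (\<Sum>q\<in>p - J. e * (Sup (snd q) - Inf (snd q)))"
  proof (rule sum_mono)
    fix q assume q: "q \<in> p - J"
    obtain x K where xK: "q = (x, K)" by fastforce
    have k: "x \<in> K" "K = {Inf K..Sup K}" "Inf K \<le> Sup K" "a \<le> Inf K" "Sup K \<le> b" "K \<subseteq> \<gamma> x" "x \<in> {a..b}"
      using pK[of x K] q xK by auto
    show "w (Sup (snd q)) - w (Inf (snd q)) \<le> e * (Sup (snd q) - Inf (snd q))"
    proof (cases "x \<in> N")
      case True
      then have "Inf K = Sup K" using q xK k by (auto simp: J_def)
      then show ?thesis by (simp add: xK)
    next
      case False
      have i: "Inf K \<le> x" "x \<le> Sup K" using k(1,2) by (metis atLeastAtMost_iff)+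
      have "Inf K \<in> K" "Sup K \<in> K" using k(2,3) by (metis atLeastAtMost_iff order_refl)+
      then have "Inf K \<in> ball x (r x)" "Sup K \<in> ball x (r x)"
        using k False by (auto simp: \<gamma>_def)
      then show ?thesis
        unfolding xK snd_conv using i by (intro R[OF k(7) False k(4) _ _ k(5)]) (auto simp: dist_real_def)
    qed
  qed
  moreover have "(\<Sum>q\<in>p - J. e * (Sup (snd q) - Inf (snd q))) \<le> (\<Sum>q\<in>p. e * (Sup (snd q) - Inf (snd q)))"
    using fp e pK by (intro sum_mono2) force+
  moreover have "(\<Sum>q\<in>p. e * (Sup (snd q) - Inf (snd q))) = e * (b - a)"
    using additive_tagged_division_1[OF ab p(1), of "\<lambda>x. x"]
    by (simp add: case_prod_beta flip: sum_distrib_left)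
  moreover have "(\<Sum>q\<in>p. w (Sup (snd q)) - w (Inf (snd q))) = w b - w a"
    using additive_tagged_division_1[OF ab p(1), of w] by (simp add: case_prod_beta)
  moreover have "(\<Sum>q\<in>p. w (Sup (snd q)) - w (Inf (snd q))) =
      (\<Sum>q\<in>J. w (Sup (snd q)) - w (Inf (snd q))) + (\<Sum>q\<in>p - J. w (Sup (snd q)) - w (Inf (snd q)))"
    using sum.subset_diff[OF J(2) fp] by (simp add: add.commute)
  ultimately show "w b \<le> w a + \<eta>" using e_eq by linarith
qed

section \<open>The implicit Euler scheme\<close>

text \<open>(A3) provides a Lebesgue measurable bound on \<open>{0..T}\<close>, while the integrals
  here are taken against \<open>lborel\<close> on the line. The absolute value makes the
  representative nonnegative everywhere and not just almost everywhere.\<close>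

lemma absolutely_integrable_borel_representative:
  fixes \<sigma> :: "real \<Rightarrow> real"
  assumes i: "\<sigma> absolutely_integrable_on S" and p: "\<And>t. t \<in> S \<Longrightarrow> 0 \<le> \<sigma> t"
  obtains \<rho> where "integrable lborel \<rho>" "\<And>x. 0 \<le> \<rho> x" "AE x in lborel. x \<in> S \<longrightarrow> \<rho> x = \<sigma> x"
proof -
  have i': "integrable lebesgue (\<lambda>x. indicator S x *\<^sub>R \<sigma> x)"
    using i by (simp add: set_integrable_def)
  then obtain g where g[measurable]: "g \<in> borel_measurable lborel"
    and ae: "AE x in lborel. indicator S x *\<^sub>R \<sigma> x = g x"
    using completion_ex_borel_measurable_real[of "\<lambda>x. indicator S x *\<^sub>R \<sigma> x" lborel] by auto
  have "integrable lebesgue g"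
  proof (rule Bochner_Integration.integrable_cong_AE_imp[OF i'])
    show "AE x in lebesgue. indicat_real S x *\<^sub>R \<sigma> x = g x"
      using ae by (simp only: AE_completion_iff)
  qed (use g in \<open>auto intro: measurable_completion\<close>)
  then have "integrable lborel g" using g by (simp add: integrable_completion)
  then have "integrable lborel (\<lambda>x. \<bar>g x\<bar>)" by (rule integrable_abs)
  moreover have "AE x in lborel. x \<in> S \<longrightarrow> \<bar>g x\<bar> = \<sigma> x"
    using ae
  proof eventually_elim
    case (elim x)
    then show ?case using p[of x] by (cases "x \<in> S") auto
  qed
  ultimately show thesis using that[of "\<lambda>x. \<bar>g x\<bar>"] by auto
qed

text \<open>The selected point must be good for \<open>\<sigma>\<close> itself: (A3) holds for
  \<open>\<sigma>\<close> at every time, whereas the Borel representative \<open>\<rho>\<close>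
  agrees with it only almost everywhere. The slack \<open>u - s\<close> makes the contradiction
  survive integration, where strict inequalities become weak.\<close>

lemma exists_point_le_mean:
  fixes \<rho> \<sigma> :: "real \<Rightarrow> real"
  assumes su: "s < u" and \<rho>: "integrable lborel \<rho>"
    and ae: "AE x in lborel. x \<in> {s<..u} \<longrightarrow> \<rho> x = \<sigma> x"
  shows "\<exists>\<tau>\<in>{s<..u}. (u - s) * \<sigma> \<tau> \<le> (LINT x:{s<..u}|lborel. \<rho> x) + (u - s)"
proof (rule ccontr)
  define L where "L = (LINT x:{s<..u}|lborel. \<rho> x)"
  assume "\<not> ?thesis"
  then have "\<forall>\<tau>\<in>{s<..u}. L + (u - s) < (u - s) * \<sigma> \<tau>" by (simp add: L_def not_le)
  then have "AE x in lborel. x \<in> {s<..u} \<longrightarrow> L + (u - s) \<le> (u - s) * \<rho> x"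
    using ae by (auto elim!: eventually_mono intro: less_imp_le)
  then have "(LINT x:{s<..u}|lborel. L + (u - s)) \<le> (LINT x:{s<..u}|lborel. (u - s) * \<rho> x)"
    using su \<rho> set_integrable_lborel[OF \<rho>, of "{s<..u}"]
    by (intro set_integral_mono_AE) (simp_all add: set_integrable_def mult.left_commute)
  also have "\<dots> = (u - s) * L" by (simp add: L_def)
  also have "(LINT x:{s<..u}|lborel. L + (u - s)) = (u - s) * (L + (u - s))"
    using su by (simp add: set_lebesgue_integral_def)
  finally show False using su by (simp add: distrib_left mult_le_0_iff)
qed

lemma exists_near_sv_dom:
  fixes z :: "'a::euclidean_space"
  assumes z: "z \<in> closure D" and D: "\<forall>z\<in>D. infdist z E \<le> d" and E: "E \<noteq> {}" and e: "0 < e"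
  shows "\<exists>w\<in>E. norm (z - w) \<le> d + e"
proof -
  have e3: "0 < e / 2" using e by simp
  obtain z' where z': "z' \<in> D" "dist z' z < e / 2" using z e3 unfolding closure_approachable by blast
  have "infdist z' E < d + e / 2" using D z' e3 by fastforce
  then obtain w where "w \<in> E" "dist z' w < d + e / 2"
    using E by (auto simp: infdist_def cINF_less_iff)
  moreover have "norm (z - w) \<le> dist z z' + dist z' w"
    by (metis dist_norm dist_triangle)
  ultimately show ?thesis using z' by (auto simp: dist_commute intro!: bexI[of _ w])
qed

text \<open>Reference points \<open>u k\<close> in the successive domains stay in a ball of radius
  \<open>r1\<close> fixed by (A2). The bound \<open>\<sigma>1\<close> for that ball controls the
  distance from the scheme to them and so yields a radius \<open>R\<close>; the bound
  \<open>\<sigma>2\<close> for radius \<open>R\<close> then controls the single increments. One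
  sampling time per cell has to serve both bounds. The returned \<open>g\<close> is
  \<open>\<sigma>1\<close>: wherever it is at most \<open>M\<close>, the graph has a pair of
  uniformly bounded norm, which later keeps resolvents bounded.\<close>

lemma Euler_scheme_exists:
  fixes F :: "real \<Rightarrow> 'a::euclidean_space \<Rightarrow> 'a set"
  assumes T: "0 < T"
    and A1: "\<forall>t\<in>{0..T}. maximal_monotone (F t)"
    and A2: "\<exists>\<phi> :: real \<Rightarrow> real. mono_on {0..T} \<phi> \<and> absolutely_continuous_on_interval 0 T \<phi> \<and>
               (\<forall>s t. 0 \<le> s \<and> s \<le> t \<and> t \<le> T \<longrightarrow>
                  (\<forall>z\<in>sv_dom (F s). infdist z (sv_dom (F t)) \<le> \<phi> t - \<phi> s))"
    and A3: "\<forall>r>0. \<exists>\<sigma> :: real \<Rightarrow> real. \<sigma> absolutely_integrable_on {0..T} \<and>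
               (\<forall>t\<in>{0..T}. 0 \<le> \<sigma> t) \<and>
               (\<forall>t\<in>{0..T}. \<forall>x\<in>cball 0 r \<inter> sv_dom (F t).
                  norm (min_section F t x) \<le> \<sigma> t * (1 + norm x))"
    and x0: "x0 \<in> closure (sv_dom (F 0))"
  obtains \<theta> C g where "integrable lborel \<theta>" "\<And>x. 0 \<le> \<theta> x" "0 \<le> C"
    "\<And>M. \<exists>B. \<forall>t\<in>{0..T}. g t \<le> M \<longrightarrow> (\<exists>u v. v \<in> F t u \<and> norm u \<le> B \<and> norm v \<le> B)"
    "\<And>N h. 0 < N \<Longrightarrow> h = T / real N \<Longrightarrow> \<exists>\<tau> y. y 0 = x0 \<and>
      (\<forall>k<N. \<tau> k \<in> {h * real k..h * (real k + 1)} \<and>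
        (1 / h) *\<^sub>R (y k - y (Suc k)) \<in> F (\<tau> k) (y (Suc k)) \<and>
        norm (y (Suc k) - y k) \<le> C * (LINT x:{h * (real k - 1)<..h * (real k + 1)}|lborel. \<theta> x) \<and>
        h * g (\<tau> k) \<le> (LINT x:{h * (real k - 1)<..h * (real k + 1)}|lborel. \<theta> x) \<and>
        h \<le> (LINT x:{h * (real k - 1)<..h * (real k + 1)}|lborel. \<theta> x))"
proof -
  obtain \<phi> where \<phi>m: "mono_on {0..T} \<phi>" and \<phi>ac: "absolutely_continuous_on_interval 0 T \<phi>"
    and \<phi>: "\<And>s t. 0 \<le> s \<Longrightarrow> s \<le> t \<Longrightarrow> t \<le> T \<Longrightarrow> \<forall>z\<in>sv_dom (F s). infdist z (sv_dom (F t)) \<le> \<phi> t - \<phi> s"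
    using A2 by auto
  obtain f where f: "integrable lborel f" "\<And>x. 0 \<le> f x"
    "\<And>s t. 0 \<le> s \<Longrightarrow> s \<le> t \<Longrightarrow> t \<le> T \<Longrightarrow> \<phi> t - \<phi> s = (LINT x:{s<..t}|lborel. f x)"
    using absolutely_continuous_mono_density[OF _ \<phi>ac \<phi>m] T by auto
  have dom: "sv_dom (F t) \<noteq> {}" if "t \<in> {0..T}" for t
    using Minty_surjective[of "F t" 1 0] A1 that by (auto simp: sv_dom_def)
  have near: "\<exists>w\<in>sv_dom (F t). norm (z - w) \<le> \<phi> t - \<phi> s + e"
    if "z \<in> closure (sv_dom (F s))" "0 \<le> s" "s \<le> t" "t \<le> T" "0 < e" for z s t e
    using that by (intro exists_near_sv_dom[OF _ \<phi> dom]) auto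
  define V where "V = \<phi> T - \<phi> 0"
  have \<phi>V: "0 \<le> \<phi> t - \<phi> s" "\<phi> t - \<phi> s \<le> V" if "0 \<le> s" "s \<le> t" "t \<le> T" for s t
    using mono_onD[OF \<phi>m, of s t] mono_onD[OF \<phi>m, of 0 s] mono_onD[OF \<phi>m, of t T] that
    by (auto simp: V_def)
  obtain u0 where u0: "u0 \<in> sv_dom (F 0)" using dom[of 0] T by auto
  \<comment> \<open>\<open>V\<close> is the total drift of the domains, and \<open>T\<close>
    dominates the slacks \<open>h\<close> accumulated along the grid.\<close>
  define r1 where "r1 = norm u0 + V + T"
  have r1: "0 < r1" using T \<phi>V[of 0 0] by (simp add: r1_def add_nonneg_pos)
  obtain \<sigma>1 where \<sigma>1: "\<sigma>1 absolutely_integrable_on {0..T}" "\<And>t. t \<in> {0..T} \<Longrightarrow> 0 \<le> \<sigma>1 t"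
    and \<sigma>1b: "\<And>t x. t \<in> {0..T} \<Longrightarrow> norm x \<le> r1 \<Longrightarrow> x \<in> sv_dom (F t) \<Longrightarrow> norm (min_section F t x) \<le> \<sigma>1 t * (1 + norm x)"
    using A3 r1 by (metis IntI mem_cball_0)
  obtain \<rho>1 where \<rho>1: "integrable lborel \<rho>1" "\<And>x. 0 \<le> \<rho>1 x" "AE x in lborel. x \<in> {0..T} \<longrightarrow> \<rho>1 x = \<sigma>1 x"
    using absolutely_integrable_borel_representative[OF \<sigma>1] by blast
  define L1 where "L1 = (LINT x|lborel. \<rho>1 x)"
  have L1: "0 \<le> L1" unfolding L1_def using \<rho>1 by (simp add: integral_nonneg_AE)
  \<comment> \<open>Bound for the distance between the scheme and the reference sequence: initial
    distance, drift, slack, and \<open>1 + r1\<close> times the sum of the sampled means. That sum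
    is allowed the budget \<open>L1 + 1 + T\<close>, whose \<open>1\<close> is reserved for
    \<open>\<sigma>2\<close>.\<close>
  define b where "b = norm (x0 - u0) + V + T + (1 + r1) * (L1 + 1 + T)"
  define R where "R = r1 + b + V + T"
  have b0: "0 \<le> b" unfolding b_def using \<phi>V[of 0 0] T r1 L1 by (intro add_nonneg_nonneg mult_nonneg_nonneg) auto
  have R: "0 < R" unfolding R_def using b0 \<phi>V[of 0 0] T r1 by simp
  obtain \<sigma>2 where \<sigma>2: "\<sigma>2 absolutely_integrable_on {0..T}" "\<And>t. t \<in> {0..T} \<Longrightarrow> 0 \<le> \<sigma>2 t"
    and \<sigma>2b: "\<And>t x. t \<in> {0..T} \<Longrightarrow> norm x \<le> R \<Longrightarrow> x \<in> sv_dom (F t) \<Longrightarrow> norm (min_section F t x) \<le> \<sigma>2 t * (1 + norm x)"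
    using A3 R by (metis IntI mem_cball_0)
  obtain \<rho>2 where \<rho>2: "integrable lborel \<rho>2" "\<And>x. 0 \<le> \<rho>2 x" "AE x in lborel. x \<in> {0..T} \<longrightarrow> \<rho>2 x = \<sigma>2 x"
    using absolutely_integrable_borel_representative[OF \<sigma>2] by blast
  \<comment> \<open>\<open>R\<close>, and with it \<open>\<sigma>2\<close>, was determined before
    the mass of \<open>\<rho>2\<close> is known. The weight \<open>c\<close> reduces this mass to at
    most 1, so sampling for the sum \<open>\<rho>1 + c * \<rho>2\<close> stays within the reserved
    budget.\<close>
  define c where "c = 1 / (1 + (LINT x|lborel. \<rho>2 x))"
  have L2: "0 \<le> (LINT x|lborel. \<rho>2 x)" using \<rho>2 by (simp add: integral_nonneg_AE)
  have c: "0 < c" "c * (LINT x|lborel. \<rho>2 x) \<le> 1" using L2 by (auto simp: c_def divide_simps)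
  define \<rho> where "\<rho> x = \<rho>1 x + c * \<rho>2 x" for x
  define \<sigma> where "\<sigma> x = \<sigma>1 x + c * \<sigma>2 x" for x
  have \<rho>: "integrable lborel \<rho>" unfolding \<rho>_def using \<rho>1 \<rho>2 by auto
  have \<rho>0: "0 \<le> \<rho> x" for x using \<rho>1 \<rho>2 c by (simp add: \<rho>_def)
  have \<rho>\<sigma>: "AE x in lborel. x \<in> {0..T} \<longrightarrow> \<rho> x = \<sigma> x"
    using \<rho>1(3) \<rho>2(3) by eventually_elim (auto simp: \<rho>_def \<sigma>_def)
  have L\<rho>: "(LINT x|lborel. \<rho> x) \<le> L1 + 1"
    unfolding \<rho>_def using \<rho>1 \<rho>2 c by (subst Bochner_Integration.integral_add) (auto simp: L1_def)
  define \<theta> where "\<theta> x = f x + \<rho> x + indicator {0..T} x" for x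
  have \<theta>: "integrable lborel \<theta>" unfolding \<theta>_def using f \<rho> T by auto
  have \<theta>0: "0 \<le> \<theta> x" for x using f \<rho>0 by (simp add: \<theta>_def)
  \<comment> \<open>The \<open>2\<close> pays for moving to a point of the next domain and back;
    dividing by \<open>c\<close> undoes the weight of \<open>\<sigma>2\<close>.\<close>
  define C where "C = 2 + (1 + R) / c"
  have C0: "0 \<le> C" using c R by (simp add: C_def)
  have bnd: "\<exists>B. \<forall>t\<in>{0..T}. \<sigma>1 t \<le> M \<longrightarrow> (\<exists>u v. v \<in> F t u \<and> norm u \<le> B \<and> norm v \<le> B)" for M
  proof (intro exI[of _ "max r1 (M * (1 + r1))"] ballI impI)
    fix t assume t: "t \<in> {0..T}" "\<sigma>1 t \<le> M"
    obtain w where w: "w \<in> sv_dom (F t)" "norm (u0 - w) \<le> \<phi> t - \<phi> 0 + T"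
      using near[of u0 0 t T] t T u0 closure_subset by fastforce
    have "norm w \<le> norm u0 + norm (u0 - w)" by (metis norm_triangle_sub norm_minus_commute)
    also have "\<dots> \<le> r1" using w \<phi>V[of 0 t] t by (simp add: r1_def)
    finally have wr: "norm w \<le> r1" .
    have "norm (min_section F t w) \<le> \<sigma>1 t * (1 + norm w)" using \<sigma>1b t wr w by blast
    also have "\<dots> \<le> M * (1 + r1)" using t wr \<sigma>1(2)[OF t(1)] by (intro mult_mono) auto
    finally have "norm (min_section F t w) \<le> max r1 (M * (1 + r1))" by simp
    then show "\<exists>u v. v \<in> F t u \<and> norm u \<le> max r1 (M * (1 + r1)) \<and> norm v \<le> max r1 (M * (1 + r1))"
      using min_section_mem[of F t w] A1 t w wr by (intro exI[of _ w] exI[of _ "min_section F t w"]) auto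
  qed
  have scheme: "\<exists>\<tau> y. y 0 = x0 \<and>
      (\<forall>k<N. \<tau> k \<in> {h * real k..h * (real k + 1)} \<and>
        (1 / h) *\<^sub>R (y k - y (Suc k)) \<in> F (\<tau> k) (y (Suc k)) \<and>
        norm (y (Suc k) - y k) \<le> C * (LINT x:{h * (real k - 1)<..h * (real k + 1)}|lborel. \<theta> x) \<and>
        h * \<sigma>1 (\<tau> k) \<le> (LINT x:{h * (real k - 1)<..h * (real k + 1)}|lborel. \<theta> x) \<and>
        h \<le> (LINT x:{h * (real k - 1)<..h * (real k + 1)}|lborel. \<theta> x))"
    if N: "0 < N" and hN: "h = T / real N" for N h
  proof -
    have h: "0 < h" "h \<le> T" using N T by (auto simp: hN divide_le_eq)
    have hk: "h * real k \<le> T" if "k \<le> N" for k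
    proof -
      have "h * real k \<le> h * real N" using that h by (intro mult_left_mono) auto
      then show ?thesis using N by (simp add: hN)
    qed
    have hk0: "0 \<le> h * real k" for k using h by simp
    define lam where "lam k = (LINT x:{h * real k<..h * (real k + 1)}|lborel. \<rho> x) + h" for k :: nat
    have lamh: "h \<le> lam k" for k
      unfolding lam_def set_lebesgue_integral_def using \<rho>0 by (simp add: integral_nonneg_AE)
    have "\<exists>\<tau>\<in>{h * real k<..h * (real k + 1)}. h * \<sigma> \<tau> \<le> lam k" if k: "k < N" for k
    proof -
      have "{h * real k<..h * (real k + 1)} \<subseteq> {0..T}"
      proof
        fix x assume x: "x \<in> {h * real k<..h * (real k + 1)}"
        have "h * (real k + 1) \<le> T" using hk[of "Suc k"] k by (simp add: add.commute)
        moreover have "h * real k < x" "x \<le> h * (real k + 1)" using x by simp_all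
        ultimately have "0 \<le> x" "x \<le> T" using hk0[of k] by linarith+
        then show "x \<in> {0..T}" by simp
      qed
      then have "AE x in lborel. x \<in> {h * real k<..h * (real k + 1)} \<longrightarrow> \<rho> x = \<sigma> x"
        using \<rho>\<sigma> by (elim eventually_mono) blast
      moreover have "h * real k < h * (real k + 1)" using h by simp
      moreover have "h * (real k + 1) - h * real k = h" by (simp add: algebra_simps)
      ultimately show ?thesis using exists_point_le_mean[of "h * real k" "h * (real k + 1)" \<rho> \<sigma>] \<rho>
        by (simp add: lam_def)
    qed
    then obtain \<tau> where \<tau>: "\<And>k. k < N \<Longrightarrow> \<tau> k \<in> {h * real k<..h * (real k + 1)}"
      and \<tau>\<sigma>: "\<And>k. k < N \<Longrightarrow> h * \<sigma> (\<tau> k) \<le> lam k"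
      by metis
    \<comment> \<open>The sampling times shifted by one, starting at 0 because the initial value
      belongs to the domain at time 0. The value \<open>T\<close> from index \<open>Suc N\<close> on
      makes the sequence total, so that points can be chosen for all \<open>k\<close> at
      once.\<close>
    define s where "s k = (case k of 0 \<Rightarrow> 0 | Suc j \<Rightarrow> if j < N then \<tau> j else T)" for k
    have s0: "s 0 = 0" by (simp add: s_def)
    have sS: "s (Suc k) = \<tau> k" if "k < N" for k using that by (simp add: s_def)
    have \<tau>T: "0 \<le> \<tau> k" "\<tau> k \<le> T" if "k < N" for k
    proof -
      show "0 \<le> \<tau> k" using \<tau>[OF that] hk0[of k] unfolding greaterThanAtMost_iff by linarith
      show "\<tau> k \<le> T" using \<tau>[OF that] hk[of "Suc k"] that by (auto simp: add.commute)
    qed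
    have sT: "s k \<in> {0..T}" for k using \<tau>T T by (auto simp: s_def split: nat.split)
    have sm: "s k \<le> s (Suc k)" for k
    proof (cases k)
      case 0 then show ?thesis using sT[of 1] s0 by simp
    next
      case (Suc j)
      show ?thesis
      proof (cases "Suc j < N")
        case True
        then show ?thesis using \<tau>[of j] \<tau>[of "Suc j"] Suc by (auto simp: sS add.commute)
      next
        case False
        then show ?thesis using sT[of k] Suc by (simp add: s_def)
      qed
    qed
    have mm: "maximal_monotone (F (s k))" for k using A1 sT by blast
    obtain u where u: "\<And>k. u k \<in> sv_dom (F (s k)) \<and> (k = 0 \<longrightarrow> u k = u0)"
      and ud: "\<And>k. norm (u k - u (Suc k)) \<le> \<phi> (s (Suc k)) - \<phi> (s k) + h"
    proof -
      have "\<exists>u. \<forall>k. (u k \<in> sv_dom (F (s k)) \<and> (k = 0 \<longrightarrow> u k = u0)) \<and> norm (u k - u (Suc k)) \<le> \<phi> (s (Suc k)) - \<phi> (s k) + h"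
      proof (rule dependent_nat_choice[where P = "\<lambda>k w. w \<in> sv_dom (F (s k)) \<and> (k = 0 \<longrightarrow> w = u0)"])
        show "\<exists>w. w \<in> sv_dom (F (s 0)) \<and> (0 = (0::nat) \<longrightarrow> w = u0)" using u0 s0 by auto
        show "\<exists>w. (w \<in> sv_dom (F (s (Suc k))) \<and> (Suc k = 0 \<longrightarrow> w = u0)) \<and> norm (z - w) \<le> \<phi> (s (Suc k)) - \<phi> (s k) + h"
          if "z \<in> sv_dom (F (s k)) \<and> (k = 0 \<longrightarrow> z = u0)" for z k
          using near[of z "s k" "s (Suc k)" h] that sT[of k] sT[of "Suc k"] sm[of k] h closure_subset by fastforce
      qed
      then show thesis using that by blast
    qed
    obtain y where y0: "y 0 = x0" and y: "\<And>k. (1 / h) *\<^sub>R (y k - y (Suc k)) \<in> F (s (Suc k)) (y (Suc k))"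
    proof -
      have "\<exists>y. \<forall>k. (k = 0 \<longrightarrow> y k = x0) \<and> (1 / h) *\<^sub>R (y k - y (Suc k)) \<in> F (s (Suc k)) (y (Suc k))"
      proof (rule dependent_nat_choice[where P = "\<lambda>k z. k = 0 \<longrightarrow> z = x0"])
        show "\<exists>z. (Suc k = 0 \<longrightarrow> z = x0) \<and> (1 / h) *\<^sub>R (x - z) \<in> F (s (Suc k)) z" for x k
          using Minty_surjective[OF mm, of "1 / h" x "Suc k"] h by auto
      qed auto
      then show thesis using that by blast
    qed
    have step: "norm (y (Suc k) - w) \<le> norm (y k - w) + h * norm v" if "v \<in> F (s (Suc k)) w" for k v w
      using resolvent_dist_le[OF mm _ y that] h by (simp add: mult.commute)
    have ur: "norm (u k) \<le> r1" if k: "k \<le> N" for k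
    proof -
      have "norm (u k - u0) \<le> \<phi> (s k) - \<phi> 0 + h * real k"
      proof (induction k)
        case 0 show ?case using u[of 0] s0 by simp
      next
        case (Suc k)
        have "norm (u (Suc k) - u0) \<le> norm (u k - u (Suc k)) + norm (u k - u0)"
          by (metis dist_norm dist_triangle3)
        then show ?case using Suc ud[of k] by (simp add: algebra_simps)
      qed
      moreover have "norm (u k) \<le> norm u0 + norm (u k - u0)" by (rule norm_triangle_sub)
      ultimately show ?thesis using hk[OF k] \<phi>V[of 0 "s k"] sT[of k] by (auto simp: r1_def)
    qed
    have s1: "0 \<le> \<sigma>1 (\<tau> k)" "0 \<le> \<sigma>2 (\<tau> k)" if "k < N" for k using \<sigma>1 \<sigma>2 \<tau>T[OF that] by auto
    have h\<sigma>1: "h * \<sigma>1 (\<tau> k) \<le> lam k" if k: "k < N" for k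
    proof -
      have "h * \<sigma>1 (\<tau> k) \<le> h * \<sigma> (\<tau> k)" using h c s1[OF k] by (intro mult_left_mono) (auto simp: \<sigma>_def)
      then show ?thesis using \<tau>\<sigma>[OF k] by simp
    qed
    have h\<sigma>2: "h * \<sigma>2 (\<tau> k) \<le> lam k / c" if k: "k < N" for k
    proof -
      have "h * (c * \<sigma>2 (\<tau> k)) \<le> h * \<sigma> (\<tau> k)" using h c s1[OF k] by (intro mult_left_mono) (auto simp: \<sigma>_def)
      then have "h * (c * \<sigma>2 (\<tau> k)) \<le> lam k" using \<tau>\<sigma>[OF k] by simp
      then show ?thesis using c by (simp add: field_simps)
    qed
    \<comment> \<open>Each step compares \<open>y (Suc k)\<close> with \<open>u (Suc k)\<close> by
      the resolvent estimate, using the minimal section at \<open>u (Suc k)\<close>. Only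
      \<open>\<sigma>1\<close> enters, since the reference points have norm at most
      \<open>r1\<close>.\<close>
    have yu: "norm (y k - u k) \<le> norm (x0 - u0) + (\<phi> (s k) - \<phi> 0) + h * real k + (1 + r1) * (\<Sum>j<k. lam j)" if "k \<le> N" for k
      using that
    proof (induction k)
      case 0 show ?case using u[of 0] s0 y0 by simp
    next
      case (Suc k)
      then have k: "k < N" by simp
      let ?v = "min_section F (s (Suc k)) (u (Suc k))"
      have "?v \<in> F (s (Suc k)) (u (Suc k))" using min_section_mem[of F "s (Suc k)"] mm u by blast
      then have "norm (y (Suc k) - u (Suc k)) \<le> norm (y k - u (Suc k)) + h * norm ?v" by (rule step)
      moreover have n: "norm ?v \<le> \<sigma>1 (\<tau> k) * (1 + norm (u (Suc k)))"
        using \<sigma>1b[of "\<tau> k" "u (Suc k)"] u[of "Suc k"] ur[of "Suc k"] \<tau>T[OF k] Suc by (simp add: sS k)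
      moreover have "h * norm ?v \<le> h * (\<sigma>1 (\<tau> k) * (1 + r1))"
      proof -
        have "\<sigma>1 (\<tau> k) * (1 + norm (u (Suc k))) \<le> \<sigma>1 (\<tau> k) * (1 + r1)"
          using ur[of "Suc k"] Suc s1[OF k] by (intro mult_left_mono) auto
        with n have "norm ?v \<le> \<sigma>1 (\<tau> k) * (1 + r1)" by linarith
        then show ?thesis using h by (intro mult_left_mono) auto
      qed
      moreover have "h * (\<sigma>1 (\<tau> k) * (1 + r1)) \<le> lam k * (1 + r1)"
        unfolding mult.assoc[symmetric] using h\<sigma>1[OF k] r1 by (intro mult_right_mono) auto
      moreover have "norm (y k - u (Suc k)) \<le> norm (y k - u k) + norm (u k - u (Suc k))"
        by (metis dist_norm dist_triangle)
      ultimately have "norm (y (Suc k) - u (Suc k)) \<le> norm (x0 - u0) + (\<phi> (s k) - \<phi> 0) + h * real k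
          + (1 + r1) * (\<Sum>j<k. lam j) + (\<phi> (s (Suc k)) - \<phi> (s k) + h) + lam k * (1 + r1)"
        using Suc.IH ud[of k] k by linarith
      also have "\<dots> = norm (x0 - u0) + (\<phi> (s (Suc k)) - \<phi> 0) + h * real (Suc k) + (1 + r1) * (\<Sum>j<Suc k. lam j)"
        by (simp add: algebra_simps)
      finally show ?case .
    qed
    have lams: "(\<Sum>j<k. lam j) \<le> L1 + 1 + T" if "k \<le> N" for k
    proof -
      have "(\<Sum>j<k. lam j) = (LINT x:{0<..h * real k}|lborel. \<rho> x) + h * real k"
      proof (induction k)
        case (Suc k)
        have "(LINT x:{0<..h * real (Suc k)}|lborel. \<rho> x) = (LINT x:{0<..h * real k}|lborel. \<rho> x)
            + (LINT x:{h * real k<..h * real (Suc k)}|lborel. \<rho> x)"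
          using h by (intro Ioc_integral_combine \<rho>) auto
        then show ?case using Suc by (simp add: lam_def algebra_simps)
      qed (simp add: set_lebesgue_integral_def)
      moreover have "(LINT x:{0<..h * real k}|lborel. \<rho> x) \<le> (LINT x|lborel. \<rho> x)"
        unfolding set_lebesgue_integral_def
        using \<rho> \<rho>0 by (intro integral_mono integrable_mult_indicator) (auto simp: indicator_def)
      ultimately show ?thesis using hk[OF that] L\<rho> by linarith
    qed
    have yb: "norm (y k) \<le> r1 + b" if k: "k \<le> N" for k
    proof -
      have "norm (y k) \<le> norm (u k) + norm (y k - u k)" by (rule norm_triangle_sub)
      moreover have "(1 + r1) * (\<Sum>j<k. lam j) \<le> (1 + r1) * (L1 + 1 + T)"
        using lams[OF k] r1 by (intro mult_left_mono) auto
      ultimately show ?thesis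
        using yu[OF k] ur[OF k] hk[OF k] \<phi>V[of 0 "s k"] sT[of k] by (auto simp: b_def)
    qed
    have ycl: "y k \<in> closure (sv_dom (F (s k)))" for k
    proof (cases k)
      case 0 then show ?thesis using x0 y0 s0 by simp
    next
      case (Suc j)
      then have "y k \<in> sv_dom (F (s k))" using y[of j] by (auto simp: sv_dom_def)
      then show ?thesis using closure_subset by blast
    qed
    \<comment> \<open>\<open>y k\<close> lies in the closure of the previous domain only, so the
      step is compared with a point \<open>w\<close> of the next domain close to it. The definition
      of \<open>R\<close> adds \<open>V + T\<close> to \<open>r1 + b\<close> exactly to contain
      \<open>w\<close>.\<close>
    have yd: "norm (y (Suc k) - y k) \<le> C * ((\<phi> (s (Suc k)) - \<phi> (s k)) + lam k)" if k: "k < N" for k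
    proof -
      let ?d = "\<phi> (s (Suc k)) - \<phi> (s k)"
      have s: "0 \<le> s k" "s k \<le> s (Suc k)" "s (Suc k) \<le> T" using sT[of k] sT[of "Suc k"] sm by auto
      obtain w where w: "w \<in> sv_dom (F (s (Suc k)))" "norm (y k - w) \<le> ?d + h"
        using near[OF ycl[of k] s h(1)] by blast
      have "norm w \<le> norm (y k) + norm (y k - w)" by (metis norm_triangle_sub norm_minus_commute)
      then have wR: "norm w \<le> R" using w(2) yb[of k] k h(2) \<phi>V(2)[OF s] by (simp add: R_def)
      let ?v = "min_section F (s (Suc k)) w"
      have "?v \<in> F (s (Suc k)) w" using min_section_mem[of F "s (Suc k)"] mm w by blast
      then have "norm (y (Suc k) - w) \<le> norm (y k - w) + h * norm ?v" by (rule step)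
      moreover have n: "norm ?v \<le> \<sigma>2 (\<tau> k) * (1 + norm w)"
        using \<sigma>2b[of "\<tau> k" w] w wR \<tau>T[OF k] by (simp add: sS k)
      moreover have "h * norm ?v \<le> h * (\<sigma>2 (\<tau> k) * (1 + R))"
      proof -
        have "\<sigma>2 (\<tau> k) * (1 + norm w) \<le> \<sigma>2 (\<tau> k) * (1 + R)"
          using wR s1[OF k] by (intro mult_left_mono) auto
        with n have "norm ?v \<le> \<sigma>2 (\<tau> k) * (1 + R)" by linarith
        then show ?thesis using h by (intro mult_left_mono) auto
      qed
      moreover have "h * (\<sigma>2 (\<tau> k) * (1 + R)) \<le> lam k / c * (1 + R)"
        unfolding mult.assoc[symmetric] using h\<sigma>2[OF k] R by (intro mult_right_mono) auto
      moreover have "norm (y (Suc k) - y k) \<le> norm (y (Suc k) - w) + norm (y k - w)"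
        by (metis dist_norm dist_triangle2)
      ultimately have hv: "h * norm ?v \<le> lam k / c * (1 + R)"
        and "norm (y (Suc k) - y k) \<le> 2 * norm (y k - w) + h * norm ?v" by linarith+
      note this(2)
      also have "\<dots> \<le> 2 * (?d + h) + lam k / c * (1 + R)"
        using w(2) hv by (intro add_mono mult_left_mono) auto
      also have "\<dots> = 2 * ?d + 2 * h + lam k / c * (1 + R)" by simp
      also have "\<dots> \<le> 2 * ?d + 2 * lam k + lam k / c * (1 + R)" using lamh[of k] by simp
      also have "\<dots> = C * (?d + lam k) - (1 + R) / c * ?d" by (simp add: C_def algebra_simps)
      also have "\<dots> \<le> C * (?d + lam k)" using \<phi>V(1)[OF s] R c by simp
      finally show ?thesis .
    qed
    have main: "(\<phi> (s (Suc k)) - \<phi> (s k)) + lam k \<le> (LINT x:{h * (real k - 1)<..h * (real k + 1)}|lborel. \<theta> x)"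
      if k: "k < N" for k
    proof -
      have s: "0 \<le> s k" "s k \<le> s (Suc k)" "s (Suc k) \<le> T" using sT[of k] sT[of "Suc k"] sm by auto
      have "h * (real k - 1) \<le> s k"
      proof (cases k)
        case 0 then show ?thesis using h s0 by simp
      next
        case (Suc j)
        then show ?thesis using \<tau>[of j] k by (auto simp: sS)
      qed
      moreover have "s (Suc k) \<le> h * (real k + 1)" using \<tau>[OF k] k by (simp add: sS)
      ultimately have sub: "{s k<..s (Suc k)} \<subseteq> {h * (real k - 1)<..h * (real k + 1)}" by auto
      have sub2: "{h * real k<..h * (real k + 1)} \<subseteq> {h * (real k - 1)<..h * (real k + 1)}"
      proof -
        have "h * (real k - 1) \<le> h * real k" using h by (intro mult_left_mono) auto
        then show ?thesis by auto
      qed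
      \<comment> \<open>Only the current cell must lie in \<open>{0..T}\<close>, where the indicator
        in \<open>\<theta>\<close> supplies the extra \<open>h\<close> of \<open>lam k\<close>. For
        \<open>k = 0\<close> the doubled interval extends left of 0, which is harmless because
        \<open>\<theta>\<close> is nonnegative on the whole line.\<close>
      have hT: "0 \<le> h * real k" "h * (real k + 1) \<le> T" using hk[of "Suc k"] k h by (auto simp: add.commute)
      let ?A = "{s k<..s (Suc k)}" and ?B = "{h * real k<..h * (real k + 1)}"
      have ind: "(LINT x|lborel. indicator ?B x) = h" using h by (simp add: algebra_simps)
      have "(\<phi> (s (Suc k)) - \<phi> (s k)) + lam k =
          (LINT x|lborel. indicator ?A x * f x) + ((LINT x|lborel. indicator ?B x * \<rho> x) + (LINT x|lborel. indicator ?B x))"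
        unfolding ind by (simp add: lam_def f(3)[OF s] set_lebesgue_integral_def)
      also have "\<dots> = (LINT x|lborel. indicator ?A x * f x + (indicator ?B x * \<rho> x + indicator ?B x))"
        using integrable_mult_indicator[OF _ f(1), of ?A] integrable_mult_indicator[OF _ \<rho>, of ?B] h
        by (subst Bochner_Integration.integral_add, simp, simp)+ simp
      also have "\<dots> \<le> (LINT x|lborel. indicator {h * (real k - 1)<..h * (real k + 1)} x * \<theta> x)"
      proof (rule integral_mono)
        show "integrable lborel (\<lambda>x. indicator ?A x * f x + (indicator ?B x * \<rho> x + indicator ?B x))"
          using integrable_mult_indicator[OF _ f(1), of ?A] integrable_mult_indicator[OF _ \<rho>, of ?B] h by simp
        show "integrable lborel (\<lambda>x. indicator {h * (real k - 1)<..h * (real k + 1)} x * \<theta> x)"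
          using integrable_mult_indicator[OF _ \<theta>, of "{h * (real k - 1)<..h * (real k + 1)}"] by simp
        fix x
        have "indicator ?B x \<le> (indicator {0..T} x :: real)" using hT by (auto simp: indicator_def)
        then show "indicator ?A x * f x + (indicator ?B x * \<rho> x + indicator ?B x) \<le> indicator {h * (real k - 1)<..h * (real k + 1)} x * \<theta> x"
          using f(2)[of x] \<rho>0[of x] sub sub2 unfolding \<theta>_def by (auto simp: indicator_def split: if_splits)
      qed
      finally show ?thesis by (simp add: set_lebesgue_integral_def)
    qed
    have dp: "0 \<le> \<phi> (s (Suc k)) - \<phi> (s k)" for k
      using \<phi>V(1)[of "s k" "s (Suc k)"] sT[of k] sT[of "Suc k"] sm[of k] by simp
    show ?thesis
    proof (intro exI conjI allI impI)
      show "y 0 = x0" by (rule y0)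
      fix k assume k: "k < N"
      show "\<tau> k \<in> {h * real k..h * (real k + 1)}" using \<tau>[OF k] by auto
      show "(1 / h) *\<^sub>R (y k - y (Suc k)) \<in> F (\<tau> k) (y (Suc k))" using y[of k] k by (simp add: sS)
      show "norm (y (Suc k) - y k) \<le> C * (LINT x:{h * (real k - 1)<..h * (real k + 1)}|lborel. \<theta> x)"
        using yd[OF k] mult_left_mono[OF main[OF k] C0] by linarith
      show "h * \<sigma>1 (\<tau> k) \<le> (LINT x:{h * (real k - 1)<..h * (real k + 1)}|lborel. \<theta> x)"
        using h\<sigma>1[OF k] main[OF k] dp[of k] by linarith
      show "h \<le> (LINT x:{h * (real k - 1)<..h * (real k + 1)}|lborel. \<theta> x)"
        using lamh[of k] main[OF k] dp[of k] by linarith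
    qed
  qed
  show thesis by (rule that[OF \<theta> \<theta>0 C0 bnd scheme])
qed

section \<open>Compactness of the Euler approximations\<close>

text \<open>Integrating from minus infinity makes the indefinite integral available left of 0, where
  arguments such as \<open>a - 2 * h\<close> may fall.\<close>

lemma indefinite_integral_exists:
  fixes f :: "real \<Rightarrow> real"
  assumes f: "integrable lborel f" and f0: "\<And>x. 0 \<le> f x"
  obtains \<Theta> where "\<And>s u. s \<le> u \<Longrightarrow> (LINT x:{s<..u}|lborel. f x) = \<Theta> u - \<Theta> s"
    "mono \<Theta>" "continuous_on UNIV \<Theta>"
proof -
  define \<Theta> where "\<Theta> t = (LINT x:{..t}|lborel. f x)" for t
  have eq: "(LINT x:{s<..u}|lborel. f x) = \<Theta> u - \<Theta> s" if "s \<le> u" for s u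
  proof -
    have "{..u} = {..s} \<union> {s<..u}" using that by auto
    then have "\<Theta> u = \<Theta> s + (LINT x:{s<..u}|lborel. f x)" unfolding \<Theta>_def
      using set_integral_Un[of "{..s}" "{s<..u}" lborel f] by (simp add: set_integrable_lborel f disjoint_iff)
    then show ?thesis by simp
  qed
  have mono: "mono \<Theta>"
  proof (rule monoI)
    fix s u :: real assume "s \<le> u"
    moreover have "0 \<le> (LINT x:{s<..u}|lborel. f x)"
      using f0 unfolding set_lebesgue_integral_def by (simp add: integral_nonneg_AE)
    ultimately show "\<Theta> s \<le> \<Theta> u" using eq[of s u] by simp
  qed
  have cont: "isCont \<Theta> t" for t
  proof -
    have "absolutely_continuous_on_interval (t - 1) (t + 1) \<Theta>"
      using mono by (intro absolutely_continuous_of_dominated[OF f f0]) (simp add: eq monoD)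
    then have "continuous_on {t - 1..t + 1} \<Theta>" by (rule absolutely_continuous_imp_continuous_on)
    then show ?thesis by (rule continuous_on_interior) (simp add: interior_atLeastAtMost_real)
  qed
  show thesis by (rule that[OF eq mono]) (simp_all add: continuous_at_imp_continuous_on cont)
qed

lemma telescoping_norm_le:
  fixes y :: "nat \<Rightarrow> 'a::real_normed_vector"
  assumes "i \<le> j" "\<And>k. i \<le> k \<Longrightarrow> k < j \<Longrightarrow> norm (y (Suc k) - y k) \<le> e (Suc k) - e k"
  shows "norm (y j - y i) \<le> e j - e i"
  using assms
proof (induction j rule: dec_induct)
  case (step j)
  have "norm (y (Suc j) - y i) \<le> norm (y (Suc j) - y j) + norm (y j - y i)"
    by (metis dist_norm dist_triangle)
  moreover have "norm (y j - y i) \<le> e j - e i" using step by simp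
  moreover have "norm (y (Suc j) - y j) \<le> e (Suc j) - e j" using step by simp
  ultimately show ?case by linarith
qed simp

lemma floor_grid:
  assumes h: "h = T / real N" and N: "0 < N" and T: "0 < T" and t: "0 \<le> t" "t \<le> T"
  shows "nat \<lfloor>t / h\<rfloor> \<le> N" "h * real (nat \<lfloor>t / h\<rfloor>) \<le> t" "t < h * (real (nat \<lfloor>t / h\<rfloor>) + 1)"
proof -
  have h0: "0 < h" using h N T by simp
  have r: "real (nat \<lfloor>t / h\<rfloor>) = of_int \<lfloor>t / h\<rfloor>" using t h0 by simp
  have "real (nat \<lfloor>t / h\<rfloor>) \<le> t / h" unfolding r by simp
  then show 1: "h * real (nat \<lfloor>t / h\<rfloor>) \<le> t" using h0 by (simp add: field_simps)
  have "t / h < real (nat \<lfloor>t / h\<rfloor>) + 1" unfolding r by linarith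
  then show "t < h * (real (nat \<lfloor>t / h\<rfloor>) + 1)" using h0 by (simp add: field_simps)
  have "h * real (nat \<lfloor>t / h\<rfloor>) \<le> h * real N" using 1 t h N by simp
  then show "nat \<lfloor>t / h\<rfloor> \<le> N" using h0 by simp
qed

lemma floor_grid_mono:
  assumes "0 < h" "a \<le> b"
  shows "nat \<lfloor>a / h\<rfloor> \<le> nat \<lfloor>b / h\<rfloor>"
  using assms by (intro nat_mono floor_mono divide_right_mono) auto

text \<open>A step of the scheme may use the whole of two neighbouring grid cells, because the point at
  which \<open>F\<close> is frozen is only known to lie somewhere in its cell.\<close>

lemma Euler_increment_le:
  fixes y :: "nat \<Rightarrow> 'a::real_normed_vector"
  assumes h: "h = T / real N" and N: "0 < N" and T: "0 < T" and C: "0 \<le> C" and \<Theta>: "mono \<Theta>"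
    and step: "\<And>k. k < N \<Longrightarrow> norm (y (Suc k) - y k) \<le> C * (\<Theta> (h * (real k + 1)) - \<Theta> (h * (real k - 1)))"
    and ab: "0 \<le> a" "a \<le> b" "b \<le> T"
  shows "norm (y (nat \<lfloor>b / h\<rfloor>) - y (nat \<lfloor>a / h\<rfloor>)) \<le> 2 * C * (\<Theta> b - \<Theta> (a - 2 * h))"
proof -
  define i where "i = nat \<lfloor>a / h\<rfloor>"
  define j where "j = nat \<lfloor>b / h\<rfloor>"
  have h0: "0 < h" using h N T by simp
  have ij: "i \<le> j" "j \<le> N" "h * real j \<le> b" "a < h * (real i + 1)"
    using floor_grid_mono[OF h0 ab(2)] floor_grid[OF h N T] ab by (auto simp: i_def j_def)
  \<comment> \<open>An increment over two neighbouring cells is the sum of two one-cell increments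
    shifted by \<open>h\<close>. Hence a sum of two copies telescopes, which is the origin of the
    factor 2 in the conclusion.\<close>
  define e where "e k = C * (\<Theta> (h * real k) + \<Theta> (h * (real k - 1)))" for k
  have "norm (y j - y i) \<le> e j - e i"
  proof (rule telescoping_norm_le[OF ij(1)])
    fix k assume "i \<le> k" "k < j"
    then show "norm (y (Suc k) - y k) \<le> e (Suc k) - e k"
      using step[of k] ij by (simp add: e_def algebra_simps)
  qed
  also have "e j - e i = C * ((\<Theta> (h * real j) - \<Theta> (h * real i)) + (\<Theta> (h * (real j - 1)) - \<Theta> (h * (real i - 1))))"
    by (simp add: e_def algebra_simps)
  also have "\<dots> \<le> C * ((\<Theta> b - \<Theta> (a - 2 * h)) + (\<Theta> b - \<Theta> (a - 2 * h)))"
  proof (intro mult_left_mono[OF _ C] add_mono diff_mono monoD[OF \<Theta>])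
    show "h * real j \<le> b" by (rule ij)
    show "a - 2 * h \<le> h * real i" "a - 2 * h \<le> h * (real i - 1)"
      using ij(4) h0 by (auto simp: algebra_simps)
    show "h * (real j - 1) \<le> b" using ij(3) h0 by (simp add: algebra_simps)
  qed
  finally show ?thesis by (simp add: i_def j_def algebra_simps)
qed

text \<open>A diagonal choice gives convergence at rational times. The step functions are not
  continuous, but their oscillation is controlled by that of \<open>\<Theta>\<close> up to a shift
  by two mesh widths, and this equicontinuity in the limit carries the convergence to every time.
  The shift disappears in the final estimate because \<open>\<Theta>\<close> is continuous.\<close>

lemma Euler_subsequence:
  fixes Y :: "nat \<Rightarrow> nat \<Rightarrow> 'a::euclidean_space"
  assumes T: "0 < T" and C: "0 \<le> C" and \<Theta>: "mono \<Theta>" "continuous_on UNIV \<Theta>"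
    and h: "\<And>n. h n = T / real (Suc n)"
    and Y0: "\<And>n. Y n 0 = x0"
    and step: "\<And>n k. k < Suc n \<Longrightarrow> norm (Y n (Suc k) - Y n k) \<le> C * (\<Theta> (h n * (real k + 1)) - \<Theta> (h n * (real k - 1)))"
  obtains r x where "strict_mono r" "\<And>t. 0 \<le> t \<Longrightarrow> t \<le> T \<Longrightarrow> (\<lambda>n. Y (r n) (nat \<lfloor>t / h (r n)\<rfloor>)) \<longlonglongrightarrow> x t"
    "x 0 = x0" "\<And>a b. 0 \<le> a \<Longrightarrow> a \<le> b \<Longrightarrow> b \<le> T \<Longrightarrow> norm (x b - x a) \<le> 2 * C * (\<Theta> b - \<Theta> a)"
proof -
  define X where "X n t = Y n (nat \<lfloor>t / h n\<rfloor>)" for n t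
  have X0: "X n 0 = x0" for n by (simp add: X_def Y0)
  have h0: "0 < h n" "h n \<le> T" for n using T by (auto simp: h divide_le_eq mult_le_cancel_left1)
  have hlim: "h \<longlonglongrightarrow> 0"
  proof -
    have "(\<lambda>n. T * (1 / real (Suc n))) \<longlonglongrightarrow> T * 0"
      by (intro tendsto_intros LIMSEQ_Suc lim_1_over_n)
    then show ?thesis by (simp add: h[abs_def])
  qed
  have inc: "norm (X n b - X n a) \<le> 2 * C * (\<Theta> b - \<Theta> (a - 2 * h n))" if "0 \<le> a" "a \<le> b" "b \<le> T" for n a b
    unfolding X_def by (rule Euler_increment_le[OF h _ T C \<Theta>(1) step that]) auto
  have bd: "norm (X n t) \<le> norm x0 + 2 * C * (\<Theta> T - \<Theta> (- 2 * T))" if t: "0 \<le> t" "t \<le> T" for n t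
  proof -
    have "norm (X n t) \<le> norm (X n 0) + norm (X n t - X n 0)" by (rule norm_triangle_sub)
    also have "norm (X n t - X n 0) \<le> 2 * C * (\<Theta> t - \<Theta> (0 - 2 * h n))" using t by (intro inc) auto
    also have "\<dots> \<le> 2 * C * (\<Theta> T - \<Theta> (- 2 * T))"
      using C t h0[of n] by (intro mult_left_mono diff_mono monoD[OF \<Theta>(1)]) auto
    finally show ?thesis by (simp add: X0)
  qed
  obtain r :: "nat \<Rightarrow> nat" where r: "strict_mono r"
    and rq: "\<And>q. q \<in> \<rat> \<inter> {0..T} \<Longrightarrow> \<exists>l. (\<lambda>n. X (r n) q) \<longlonglongrightarrow> l"
  proof (rule function_convergent_subsequence[of "\<rat> \<inter> {0..T}" X])
    show "countable (\<rat> \<inter> {0..T})" by (intro countable_Int1 countable_rat)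
  qed (use bd in auto)
  have hr: "(\<lambda>n. h (r n)) \<longlonglongrightarrow> 0"
    using LIMSEQ_subseq_LIMSEQ[OF hlim r] by (simp add: comp_def)
  have "convergent (\<lambda>n. X (r n) t)" if t: "0 \<le> t" "t \<le> T" for t
  proof (cases "t = 0")
    case True then show ?thesis by (simp add: X0 convergent_const)
  next
    case False
    have "Cauchy (\<lambda>n. X (r n) t)"
    proof (rule metric_CauchyI)
      fix e :: real assume e: "0 < e"
      \<comment> \<open>Chosen so that the oscillation bound \<open>2 * C * e'\<close> is below
        \<open>e / 3\<close>.\<close>
      define e' where "e' = e / (6 * C + 6)"
      have e': "0 < e'" "6 * C * e' < e" using e C by (auto simp: e'_def divide_simps)
      have "isCont \<Theta> t" using \<Theta>(2) by (simp add: continuous_on_eq_continuous_at)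
      then obtain d where d: "0 < d" "\<And>s. \<bar>s - t\<bar> < d \<Longrightarrow> \<bar>\<Theta> s - \<Theta> t\<bar> < e'"
        using e' unfolding continuous_at_eps_delta dist_real_def by blast
      \<comment> \<open>The rational is taken left of \<open>t\<close>, as the increment bound is
        stated for ordered times; \<open>t = 0\<close> leaves no room for it and was settled
        separately by the common initial value.\<close>
      have "max 0 (t - d / 2) < t" using False t d by auto
      then obtain q where q: "q \<in> \<rat>" "max 0 (t - d / 2) < q" "q < t"
        using Rats_dense_in_real by blast
      then obtain l where "(\<lambda>n. X (r n) q) \<longlonglongrightarrow> l" using rq[of q] t by auto
      then have "Cauchy (\<lambda>n. X (r n) q)" by (rule LIMSEQ_imp_Cauchy)
      then obtain N1 where N1: "\<And>m n. m \<ge> N1 \<Longrightarrow> n \<ge> N1 \<Longrightarrow> dist (X (r m) q) (X (r n) q) < e / 3"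
        using e unfolding Cauchy_def by (metis zero_less_divide_iff zero_less_numeral)
      have "eventually (\<lambda>n. h (r n) < d / 4) sequentially"
        using d by (intro order_tendstoD(2)[OF hr]) auto
      then obtain N2 where N2: "\<And>n. n \<ge> N2 \<Longrightarrow> h (r n) < d / 4"
        by (auto simp: eventually_sequentially)
      have near: "dist (X (r n) t) (X (r n) q) < e / 3" if n: "n \<ge> N2" for n
      proof -
        have "\<bar>\<Theta> (q - 2 * h (r n)) - \<Theta> t\<bar> < e'"
          using N2[OF n] q d(1) h0[of "r n"] by (intro d(2)) auto
        then have "\<Theta> t - \<Theta> (q - 2 * h (r n)) \<le> e'" by linarith
        then have "2 * C * (\<Theta> t - \<Theta> (q - 2 * h (r n))) \<le> 2 * C * e'"
          using C by (intro mult_left_mono) auto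
        moreover have "norm (X (r n) t - X (r n) q) \<le> 2 * C * (\<Theta> t - \<Theta> (q - 2 * h (r n)))"
          using q t by (intro inc) auto
        ultimately show ?thesis using e' by (simp add: dist_norm)
      qed
      have "dist (X (r m) t) (X (r n) t) < e" if "m \<ge> max N1 N2" "n \<ge> max N1 N2" for m n
        using near[of m] near[of n] N1[of m n] that
          dist_triangle[of "X (r m) t" "X (r n) t" "X (r m) q"]
          dist_triangle[of "X (r m) q" "X (r n) t" "X (r n) q"]
        by (simp add: dist_commute)
      then show "\<exists>M. \<forall>m\<ge>M. \<forall>n\<ge>M. dist (X (r m) t) (X (r n) t) < e" by blast
    qed
    then show ?thesis by (rule Cauchy_convergent)
  qed
  then obtain x where x: "\<And>t. 0 \<le> t \<Longrightarrow> t \<le> T \<Longrightarrow> (\<lambda>n. X (r n) t) \<longlonglongrightarrow> x t"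
    unfolding convergent_def by metis
  show thesis
  proof (rule that[OF r])
    show "(\<lambda>n. Y (r n) (nat \<lfloor>t / h (r n)\<rfloor>)) \<longlonglongrightarrow> x t" if "0 \<le> t" "t \<le> T" for t
      using x[OF that] by (simp add: X_def)
    show "x 0 = x0" using x[of 0] T by (simp add: X0 LIMSEQ_const_iff)
    fix a b assume ab: "0 \<le> a" "a \<le> b" "b \<le> T"
    have "isCont \<Theta> a" using \<Theta>(2) by (simp add: continuous_on_eq_continuous_at)
    moreover have "(\<lambda>n. a - 2 * h (r n)) \<longlonglongrightarrow> a - 2 * 0" by (intro tendsto_intros hr)
    ultimately have "(\<lambda>n. \<Theta> (a - 2 * h (r n))) \<longlonglongrightarrow> \<Theta> a" by (intro isCont_tendsto_compose[of a \<Theta>]) auto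
    then have R: "(\<lambda>n. 2 * C * (\<Theta> b - \<Theta> (a - 2 * h (r n)))) \<longlonglongrightarrow> 2 * C * (\<Theta> b - \<Theta> a)"
      by (intro tendsto_intros)
    have L: "(\<lambda>n. norm (X (r n) b - X (r n) a)) \<longlonglongrightarrow> norm (x b - x a)"
      using ab by (intro tendsto_intros x) auto
    show "norm (x b - x a) \<le> 2 * C * (\<Theta> b - \<Theta> a)"
      by (rule LIMSEQ_le[OF L R]) (use inc[OF ab] in auto)
  qed
qed

section \<open>The limit solves the inclusion\<close>

text \<open>The nearby pair at time \<open>s\<close> is \<open>(p, z - p)\<close> with
  \<open>p\<close> the resolvent of \<open>F s\<close> at \<open>z = u + v\<close>. Along a sequence
  of times tending to \<open>t\<close> with \<open>g\<close> at most \<open>M\<close>, these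
  resolvents are bounded by comparison with the bounded pairs. By (A4) a limit point
  \<open>l\<close> satisfies \<open>z - l \<in> F t l\<close>, as \<open>u\<close> does, so
  uniqueness of the resolvent gives \<open>l = u\<close>.\<close>

lemma graph_inner_approximation:
  fixes F :: "real \<Rightarrow> 'a::euclidean_space \<Rightarrow> 'a set"
  assumes A1: "\<forall>t\<in>{0..T}. maximal_monotone (F t)" and A4: "graph_osc_on T F"
    and B: "\<exists>B. \<forall>t\<in>{0..T}. g t \<le> M \<longrightarrow> (\<exists>u v. v \<in> F t u \<and> norm u \<le> B \<and> norm v \<le> B)"
    and t: "t \<in> {0..T}" and uv: "v \<in> F t u" and e: "0 < e"
  shows "\<exists>d>0. \<forall>s\<in>{0..T}. \<bar>s - t\<bar> < d \<longrightarrow> g s \<le> (M::real) \<longrightarrow>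
    (\<exists>p q. q \<in> F s p \<and> norm (p - u) < e \<and> norm (q - v) < e)"
proof (rule ccontr)
  assume neg: "\<not> ?thesis"
  have "\<exists>s\<in>{0..T}. \<bar>s - t\<bar> < 1 / Suc n \<and> g s \<le> M \<and>
    (\<forall>p q. q \<in> F s p \<longrightarrow> norm (p - u) < e \<longrightarrow> \<not> norm (q - v) < e)" for n
    using neg[unfolded not_ex, rule_format, of "1 / Suc n"] by auto
  then obtain s where sT: "\<And>n. s n \<in> {0..T}" and st: "\<And>n. \<bar>s n - t\<bar> < 1 / Suc n" and gM: "\<And>n. g (s n) \<le> M"
    and far: "\<And>n p q. q \<in> F (s n) p \<Longrightarrow> norm (p - u) < e \<Longrightarrow> \<not> norm (q - v) < e"
    by metis
  obtain B where B: "\<And>t. t \<in> {0..T} \<Longrightarrow> g t \<le> M \<Longrightarrow> \<exists>u v. v \<in> F t u \<and> norm u \<le> B \<and> norm v \<le> B"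
    using B by blast
  define z where "z = u + v"
  have "\<exists>p. z - p \<in> F (s n) p" for n
    using Minty_surjective[of "F (s n)" 1 z] A1 sT by auto
  then obtain p where p: "\<And>n. z - p n \<in> F (s n) (p n)" by metis
  have "norm (p n) \<le> norm z + 3 * B" for n
  proof -
    obtain a b where ab: "b \<in> F (s n) a" "norm a \<le> B" "norm b \<le> B" using B[OF sT gM] by blast
    have "norm (p n - a) \<le> norm (z - a) + norm b / 1"
      using p ab A1 sT by (intro resolvent_dist_le[of "F (s n)"]) auto
    moreover have "norm (p n) \<le> norm a + norm (p n - a)" by (rule norm_triangle_sub)
    moreover have "norm (z - a) \<le> norm z + norm a" by (rule norm_triangle_ineq4)
    ultimately show ?thesis using ab by simp
  qed
  then have "bounded (range p)" by (auto simp: bounded_iff)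
  then obtain l r where r: "strict_mono (r :: nat \<Rightarrow> nat)" and l: "(p \<circ> r) \<longlonglongrightarrow> l"
    using bounded_imp_convergent_subsequence by blast
  have "s \<longlonglongrightarrow> t"
  proof (rule LIMSEQ_I)
    fix \<eta> :: real assume "0 < \<eta>"
    then obtain N where N: "1 / real (Suc N) < \<eta>" using nat_approx_posE by blast
    have "norm (s n - t) < \<eta>" if "n \<ge> N" for n
    proof -
      have "1 / real (Suc n) \<le> 1 / real (Suc N)" using that by (intro divide_left_mono) auto
      then show ?thesis using st[of n] N by simp
    qed
    then show "\<exists>no. \<forall>n\<ge>no. norm (s n - t) < \<eta>" by blast
  qed
  then have sr: "(\<lambda>n. s (r n)) \<longlonglongrightarrow> t" using LIMSEQ_subseq_LIMSEQ[OF _ r] by (simp add: comp_def)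
  have pr: "(\<lambda>n. p (r n)) \<longlonglongrightarrow> l" using l by (simp add: comp_def)
  have zr: "(\<lambda>n. z - p (r n)) \<longlonglongrightarrow> z - l" by (intro tendsto_intros pr)
  have "(l, z - l) \<in> sv_graph (F t)"
    using A4[unfolded graph_osc_on_def, rule_format, OF t, of "\<lambda>n. s (r n)" "\<lambda>n. p (r n)" "\<lambda>n. z - p (r n)" l "z - l"]
      sT sr pr zr p by (auto simp: sv_graph_def)
  then have "z - l \<in> F t l" by (simp add: sv_graph_def)
  moreover have "z - u \<in> F t u" using uv by (simp add: z_def)
  ultimately have lu: "l = u" using A1 t resolvent_unique by blast
  obtain n where n: "norm (p (r n) - u) < e"
    using LIMSEQ_D[OF pr e] lu by blast
  \<comment> \<open>Both components have the same error: \<open>(z - p) - v\<close> equals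
    \<open>u - p\<close>.\<close>
  then have "norm ((z - p (r n)) - v) < e" by (simp add: z_def norm_minus_commute)
  then show False using far[OF p n] by simp
qed

text \<open>Discrete monotonicity holds between \<open>y'\<close> and \<open>p\<close>, with
  \<open>q\<close> as the tested value. Replacing \<open>y'\<close> by \<open>z\<close>,
  \<open>p\<close> by \<open>u\<close> and \<open>q\<close> by \<open>v\<close> costs an error of
  order \<open>e * h\<close>. The factor \<open>h\<close> matters: summed over the cells of an
  interval, the errors amount to \<open>e\<close> times its length.\<close>

lemma Euler_step_inner_le:
  fixes G :: "'a::euclidean_space \<Rightarrow> 'a set"
  assumes G: "maximal_monotone G" and h: "0 < h" and y: "(1 / h) *\<^sub>R (y - y') \<in> G y'"
    and pq: "q \<in> G p" "norm (p - u) \<le> e" "norm (q - v) \<le> e" and e: "0 < e" "e \<le> 1"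
    and yz: "norm (y' - z) \<le> e" and B: "norm (y' - y) \<le> B * h"
  shows "inner (y' - y + h *\<^sub>R v) (z - u) \<le> e * h * (2 * (B + norm v + 1) + norm (z - u))"
proof -
  define a where "a = y' - y + h *\<^sub>R q"
  have "0 \<le> inner ((1 / h) *\<^sub>R (y - y') - q) (y' - p)" by (rule maximal_monotone_ineq[OF G y pq(1)])
  then have "0 \<le> h * inner ((1 / h) *\<^sub>R (y - y') - q) (y' - p)" using h by simp
  also have "\<dots> = inner (h *\<^sub>R ((1 / h) *\<^sub>R (y - y') - q)) (y' - p)" by simp
  also have "h *\<^sub>R ((1 / h) *\<^sub>R (y - y') - q) = - a" using h by (simp add: a_def scaleR_diff_right)
  finally have 1: "inner a (y' - p) \<le> 0" by simp
  have "norm q \<le> norm v + norm (q - v)" by (rule norm_triangle_sub)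
  then have "norm q \<le> norm v + 1" using pq e by simp
  then have "h * norm q \<le> h * (norm v + 1)" using h by (intro mult_left_mono) auto
  moreover have "norm a \<le> norm (y' - y) + norm (h *\<^sub>R q)" unfolding a_def by (rule norm_triangle_ineq)
  ultimately have na: "norm a \<le> h * (B + norm v + 1)" using B h by (simp add: algebra_simps)
  have "(z - u) - (y' - p) = (p - u) - (y' - z)" by simp
  then have "norm ((z - u) - (y' - p)) \<le> norm (p - u) + norm (y' - z)"
    by (metis norm_triangle_ineq4)
  then have nw: "norm ((z - u) - (y' - p)) \<le> 2 * e" using yz pq by simp
  have "inner a ((z - u) - (y' - p)) \<le> norm a * norm ((z - u) - (y' - p))" by (rule norm_cauchy_schwarz)
  also have "\<dots> \<le> (h * (B + norm v + 1)) * (2 * e)"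
    by (rule mult_mono[OF na nw]) (use na in \<open>auto intro: order_trans[OF norm_ge_zero]\<close>)
  finally have 2: "inner a ((z - u) - (y' - p)) \<le> (h * (B + norm v + 1)) * (2 * e)" .
  have "inner (v - q) (z - u) \<le> norm (v - q) * norm (z - u)" by (rule norm_cauchy_schwarz)
  also have "\<dots> \<le> e * norm (z - u)" using pq by (intro mult_right_mono) (auto simp: norm_minus_commute)
  finally have 3: "h * inner (v - q) (z - u) \<le> h * (e * norm (z - u))" using h by (intro mult_left_mono) auto
  \<comment> \<open>The three terms are the monotone one, the error in the positions and the error
    in the value.\<close>
  have "inner (y' - y + h *\<^sub>R v) (z - u) = inner a (y' - p) + inner a ((z - u) - (y' - p)) + h * inner (v - q) (z - u)"
  proof -
    have "y' - y + h *\<^sub>R v = a + h *\<^sub>R (v - q)" by (simp add: a_def scaleR_diff_right)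
    then have "inner (y' - y + h *\<^sub>R v) (z - u) = inner a (z - u) + h * inner (v - q) (z - u)"
      by (simp only: inner_add_left inner_scaleR_left)
    moreover have "inner a (z - u) = inner a (y' - p) + inner a ((z - u) - (y' - p))"
      by (simp flip: inner_add_right)
    ultimately show ?thesis by simp
  qed
  also have "\<dots> \<le> 0 + (h * (B + norm v + 1)) * (2 * e) + h * (e * norm (z - u))"
    using 1 2 3 by linarith
  also have "\<dots> = e * h * (2 * (B + norm v + 1) + norm (z - u))" by (simp add: algebra_simps)
  finally show ?thesis .
qed

text \<open>Sum the discrete monotonicity inequality over the grid cells between \<open>t\<close> and \<open>t + d\<close>. Cells on
  which the majorant \<open>\<theta>\<close> has mean at most \<open>4 m\<close> are handled by inner approximation of the graph;
  the total contribution of the others is controlled by the excess \<open>max 0 (\<theta> - m)\<close>, whose integral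
  has a vanishing derivative at \<open>t\<close>.\<close>

lemma Euler_limit_inclusion:
  fixes F :: "real \<Rightarrow> 'a::euclidean_space \<Rightarrow> 'a set" and Y :: "nat \<Rightarrow> nat \<Rightarrow> 'a"
  assumes T: "0 < T" and A1: "\<forall>t\<in>{0..T}. maximal_monotone (F t)" and A4: "graph_osc_on T F"
    and \<theta>: "integrable lborel \<theta>" "\<And>x. 0 \<le> \<theta> x" and C: "0 \<le> C"
    and bd: "\<And>M. \<exists>B. \<forall>t\<in>{0..T}. g t \<le> M \<longrightarrow> (\<exists>u v. v \<in> F t u \<and> norm u \<le> B \<and> norm v \<le> B)"
    and h: "\<And>n. h n = T / real (Suc n)"
    and tau: "\<And>n k. k < Suc n \<Longrightarrow> \<tau> n k \<in> {h n * real k..h n * (real k + 1)}"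
    and Y: "\<And>n k. k < Suc n \<Longrightarrow> (1 / h n) *\<^sub>R (Y n k - Y n (Suc k)) \<in> F (\<tau> n k) (Y n (Suc k))"
    and step: "\<And>n k. k < Suc n \<Longrightarrow>
      norm (Y n (Suc k) - Y n k) \<le> C * (LINT x:{h n * (real k - 1)<..h n * (real k + 1)}|lborel. \<theta> x)"
    and hg: "\<And>n k. k < Suc n \<Longrightarrow> h n * g (\<tau> n k) \<le> (LINT x:{h n * (real k - 1)<..h n * (real k + 1)}|lborel. \<theta> x)"
    and hle: "\<And>n k. k < Suc n \<Longrightarrow> h n \<le> (LINT x:{h n * (real k - 1)<..h n * (real k + 1)}|lborel. \<theta> x)"
    and r: "strict_mono r"
    and x: "\<And>t. 0 \<le> t \<Longrightarrow> t \<le> T \<Longrightarrow> (\<lambda>n. Y (r n) (nat \<lfloor>t / h (r n)\<rfloor>)) \<longlonglongrightarrow> x t"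
    and t: "0 < t" "t < T"
    and m: "1 \<le> m" "\<forall>e>0. \<exists>d>0. \<forall>s u. s \<le> t \<and> t \<le> u \<and> u - s < d \<longrightarrow>
      (LINT x:{s<..u}|lborel. max 0 (\<theta> x - m)) \<le> e * (u - s)"
    and D: "(x has_vector_derivative D) (at t)"
  shows "- D \<in> F t (x t)"
proof (rule maximal_monotone_mem)
  show "maximal_monotone (F t)" using A1 t by simp
  fix u v assume uv: "v \<in> F t u"
  define w where "w = x t - u"
  define \<psi> where "\<psi> x = max 0 (\<theta> x - m)" for x
  have [measurable]: "\<theta> \<in> borel_measurable borel" using \<theta>(1) by auto
  have \<psi>: "integrable lborel \<psi>" "\<And>x. 0 \<le> \<psi> x"
    unfolding \<psi>_def using m(1) \<theta>(2)
    by (auto intro!: Bochner_Integration.integrable_bound[OF \<theta>(1)] simp: max_def)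
  obtain \<Theta> where \<Theta>: "\<And>s u. s \<le> u \<Longrightarrow> (LINT x:{s<..u}|lborel. \<theta> x) = \<Theta> u - \<Theta> s"
    "mono \<Theta>" "continuous_on UNIV \<Theta>"
    using indefinite_integral_exists[OF \<theta>] by blast
  obtain \<Psi> where \<Psi>: "\<And>s u. s \<le> u \<Longrightarrow> (LINT x:{s<..u}|lborel. \<psi> x) = \<Psi> u - \<Psi> s"
    "mono \<Psi>" "continuous_on UNIV \<Psi>"
    using indefinite_integral_exists[OF \<psi>] by blast
  have \<Theta>\<Psi>: "\<Theta> b - \<Theta> a \<le> m * (b - a) + (\<Psi> b - \<Psi> a)" if "a \<le> b" for a b
  proof -
    have c: "set_integrable lborel {a<..b} (\<lambda>x. m)" using that by (simp add: set_integrable_def)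
    have "(LINT x:{a<..b}|lborel. \<theta> x) \<le> (LINT x:{a<..b}|lborel. m + \<psi> x)"
    proof (rule set_integral_mono)
      show "set_integrable lborel {a<..b} (\<lambda>x. m + \<psi> x)"
        by (rule set_integral_add(1)[OF c set_integrable_lborel]) (auto simp: \<psi>)
    qed (auto simp: \<psi>_def set_integrable_lborel \<theta>)
    also have "\<dots> = (LINT x:{a<..b}|lborel. m) + (LINT x:{a<..b}|lborel. \<psi> x)"
      by (rule set_integral_add(2)[OF c set_integrable_lborel]) (auto simp: \<psi>)
    also have "(LINT x:{a<..b}|lborel. m) = m * (b - a)"
      using that by (simp add: set_lebesgue_integral_def mult.commute)
    finally show ?thesis using \<Theta>(1)[OF that] \<Psi>(1)[OF that] by simp
  qed
  define X where "X n s = Y n (nat \<lfloor>s / h n\<rfloor>)" for n s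
  have h0: "0 < h n" for n using T by (simp add: h)
  have "(\<lambda>n. T * (1 / real (Suc n))) \<longlonglongrightarrow> T * 0"
    by (intro tendsto_intros LIMSEQ_Suc lim_1_over_n)
  then have hr: "(\<lambda>n. h (r n)) \<longlonglongrightarrow> 0"
    using LIMSEQ_subseq_LIMSEQ[OF _ r, of h 0] by (simp add: h[abs_def] comp_def)
  have Xlim: "(\<lambda>n. X (r n) s) \<longlonglongrightarrow> x s" if "0 \<le> s" "s \<le> T" for s
    using x[OF that] by (simp add: X_def)
  have ddiff: "h n * (real k - 1) \<le> h n * (real k + 1)" for n k using h0[of n] by (intro mult_left_mono) auto
  have step': "norm (Y n (Suc k) - Y n k) \<le> C * (\<Theta> (h n * (real k + 1)) - \<Theta> (h n * (real k - 1)))"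
    if "k < Suc n" for n k using step[OF that] \<Theta>(1)[OF ddiff[of n k]] by simp
  \<comment> \<open>\<open>K1\<close> is the constant of \<open>Euler_step_inner_le\<close> when
    increments are at most \<open>4 * m * C * h\<close>; \<open>K2\<close> comes from the plain
    Cauchy-Schwarz bound on the remaining cells. Neither depends on \<open>e\<close>.\<close>
  define K1 where "K1 = 2 * (4 * m * C + norm v + 1) + norm w"
  define K2 where "K2 = (C + norm v) * norm w"
  have K0: "0 \<le> K1" "0 \<le> K2" using C m by (auto simp: K1_def K2_def)
  have contT: "isCont \<Theta> s" "isCont \<Psi> s" for s
    using \<Theta>(3) \<Psi>(3) by (auto simp: continuous_on_eq_continuous_at)
  \<comment> \<open>Forward increments are enough, since \<open>x\<close> is differentiable at
    \<open>t\<close>: afterwards one divides by \<open>d\<close> and lets \<open>e\<close> tend to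
    0.\<close>
  have claim: "\<exists>\<delta>>0. \<forall>d. 0 < d \<and> d < \<delta> \<longrightarrow>
      inner (x (t + d) - x t + d *\<^sub>R v) w \<le> e * (K1 + 4 * K2) * d"
    if e: "0 < e" "e \<le> 1" for e
  proof -
    obtain d0 where d0: "0 < d0" "\<And>s u. s \<le> t \<Longrightarrow> t \<le> u \<Longrightarrow> u - s < d0 \<Longrightarrow> (LINT x:{s<..u}|lborel. \<psi> x) \<le> e * (u - s)"
    proof -
      from m(2)[folded \<psi>_def, rule_format, OF e(1)] obtain d where "0 < d"
        and "\<forall>s u. s \<le> t \<and> t \<le> u \<and> u - s < d \<longrightarrow> (LINT x:{s<..u}|lborel. \<psi> x) \<le> e * (u - s)" by blast
      then show thesis by (intro that[of d]) auto
    qed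
    obtain d1 where d1: "0 < d1" "\<And>s. s \<in> {0..T} \<Longrightarrow> \<bar>s - t\<bar> < d1 \<Longrightarrow> g s \<le> 4 * m \<Longrightarrow>
        \<exists>p q. q \<in> F s p \<and> norm (p - u) < e \<and> norm (q - v) < e"
    proof -
      have "t \<in> {0..T}" using t by simp
      from graph_inner_approximation[OF A1 A4 bd this uv e(1), of "4 * m"] obtain d where "0 < d"
        and "\<forall>s\<in>{0..T}. \<bar>s - t\<bar> < d \<longrightarrow> g s \<le> 4 * m \<longrightarrow> (\<exists>p q. q \<in> F s p \<and> norm (p - u) < e \<and> norm (q - v) < e)"
        by blast
      then show thesis by (intro that[of d]) auto
    qed
    \<comment> \<open>The oscillation of the approximation near \<open>t\<close> is at most
      \<open>4 * C * e'\<close>, below \<open>e / 2\<close>; the other \<open>e / 2\<close> is the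
      distance from its value at \<open>t\<close> to \<open>x t\<close>.\<close>
    define e' where "e' = e / (8 * C + 8)"
    have e': "0 < e'" "4 * C * e' < e / 2" using e C by (auto simp: e'_def divide_simps)
    obtain d2 where d2: "0 < d2" "\<And>s. \<bar>s - t\<bar> < d2 \<Longrightarrow> \<bar>\<Theta> s - \<Theta> t\<bar> < e'"
      using contT(1)[of t] e' unfolding continuous_at_eps_delta dist_real_def by blast
    define \<delta> where "\<delta> = Min {d0, d1, d2, T - t}"
    have \<delta>: "0 < \<delta>" "\<delta> \<le> d0" "\<delta> \<le> d1" "\<delta> \<le> d2" "\<delta> \<le> T - t"
      using d0 d1 d2 t by (auto simp: \<delta>_def)
    have "inner (x (t + d) - x t + d *\<^sub>R v) w \<le> e * (K1 + 4 * K2) * d" if d: "0 < d" "d < \<delta>" for d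
    proof -
      define i where "i n = nat \<lfloor>t / h n\<rfloor>" for n
      define j where "j n = nat \<lfloor>(t + d) / h n\<rfloor>" for n
      have tdT: "t + d \<le> T" "0 \<le> t + d" using d \<delta> t by auto
      have gi: "h n * real (i n) \<le> t" "t < h n * (real (i n) + 1)" for n
        using floor_grid[OF h _ T, of n t] t by (auto simp: i_def)
      have gj: "j n \<le> Suc n" "h n * real (j n) \<le> t + d" "t + d < h n * (real (j n) + 1)" for n
        using floor_grid[OF h _ T tdT(2,1), of n] by (auto simp: j_def)
      have ij: "i n \<le> j n" for n using floor_grid_mono[OF h0, of t "t + d"] d by (simp add: i_def j_def)
      have eh: "eventually (\<lambda>n. 2 * h (r n) < Min {\<delta>, t}) sequentially"
      proof -
        have "(\<lambda>n. 2 * h (r n)) \<longlonglongrightarrow> 2 * 0" by (intro tendsto_intros hr)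
        then show ?thesis using \<delta> t by (intro order_tendstoD(2)) auto
      qed
      have eX: "eventually (\<lambda>n. dist (X (r n) t) (x t) < e / 2) sequentially"
        using t e by (intro tendstoD[OF Xlim]) auto
      have bound: "inner (X (r n) (t + d) - X (r n) t + (h (r n) * real (j (r n)) - h (r n) * real (i (r n))) *\<^sub>R v) w
          \<le> e * K1 * (h (r n) * real (j (r n)) - h (r n) * real (i (r n))) + 4 * K2 * (\<Psi> (t + d) - \<Psi> (t - 2 * h (r n)))"
        if n: "2 * h (r n) < Min {\<delta>, t}" "dist (X (r n) t) (x t) < e / 2" for n
      proof -
        define N where "N = r n"
        define H where "H = h N"
        note n' = n[folded N_def]
        have H: "0 < H" "2 * H < \<delta>" "2 * H < t" using n' h0[of N] by (auto simp: H_def)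
        have cell: "inner (Y N (Suc k) - Y N k + H *\<^sub>R v) w
            \<le> e * H * K1 + 2 * K2 * (\<Psi> (H * (real k + 1)) - \<Psi> (H * (real k - 1)))"
          if k: "i N \<le> k" "k < j N" for k
        proof -
          have kN: "k < Suc N" using k gj(1)[of N] by simp
          define Dk where "Dk = \<Theta> (H * (real k + 1)) - \<Theta> (H * (real k - 1))"
          define Pk where "Pk = \<Psi> (H * (real k + 1)) - \<Psi> (H * (real k - 1))"
          have dd: "H * (real k - 1) \<le> H * (real k + 1)" using ddiff[of N k] by (simp add: H_def)
          have P0: "0 \<le> Pk" unfolding Pk_def using monoD[OF \<Psi>(2) dd] by simp
          have HD: "H \<le> Dk" "H * g (\<tau> N k) \<le> Dk" "norm (Y N (Suc k) - Y N k) \<le> C * Dk"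
            using hle[OF kN] hg[OF kN] step'[OF kN] \<Theta>(1)[OF ddiff[of N k]] by (auto simp: Dk_def H_def)
          have DP: "Dk \<le> 2 * m * H + Pk"
            using \<Theta>\<Psi>[OF dd] by (simp add: Dk_def Pk_def algebra_simps)
          \<comment> \<open>The doubled cell has length \<open>2 * H\<close>, so \<open>Dk\<close>
            is at most \<open>2 * m * H\<close> plus the excess \<open>Pk\<close>. Beyond the
            threshold \<open>4 * m * H\<close> the first term is less than half of
            \<open>Dk\<close>, hence \<open>Dk\<close> is at most \<open>2 * Pk\<close>. Below it,
            \<open>g\<close> at the sampling time is at most \<open>4 * m\<close>, the level for
            which \<open>d1\<close> was chosen.\<close>
          show ?thesis
          proof (cases "Dk \<le> 4 * m * H")
            case True
            have "real (i N) \<le> real k" "real k + 1 \<le> real (j N)" using k by auto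
            then have "H * (real (i N) + 1) \<le> H * (real k + 1)" "H * (real k + 1) \<le> H * real (j N)"
              "H * real (i N) \<le> H * real k"
              using H by (auto intro!: mult_left_mono)
            then have k1: "t < H * (real k + 1)" "H * (real k + 1) \<le> t + d"
              using gi(2)[of N] gj(2)[of N] by (auto simp: H_def)
            then have k2: "t - H < H * real k" by (simp add: algebra_simps)
            have tk: "\<tau> N k \<in> {H * real k..H * (real k + 1)}" using tau[OF kN] by (simp add: H_def)
            have tkT: "\<tau> N k \<in> {0..T}" using tk k1 k2 H tdT by auto
            have "H * g (\<tau> N k) \<le> H * (4 * m)" using HD(2) True by (simp add: mult.commute)
            then have g4: "g (\<tau> N k) \<le> 4 * m" using H by simp
            have "\<bar>\<tau> N k - t\<bar> < d1" using tk k1 k2 H d \<delta> by auto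
            then obtain p q where pq: "q \<in> F (\<tau> N k) p" "norm (p - u) < e" "norm (q - v) < e"
              using d1(2)[OF tkT _ g4] by blast
            \<comment> \<open>Identifies \<open>Y N (Suc k)\<close> with the value of the step
              function at the right end of the cell, so that the increment bound compares it with
              the value at \<open>t\<close>.\<close>
            have "nat \<lfloor>H * (real k + 1) / h N\<rfloor> = Suc k"
            proof -
              have "H * (real k + 1) / h N = real (Suc k)" using h0[of N] by (simp add: H_def)
              then show ?thesis by simp
            qed
            then have "Y N (Suc k) = X N (H * (real k + 1))" by (simp add: X_def)
            moreover have "norm (X N (H * (real k + 1)) - X N t) \<le> 2 * C * (\<Theta> (H * (real k + 1)) - \<Theta> (t - 2 * H))"
              unfolding X_def H_def
              using t k1 tdT by (intro Euler_increment_le[OF h _ T C \<Theta>(2) step']) (auto simp: H_def)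
            moreover have "2 * C * (\<Theta> (H * (real k + 1)) - \<Theta> (t - 2 * H)) \<le> 2 * C * (2 * e')"
            proof -
              have "\<bar>\<Theta> (H * (real k + 1)) - \<Theta> t\<bar> < e'" using k1 d \<delta> by (intro d2(2)) auto
              moreover have "\<bar>\<Theta> (t - 2 * H) - \<Theta> t\<bar> < e'" using H \<delta> by (intro d2(2)) auto
              ultimately show ?thesis using C by (intro mult_left_mono) auto
            qed
            moreover have "norm (X N t - x t) < e / 2" using n'(2) by (simp add: dist_norm)
            moreover have "norm (Y N (Suc k) - x t) \<le> norm (Y N (Suc k) - X N t) + norm (X N t - x t)"
              by (metis dist_norm dist_triangle)
            ultimately have yx: "norm (Y N (Suc k) - x t) \<le> e" using e' by simp
            have "norm (Y N (Suc k) - Y N k) \<le> C * (4 * m * H)"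
              using HD(3) mult_left_mono[OF True C] by linarith
            then have nb: "norm (Y N (Suc k) - Y N k) \<le> (4 * m * C) * H" by (simp add: mult.commute mult.left_commute)
            have "inner (Y N (Suc k) - Y N k + H *\<^sub>R v) (x t - u) \<le> e * H * (2 * (4 * m * C + norm v + 1) + norm (x t - u))"
              using A1 tkT Y[OF kN] pq e yx nb H(1)
              by (intro Euler_step_inner_le[where G = "F (\<tau> N k)" and q = q and p = p]) (auto simp: H_def)
            then have "inner (Y N (Suc k) - Y N k + H *\<^sub>R v) w \<le> e * H * K1" by (simp add: K1_def w_def)
            moreover have "0 \<le> 2 * K2 * Pk" using K0 P0 by simp
            ultimately show ?thesis unfolding Pk_def by linarith
          next
            case False
            then have D2: "Dk \<le> 2 * Pk" using DP by linarith
            have D0: "0 \<le> Dk" using HD(1) H by simp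
            have "inner (Y N (Suc k) - Y N k + H *\<^sub>R v) w \<le> norm (Y N (Suc k) - Y N k + H *\<^sub>R v) * norm w"
              by (rule norm_cauchy_schwarz)
            also have "\<dots> \<le> ((C + norm v) * Dk) * norm w"
            proof (rule mult_right_mono)
              have "norm (Y N (Suc k) - Y N k + H *\<^sub>R v) \<le> norm (Y N (Suc k) - Y N k) + H * norm v"
                using H norm_triangle_ineq[of "Y N (Suc k) - Y N k" "H *\<^sub>R v"] by simp
              \<comment> \<open>Here the lower bound \<open>H \<le> Dk\<close> is used: it charges
                the term with \<open>v\<close> to the excess as well.\<close>
              also have "\<dots> \<le> C * Dk + Dk * norm v" using HD by (intro add_mono mult_right_mono) auto
              finally show "norm (Y N (Suc k) - Y N k + H *\<^sub>R v) \<le> (C + norm v) * Dk" by (simp add: algebra_simps)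
            qed simp
            also have "\<dots> = K2 * Dk" by (simp add: K2_def algebra_simps)
            also have "\<dots> \<le> K2 * (2 * Pk)" using D2 K0 by (intro mult_left_mono) auto
            also have "\<dots> \<le> e * H * K1 + 2 * K2 * Pk" using e H K0 by simp
            finally show ?thesis unfolding Pk_def .
          qed
        qed
        \<comment> \<open>The doubled cells overlap, so again two shifted copies are summed to
          obtain a telescoping expression.\<close>
        define E where "E k = \<Psi> (H * real k) + \<Psi> (H * (real k - 1))" for k
        have "inner (Y N l - Y N (i N) + (H * real l - H * real (i N)) *\<^sub>R v) w
            \<le> e * K1 * (H * real l - H * real (i N)) + 2 * K2 * (E l - E (i N))" if "i N \<le> l" "l \<le> j N" for l
          using that
        proof (induction l rule: dec_induct)
          case base show ?case by simp
        next
          case (step l)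
          have "inner (Y N (Suc l) - Y N (i N) + (H * real (Suc l) - H * real (i N)) *\<^sub>R v) w
            = inner (Y N l - Y N (i N) + (H * real l - H * real (i N)) *\<^sub>R v) w + inner (Y N (Suc l) - Y N l + H *\<^sub>R v) w"
            unfolding inner_add_left[symmetric] by (simp add: algebra_simps)
          also have "\<dots> \<le> (e * K1 * (H * real l - H * real (i N)) + 2 * K2 * (E l - E (i N)))
              + (e * H * K1 + 2 * K2 * (\<Psi> (H * (real l + 1)) - \<Psi> (H * (real l - 1))))"
            using step by (intro add_mono cell) auto
          also have "\<dots> = e * K1 * (H * real (Suc l) - H * real (i N)) + 2 * K2 * (E (Suc l) - E (i N))"
            by (simp add: E_def algebra_simps)
          finally show ?case .
        qed
        from this[OF ij order_refl]
        have "inner (Y N (j N) - Y N (i N) + (H * real (j N) - H * real (i N)) *\<^sub>R v) w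
            \<le> e * K1 * (H * real (j N) - H * real (i N)) + 2 * K2 * (E (j N) - E (i N))" .
        also have "2 * K2 * (E (j N) - E (i N)) \<le> 2 * K2 * (2 * (\<Psi> (t + d) - \<Psi> (t - 2 * H)))"
        proof (rule mult_left_mono)
          have g1: "H * real (j N) \<le> t + d" "t < H * (real (i N) + 1)" using gj(2)[of N] gi(2)[of N] by (auto simp: H_def)
          have "\<Psi> (H * real (j N)) \<le> \<Psi> (t + d)" "\<Psi> (H * (real (j N) - 1)) \<le> \<Psi> (t + d)"
            "\<Psi> (t - 2 * H) \<le> \<Psi> (H * real (i N))" "\<Psi> (t - 2 * H) \<le> \<Psi> (H * (real (i N) - 1))"
            using g1 H by (auto intro!: monoD[OF \<Psi>(2)] simp: algebra_simps)
          then show "E (j N) - E (i N) \<le> 2 * (\<Psi> (t + d) - \<Psi> (t - 2 * H))" by (simp add: E_def)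
        qed (use K0 in simp)
        also have "2 * K2 * (2 * (\<Psi> (t + d) - \<Psi> (t - 2 * H))) = 4 * K2 * (\<Psi> (t + d) - \<Psi> (t - 2 * H))"
          by simp
        finally show ?thesis by (simp add: X_def i_def j_def N_def H_def)
      qed
      have lim_i: "(\<lambda>n. h (r n) * real (i (r n))) \<longlonglongrightarrow> t"
      proof (rule tendsto_sandwich[OF _ _ _ tendsto_const])
        show "(\<lambda>n. t - h (r n)) \<longlonglongrightarrow> t" using tendsto_diff[OF tendsto_const hr, of t] by simp
        show "eventually (\<lambda>n. t - h (r n) \<le> h (r n) * real (i (r n))) sequentially"
          using gi(2) by (intro always_eventually allI less_imp_le) (simp add: algebra_simps)
        show "eventually (\<lambda>n. h (r n) * real (i (r n)) \<le> t) sequentially" using gi(1) by (intro always_eventually allI)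
      qed
      have lim_j: "(\<lambda>n. h (r n) * real (j (r n))) \<longlonglongrightarrow> t + d"
      proof (rule tendsto_sandwich[OF _ _ _ tendsto_const])
        show "(\<lambda>n. t + d - h (r n)) \<longlonglongrightarrow> t + d" using tendsto_diff[OF tendsto_const hr, of "t + d"] by simp
        show "eventually (\<lambda>n. t + d - h (r n) \<le> h (r n) * real (j (r n))) sequentially"
          using gj(3) by (intro always_eventually allI less_imp_le) (simp add: algebra_simps)
        show "eventually (\<lambda>n. h (r n) * real (j (r n)) \<le> t + d) sequentially" using gj(2) by (intro always_eventually allI)
      qed
      have L: "(\<lambda>n. inner (X (r n) (t + d) - X (r n) t + (h (r n) * real (j (r n)) - h (r n) * real (i (r n))) *\<^sub>R v) w)
          \<longlonglongrightarrow> inner (x (t + d) - x t + (t + d - t) *\<^sub>R v) w"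
        using t tdT by (intro tendsto_intros lim_i lim_j Xlim) auto
      have "(\<lambda>n. t - 2 * h (r n)) \<longlonglongrightarrow> t - 2 * 0" by (intro tendsto_intros hr)
      then have "(\<lambda>n. \<Psi> (t - 2 * h (r n))) \<longlonglongrightarrow> \<Psi> t" by (intro isCont_tendsto_compose[OF contT(2)]) simp
      then have R: "(\<lambda>n. e * K1 * (h (r n) * real (j (r n)) - h (r n) * real (i (r n))) + 4 * K2 * (\<Psi> (t + d) - \<Psi> (t - 2 * h (r n))))
          \<longlonglongrightarrow> e * K1 * (t + d - t) + 4 * K2 * (\<Psi> (t + d) - \<Psi> t)"
        by (intro tendsto_intros lim_i lim_j)
      have "eventually (\<lambda>n. inner (X (r n) (t + d) - X (r n) t + (h (r n) * real (j (r n)) - h (r n) * real (i (r n))) *\<^sub>R v) w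
          \<le> e * K1 * (h (r n) * real (j (r n)) - h (r n) * real (i (r n))) + 4 * K2 * (\<Psi> (t + d) - \<Psi> (t - 2 * h (r n)))) sequentially"
        using eh eX by eventually_elim (rule bound)
      then have "inner (x (t + d) - x t + (t + d - t) *\<^sub>R v) w \<le> e * K1 * (t + d - t) + 4 * K2 * (\<Psi> (t + d) - \<Psi> t)"
        by (rule tendsto_le[OF sequentially_bot R L])
      moreover have "\<Psi> (t + d) - \<Psi> t \<le> e * d"
        using d0(2)[of t "t + d"] \<Psi>(1)[of t "t + d"] d \<delta> by simp
      then have "4 * K2 * (\<Psi> (t + d) - \<Psi> t) \<le> 4 * K2 * (e * d)" using K0 by (intro mult_left_mono) auto
      ultimately show ?thesis by (simp add: algebra_simps)
    qed
    then show ?thesis using \<delta>(1) by blast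
  qed
  have le_e: "inner (D + v) w \<le> e * (K1 + 4 * K2 + norm w)" if e: "0 < e" "e \<le> 1" for e
  proof -
    obtain \<delta> where \<delta>: "0 < \<delta>" "\<And>d. 0 < d \<Longrightarrow> d < \<delta> \<Longrightarrow>
      inner (x (t + d) - x t + d *\<^sub>R v) w \<le> e * (K1 + 4 * K2) * d"
      using claim[OF e] by blast
    obtain \<eta> where \<eta>: "0 < \<eta>" "\<And>y. norm (y - t) < \<eta> \<Longrightarrow> norm (x y - x t - (y - t) *\<^sub>R D) \<le> e * norm (y - t)"
      using D e(1) unfolding has_vector_derivative_def has_derivative_at_alt by blast
    define d where "d = min \<delta> \<eta> / 2"
    have d: "0 < d" "d < \<delta>" "d < \<eta>" using \<delta>(1) \<eta>(1) by (auto simp: d_def)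
    have "norm (x (t + d) - x t - d *\<^sub>R D) \<le> e * d" using \<eta>(2)[of "t + d"] d by simp
    then have "norm (x (t + d) - x t - d *\<^sub>R D) * norm w \<le> e * d * norm w" by (intro mult_right_mono) auto
    moreover have "- inner (x (t + d) - x t - d *\<^sub>R D) w \<le> norm (x (t + d) - x t - d *\<^sub>R D) * norm w"
      using norm_cauchy_schwarz[of "- (x (t + d) - x t - d *\<^sub>R D)" w] unfolding norm_minus_cancel inner_minus_left .
    moreover have "inner (x (t + d) - x t + d *\<^sub>R v) w = inner (x (t + d) - x t - d *\<^sub>R D) w + d * inner (D + v) w"
      unfolding inner_scaleR_left[symmetric] inner_add_left[symmetric] by (simp add: algebra_simps)
    ultimately have "d * inner (D + v) w \<le> e * (K1 + 4 * K2) * d + e * d * norm w" using \<delta>(2)[OF d(1,2)] by linarith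
    then have "d * inner (D + v) w \<le> d * (e * (K1 + 4 * K2 + norm w))" by (simp add: algebra_simps)
    then show ?thesis using d(1) by simp
  qed
  have "inner (D + v) w \<le> 0"
  proof (rule field_le_epsilon)
    fix \<eta> :: real assume \<eta>: "0 < \<eta>"
    define K where "K = K1 + 4 * K2 + norm w + 1"
    have K: "0 < K" "K1 + 4 * K2 + norm w \<le> K" using K0 by (auto simp: K_def add_nonneg_pos)
    define e where "e = min 1 (\<eta> / K)"
    have e: "0 < e" "e \<le> 1" using \<eta> K by (auto simp: e_def)
    have "e * (K1 + 4 * K2 + norm w) \<le> (\<eta> / K) * K" using K0 K \<eta> by (intro mult_mono) (auto simp: e_def)
    then show "inner (D + v) w \<le> 0 + \<eta>" using le_e[OF e] K by simp
  qed
  moreover have "inner (v - - D) (u - x t) = - inner (D + v) w"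
    by (simp add: w_def inner_diff_right add.commute)
  ultimately show "0 \<le> inner (v - - D) (u - x t)" by simp
qed

section \<open>Differentiability almost everywhere of the limit\<close>

text \<open>Adding the indefinite integral of \<open>f\<close> makes each coordinate nondecreasing
  while it stays absolutely continuous, so it has a density; subtracting \<open>f\<close> again
  represents the coordinate itself as an integral. Lebesgue differentiation, applied to finitely
  many coordinates, then gives the derivative.\<close>

lemma AE_differentiable_of_dominated:
  fixes x :: "real \<Rightarrow> 'a::euclidean_space"
  assumes f: "integrable lborel f" and f0: "\<And>t. 0 \<le> f t" and ab: "a \<le> b"
    and x: "\<And>s u. a \<le> s \<Longrightarrow> s \<le> u \<Longrightarrow> u \<le> b \<Longrightarrow> norm (x u - x s) \<le> (LINT t:{s<..u}|lborel. f t)"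
  shows "AE t in lborel. t \<in> {a<..<b} \<longrightarrow> (\<exists>D. (x has_vector_derivative D) (at t))"
proof -
  obtain \<Theta> where \<Theta>: "\<And>s u. s \<le> u \<Longrightarrow> (LINT x:{s<..u}|lborel. f x) = \<Theta> u - \<Theta> s"
    "mono \<Theta>" "continuous_on UNIV \<Theta>"
    using indefinite_integral_exists[OF f f0] by blast
  have "\<exists>k. integrable lborel k \<and> (\<forall>s u. a \<le> s \<and> s \<le> u \<and> u \<le> b \<longrightarrow> inner (x u) i - inner (x s) i = (LINT t:{s<..u}|lborel. k t))"
    if i: "i \<in> Basis" for i
  proof -
    define G where "G t = \<Theta> t + inner (x t) i" for t
    have d: "\<bar>inner (x u) i - inner (x s) i\<bar> \<le> \<Theta> u - \<Theta> s" if "a \<le> s" "s \<le> u" "u \<le> b" for s u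
      using Basis_le_norm[OF i, of "x u - x s"] x[OF that] \<Theta>(1)[OF that(2)] by (simp add: inner_diff_left)
    have m: "mono_on {a..b} G"
    proof (rule mono_onI)
      fix s u assume "s \<in> {a..b}" "u \<in> {a..b}" "s \<le> u"
      then show "G s \<le> G u" using d[of s u] by (simp add: G_def abs_le_iff)
    qed
    have ac: "absolutely_continuous_on_interval a b G"
    proof (rule absolutely_continuous_of_dominated)
      show "integrable lborel (\<lambda>t. 2 * f t)" using f by simp
      show "norm (G u - G s) \<le> (LINT x:{s<..u}|lborel. 2 * f x)" if "a \<le> s" "s \<le> u" "u \<le> b" for s u
        using d[OF that] \<Theta>(1)[OF that(2)] by (simp add: G_def abs_le_iff)
    qed (use f0 in simp)
    obtain k where k: "integrable lborel k" "\<And>x. 0 \<le> k x"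
      "\<And>s t. a \<le> s \<Longrightarrow> s \<le> t \<Longrightarrow> t \<le> b \<Longrightarrow> G t - G s = (LINT x:{s<..t}|lborel. k x)"
      by (fact absolutely_continuous_mono_density[OF ab ac m])
    show ?thesis
    proof (intro exI[of _ "\<lambda>t. k t - f t"] conjI allI impI)
      show "integrable lborel (\<lambda>t. k t - f t)" using k f by simp
      fix s u assume su: "a \<le> s \<and> s \<le> u \<and> u \<le> b"
      then have "(LINT t:{s<..u}|lborel. k t - f t) = (LINT t:{s<..u}|lborel. k t) - (LINT t:{s<..u}|lborel. f t)"
        by (intro set_integral_diff set_integrable_lborel k f) auto
      then show "inner (x u) i - inner (x s) i = (LINT t:{s<..u}|lborel. k t - f t)"
        using k(3)[of s u] \<Theta>(1)[of s u] su by (simp add: G_def)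
    qed
  qed
  then obtain k where k: "\<And>i. i \<in> Basis \<Longrightarrow> integrable lborel (k i)"
    and xk: "\<And>i s u. i \<in> Basis \<Longrightarrow> a \<le> s \<Longrightarrow> s \<le> u \<Longrightarrow> u \<le> b \<Longrightarrow> inner (x u) i - inner (x s) i = (LINT t:{s<..u}|lborel. k i t)"
    by metis
  have "AE t in lborel. \<forall>i\<in>Basis. \<forall>e>0. \<exists>d>0. \<forall>s u. s \<le> t \<and> t \<le> u \<and> u - s < d \<longrightarrow>
    \<bar>(LINT x:{s<..u}|lborel. k i x) - k i t * (u - s)\<bar> \<le> e * (u - s)"
    by (intro AE_finite_allI finite_Basis AE_Lebesgue_differentiation k)
  then show ?thesis
  proof eventually_elim
    case (elim t)
    show ?case
    proof
      assume t: "t \<in> {a<..<b}"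
      have "(x has_vector_derivative (\<Sum>i\<in>Basis. k i t *\<^sub>R i)) (at t)"
        unfolding has_vector_derivative_def
      proof (subst has_derivative_componentwise_within, intro ballI)
        fix i :: 'a assume i: "i \<in> Basis"
        have "((\<lambda>s. inner (x s) i) has_real_derivative k i t) (at t)"
          using t xk[OF i] elim i by (intro DERIV_of_straddle[where a = a and b = b and f = "k i"]) auto
        then have "((\<lambda>s. inner (x s) i) has_derivative (*) (k i t)) (at t)"
          by (simp add: has_field_derivative_def)
        also have "(*) (k i t) = (\<lambda>s. inner (s *\<^sub>R (\<Sum>i\<in>Basis. k i t *\<^sub>R i)) i)"
          using i by (simp add: fun_eq_iff inner_sum_left inner_Basis if_distrib sum.delta cong: if_cong)
        finally show "((\<lambda>s. inner (x s) i) has_derivative (\<lambda>s. inner (s *\<^sub>R (\<Sum>i\<in>Basis. k i t *\<^sub>R i)) i)) (at t)" .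
      qed
      then show "\<exists>D. (x has_vector_derivative D) (at t)" ..
    qed
  qed
qed

section \<open>Existence and uniqueness of solutions\<close>

text \<open>Formulated through increments rather than composition, so that it covers negation, the
  squared norm of a bounded function, and restriction to a subinterval.\<close>

lemma absolutely_continuous_lipschitz:
  fixes f :: "real \<Rightarrow> 'b::real_normed_vector" and g :: "real \<Rightarrow> 'c::real_normed_vector"
  assumes f: "absolutely_continuous_on_interval a b f" and cd: "a \<le> c" "d \<le> b"
    and le: "\<And>u v. c \<le> u \<Longrightarrow> u \<le> v \<Longrightarrow> v \<le> d \<Longrightarrow> norm (g v - g u) \<le> K * norm (f v - f u)"
  shows "absolutely_continuous_on_interval c d g"
  unfolding absolutely_continuous_on_interval_def
proof (intro allI impI)
  fix e :: real assume e: "0 < e"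
  define e' where "e' = e / (\<bar>K\<bar> + 1)"
  have e': "0 < e'" "\<bar>K\<bar> * e' < e"
  proof -
    show "0 < e'" using e by (simp add: e'_def)
    have "\<bar>K\<bar> * e < e * (\<bar>K\<bar> + 1)" using e by (simp add: distrib_left mult.commute)
    then show "\<bar>K\<bar> * e' < e" by (simp add: e'_def pos_divide_less_eq)
  qed
  obtain \<delta> where \<delta>: "0 < \<delta>" and D: "\<And>I :: (real \<times> real) set.
        finite I \<and> (\<forall>(u, v)\<in>I. a \<le> u \<and> u \<le> v \<and> v \<le> b) \<and>
        (\<forall>p\<in>I. \<forall>q\<in>I. p \<noteq> q \<longrightarrow> snd p \<le> fst q \<or> snd q \<le> fst p) \<and>
        (\<Sum>(u, v)\<in>I. v - u) < \<delta> \<Longrightarrow> (\<Sum>(u, v)\<in>I. norm (f v - f u)) < e'"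
    using f e'(1) unfolding absolutely_continuous_on_interval_def by blast
  show "\<exists>\<delta>>0. \<forall>I :: (real \<times> real) set. finite I \<and> (\<forall>(u, v)\<in>I. c \<le> u \<and> u \<le> v \<and> v \<le> d) \<and>
        (\<forall>p\<in>I. \<forall>q\<in>I. p \<noteq> q \<longrightarrow> snd p \<le> fst q \<or> snd q \<le> fst p) \<and>
        (\<Sum>(u, v)\<in>I. v - u) < \<delta> \<longrightarrow> (\<Sum>(u, v)\<in>I. norm (g v - g u)) < e"
  proof (intro exI[of _ \<delta>] conjI allI impI \<delta>)
    fix I :: "(real \<times> real) set"
    assume I: "finite I \<and> (\<forall>(u, v)\<in>I. c \<le> u \<and> u \<le> v \<and> v \<le> d) \<and>
        (\<forall>p\<in>I. \<forall>q\<in>I. p \<noteq> q \<longrightarrow> snd p \<le> fst q \<or> snd q \<le> fst p) \<and> (\<Sum>(u, v)\<in>I. v - u) < \<delta>"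
    have "(\<Sum>(u, v)\<in>I. norm (g v - g u)) \<le> (\<Sum>(u, v)\<in>I. \<bar>K\<bar> * norm (f v - f u))"
    proof (intro sum_mono, clarify)
      fix u v assume "(u, v) \<in> I"
      then have "norm (g v - g u) \<le> K * norm (f v - f u)" using I by (intro le) auto
      also have "\<dots> \<le> \<bar>K\<bar> * norm (f v - f u)" by (intro mult_right_mono) auto
      finally show "norm (g v - g u) \<le> \<bar>K\<bar> * norm (f v - f u)" .
    qed
    also have "\<dots> = \<bar>K\<bar> * (\<Sum>(u, v)\<in>I. norm (f v - f u))"
      by (simp add: sum_distrib_left case_prod_beta)
    also have "\<dots> \<le> \<bar>K\<bar> * e'"
    proof (rule mult_left_mono)
      have "(\<Sum>(u, v)\<in>I. norm (f v - f u)) < e'" using I cd by (intro D) fastforce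
      then show "(\<Sum>(u, v)\<in>I. norm (f v - f u)) \<le> e'" by simp
    qed simp
    finally show "(\<Sum>(u, v)\<in>I. norm (g v - g u)) < e" using e' by simp
  qed
qed

lemma is_solution_unique:
  fixes F :: "real \<Rightarrow> 'a::euclidean_space \<Rightarrow> 'a set"
  assumes A1: "\<forall>t\<in>{0..T}. maximal_monotone (F t)"
    and x: "is_solution T F x0 x" and y: "is_solution T F x0 y" and t: "t \<in> {0..T}"
  shows "x t = y t"
proof -
  define z where "z s = x s + - y s" for s
  define w where "w s = inner (z s) (z s)" for s
  have acx: "absolutely_continuous_on_interval 0 T x" "absolutely_continuous_on_interval 0 T y"
    using x y by (auto simp: is_solution_def)
  have "absolutely_continuous_on_interval 0 T (\<lambda>s. - y s)"
    by (rule absolutely_continuous_lipschitz[OF acx(2) order_refl order_refl, of _ 1]) (simp add: norm_minus_commute)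
  then have acz: "absolutely_continuous_on_interval 0 T z"
    unfolding z_def by (intro absolutely_continuous_add acx)
  then have "compact (z ` {0..T})"
    by (intro compact_continuous_image absolutely_continuous_imp_continuous_on) auto
  then obtain B where B: "\<And>s. s \<in> {0..T} \<Longrightarrow> norm (z s) \<le> B"
    using compact_imp_bounded bounded_iff by (metis imageI)
  \<comment> \<open>The squared distance is studied on \<open>{0..t}\<close> only, since the
    comparison principle relates the two endpoints of its interval.\<close>
  have acw: "absolutely_continuous_on_interval 0 t w"
  proof (rule absolutely_continuous_lipschitz[OF acz, of _ _ _ "2 * B"])
    fix u v assume uv: "0 \<le> u" "u \<le> v" "v \<le> t"
    have "w v - w u = inner (z v - z u) (z v + z u)"
      by (simp add: w_def inner_diff_left inner_diff_right inner_add_right inner_commute)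
    then have "norm (w v - w u) \<le> norm (z v - z u) * norm (z v + z u)"
      by (simp add: Cauchy_Schwarz_ineq2)
    also have "\<dots> \<le> norm (z v - z u) * (2 * B)"
      using B[of u] B[of v] uv t norm_triangle_ineq[of "z v" "z u"] by (intro mult_left_mono) auto
    finally show "norm (w v - w u) \<le> 2 * B * norm (z v - z u)" by (simp add: mult.commute)
  qed (use t in auto)
  have "AE s in lborel. s \<in> {0..T} \<longrightarrow> (\<exists>v. (q has_vector_derivative v) (at s within {0..T}) \<and> - v \<in> F s (q s))"
    if "is_solution T F x0 q" for q
    using that[unfolded is_solution_def, THEN conjunct2, THEN conjunct2] by (rule eventually_mono) blast
  from this[OF x] this[OF y]
  have "AE s in lborel. s \<in> {0..t} \<longrightarrow> (\<exists>D\<le>0. (w has_real_derivative D) (at s within {0..t}))"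
  proof eventually_elim
    case (elim s)
    show ?case
    proof
      assume s: "s \<in> {0..t}"
      have sT: "s \<in> {0..T}" and sub: "{0..t} \<subseteq> {0..T}" using s t by auto
      obtain v1 v2 where v: "(x has_vector_derivative v1) (at s within {0..T})" "- v1 \<in> F s (x s)"
        "(y has_vector_derivative v2) (at s within {0..T})" "- v2 \<in> F s (y s)"
        using elim sT by blast
      have "(z has_vector_derivative (v1 + - v2)) (at s within {0..t})"
        unfolding z_def using v(1,3) sub
        by (intro has_vector_derivative_add has_vector_derivative_minus) (auto intro: has_vector_derivative_within_subset)
      from bounded_bilinear.has_vector_derivative[OF bounded_bilinear_inner this this]
      have "(w has_vector_derivative (2 * inner (z s) (v1 + - v2))) (at s within {0..t})"
        unfolding w_def by (simp add: inner_commute)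
      then have wd: "(w has_real_derivative (2 * inner (z s) (v1 + - v2))) (at s within {0..t})"
        by (simp add: has_real_derivative_iff_has_vector_derivative)
      have "0 \<le> inner (- v1 - - v2) (x s - y s)"
        using A1 sT v by (intro maximal_monotone_ineq[of "F s"]) auto
      moreover have "- v1 - - v2 = - (v1 + - v2)" "x s - y s = z s" by (simp_all add: z_def)
      ultimately have "inner (z s) (v1 + - v2) \<le> 0"
        by (simp only: inner_minus_left inner_commute[of "z s"])
      then have "2 * inner (z s) (v1 + - v2) \<le> 0" by simp
      with wd show "\<exists>D\<le>0. (w has_real_derivative D) (at s within {0..t})" by blast
    qed
  qed
  then have "w t \<le> w 0"
    by (rule absolutely_continuous_deriv_nonpos[rotated 2]) (use t acw in simp_all)
  also have "w 0 = 0" using x y by (simp add: w_def z_def is_solution_def)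
  finally have "z t = 0"
    unfolding w_def by (metis inner_eq_zero_iff inner_ge_zero order_antisym)
  then show ?thesis by (simp add: z_def)
qed

text \<open>For each fixed level the statement holds almost everywhere where the excess vanishes.
  Integer levels are countably many, and every \<open>t\<close> lies below one of them in the sense
  that \<open>\<theta> t\<close> does, so \<open>m\<close> may depend on \<open>t\<close>.\<close>

lemma AE_excess_straddle_zero:
  fixes \<theta> :: "real \<Rightarrow> real"
  assumes \<theta>: "integrable lborel \<theta>" "\<And>x. 0 \<le> \<theta> x"
  shows "AE t in lborel. \<exists>m\<ge>1. \<forall>e>0. \<exists>d>0. \<forall>s u. s \<le> t \<and> t \<le> u \<and> u - s < d \<longrightarrow>
      (LINT x:{s<..u}|lborel. max 0 (\<theta> x - m)) \<le> e * (u - s)"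
proof -
  define Z where "Z m t = (\<forall>e>0. \<exists>d>0. \<forall>s u. s \<le> t \<and> t \<le> u \<and> u - s < d \<longrightarrow>
      (LINT x:{s<..u}|lborel. max 0 (\<theta> x - m)) \<le> e * (u - s))" for m t
  have [measurable]: "\<theta> \<in> borel_measurable borel" using \<theta>(1) by auto
  have "AE t in lborel. max 0 (\<theta> t - real n) = 0 \<longrightarrow> Z (real n) t" for n
    unfolding Z_def
  proof (rule AE_straddle_zero)
    show "integrable lborel (\<lambda>x. max 0 (\<theta> x - real n))"
      by (rule Bochner_Integration.integrable_bound[OF \<theta>(1)]) (auto simp: \<theta>(2))
  qed simp
  then have "AE t in lborel. \<forall>n. max 0 (\<theta> t - real n) = 0 \<longrightarrow> Z (real n) t"
    unfolding AE_all_countable by blast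
  then show ?thesis unfolding Z_def[symmetric]
  proof eventually_elim
    case (elim t)
    obtain n :: nat where "max 1 (\<theta> t) < real n" using reals_Archimedean2 by blast
    then show ?case using elim[rule_format, of n] by (intro exI[of _ "real n"]) auto
  qed
qed

theorem is_solution_exists:
  fixes T :: real and F :: "real \<Rightarrow> 'a::euclidean_space \<Rightarrow> 'a set"
  assumes T: "0 < T"
    and A1: "\<forall>t\<in>{0..T}. maximal_monotone (F t)"
    and A2: "\<exists>\<phi> :: real \<Rightarrow> real. mono_on {0..T} \<phi> \<and> absolutely_continuous_on_interval 0 T \<phi> \<and>
               (\<forall>s t. 0 \<le> s \<and> s \<le> t \<and> t \<le> T \<longrightarrow>
                  (\<forall>z\<in>sv_dom (F s). infdist z (sv_dom (F t)) \<le> \<phi> t - \<phi> s))"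
    and A3: "\<forall>r>0. \<exists>\<sigma> :: real \<Rightarrow> real. \<sigma> absolutely_integrable_on {0..T} \<and>
               (\<forall>t\<in>{0..T}. 0 \<le> \<sigma> t) \<and>
               (\<forall>t\<in>{0..T}. \<forall>x\<in>cball 0 r \<inter> sv_dom (F t).
                  norm (min_section F t x) \<le> \<sigma> t * (1 + norm x))"
    and A4: "graph_osc_on T F"
    and x0: "x0 \<in> closure (sv_dom (F 0))"
  shows "\<exists>x. is_solution T F x0 x"
proof -
  obtain \<theta> C g where \<theta>: "integrable lborel \<theta>" "\<And>x. 0 \<le> \<theta> x" and C: "0 \<le> C"
    and bd: "\<And>M. \<exists>B. \<forall>t\<in>{0..T}. g t \<le> M \<longrightarrow> (\<exists>u v. v \<in> F t u \<and> norm u \<le> B \<and> norm v \<le> B)"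
    and scheme: "\<And>N h. 0 < N \<Longrightarrow> h = T / real N \<Longrightarrow> \<exists>\<tau> y. y 0 = x0 \<and>
      (\<forall>k<N. \<tau> k \<in> {h * real k..h * (real k + 1)} \<and>
        (1 / h) *\<^sub>R (y k - y (Suc k)) \<in> F (\<tau> k) (y (Suc k)) \<and>
        norm (y (Suc k) - y k) \<le> C * (LINT x:{h * (real k - 1)<..h * (real k + 1)}|lborel. \<theta> x) \<and>
        h * g (\<tau> k) \<le> (LINT x:{h * (real k - 1)<..h * (real k + 1)}|lborel. \<theta> x) \<and>
        h \<le> (LINT x:{h * (real k - 1)<..h * (real k + 1)}|lborel. \<theta> x))"
    by (fact Euler_scheme_exists[OF T A1 A2 A3 x0])
  define h where "h n = T / real (Suc n)" for n
  \<comment> \<open>Sampling times and iterates are packed into one pair, so that a single choice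
    over \<open>n\<close> picks both coherently.\<close>
  have "\<exists>p. snd p 0 = x0 \<and>
      (\<forall>k<Suc n. fst p k \<in> {h n * real k..h n * (real k + 1)} \<and>
        (1 / h n) *\<^sub>R (snd p k - snd p (Suc k)) \<in> F (fst p k) (snd p (Suc k)) \<and>
        norm (snd p (Suc k) - snd p k) \<le> C * (LINT x:{h n * (real k - 1)<..h n * (real k + 1)}|lborel. \<theta> x) \<and>
        h n * g (fst p k) \<le> (LINT x:{h n * (real k - 1)<..h n * (real k + 1)}|lborel. \<theta> x) \<and>
        h n \<le> (LINT x:{h n * (real k - 1)<..h n * (real k + 1)}|lborel. \<theta> x))" for n
    using scheme[of "Suc n" "h n"] by (auto simp: h_def)
  then obtain P where P: "\<And>n. snd (P n) 0 = x0 \<and>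
      (\<forall>k<Suc n. fst (P n) k \<in> {h n * real k..h n * (real k + 1)} \<and>
        (1 / h n) *\<^sub>R (snd (P n) k - snd (P n) (Suc k)) \<in> F (fst (P n) k) (snd (P n) (Suc k)) \<and>
        norm (snd (P n) (Suc k) - snd (P n) k) \<le> C * (LINT x:{h n * (real k - 1)<..h n * (real k + 1)}|lborel. \<theta> x) \<and>
        h n * g (fst (P n) k) \<le> (LINT x:{h n * (real k - 1)<..h n * (real k + 1)}|lborel. \<theta> x) \<and>
        h n \<le> (LINT x:{h n * (real k - 1)<..h n * (real k + 1)}|lborel. \<theta> x))"
    by metis
  define \<tau> where "\<tau> n = fst (P n)" for n
  define Y where "Y n = snd (P n)" for n
  note P' = P[folded \<tau>_def Y_def]
  obtain \<Theta> where \<Theta>: "\<And>s u. s \<le> u \<Longrightarrow> (LINT x:{s<..u}|lborel. \<theta> x) = \<Theta> u - \<Theta> s"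
    "mono \<Theta>" "continuous_on UNIV \<Theta>"
    using indefinite_integral_exists[OF \<theta>] by blast
  have hpos: "0 < h n" for n using T by (simp add: h_def)
  have le: "h n * (real k - 1) \<le> h n * (real k + 1)" for n k using hpos[of n] by (intro mult_left_mono) auto
  obtain r x where r: "strict_mono (r :: nat \<Rightarrow> nat)"
    and x: "\<And>t. 0 \<le> t \<Longrightarrow> t \<le> T \<Longrightarrow> (\<lambda>n. Y (r n) (nat \<lfloor>t / h (r n)\<rfloor>)) \<longlonglongrightarrow> x t"
    and x00: "x 0 = x0" and xd: "\<And>a b. 0 \<le> a \<Longrightarrow> a \<le> b \<Longrightarrow> b \<le> T \<Longrightarrow> norm (x b - x a) \<le> 2 * C * (\<Theta> b - \<Theta> a)"
  proof (rule Euler_subsequence[OF T C \<Theta>(2,3) h_def, of Y x0])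
    show "Y n 0 = x0" for n using P' by blast
    show "norm (Y n (Suc k) - Y n k) \<le> C * (\<Theta> (h n * (real k + 1)) - \<Theta> (h n * (real k - 1)))" if "k < Suc n" for n k
      using P'[of n] that \<Theta>(1)[OF le[of n k]] by auto
  qed blast
  have dom: "norm (x u - x s) \<le> (LINT t:{s<..u}|lborel. 2 * C * \<theta> t)" if "0 \<le> s" "s \<le> u" "u \<le> T" for s u
    using xd[OF that] \<Theta>(1)[OF that(2)] by simp
  have \<theta>C: "integrable lborel (\<lambda>t. 2 * C * \<theta> t)" "\<And>t. 0 \<le> 2 * C * \<theta> t" using \<theta> C by auto
  have "AE t in lborel. t \<in> {0<..<T} \<longrightarrow> (\<exists>D. (x has_vector_derivative D) (at t))"
    using T by (intro AE_differentiable_of_dominated[OF \<theta>C _ dom]) auto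
  moreover note AE_excess_straddle_zero[OF \<theta>]
  ultimately have "AE t in lborel. t \<in> {0<..<T} \<longrightarrow> x t \<in> sv_dom (F t) \<and>
        (\<exists>v. (x has_vector_derivative v) (at t within {0..T}) \<and> - v \<in> F t (x t))"
  proof eventually_elim
    case (elim t)
    show ?case
    proof
      assume t: "t \<in> {0<..<T}"
      obtain D where D: "(x has_vector_derivative D) (at t)" using elim t by blast
      obtain m where m: "1 \<le> m" "\<forall>e>0. \<exists>d>0. \<forall>s u. s \<le> t \<and> t \<le> u \<and> u - s < d \<longrightarrow>
          (LINT x:{s<..u}|lborel. max 0 (\<theta> x - m)) \<le> e * (u - s)"
        using elim(2) by blast
      have "- D \<in> F t (x t)"
      proof (rule Euler_limit_inclusion[OF T A1 A4 \<theta> C bd h_def _ _ _ _ _ r x _ _ m D])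
        fix n k assume "k < Suc n"
        then show "\<tau> n k \<in> {h n * real k..h n * (real k + 1)}"
          "(1 / h n) *\<^sub>R (Y n k - Y n (Suc k)) \<in> F (\<tau> n k) (Y n (Suc k))"
          "norm (Y n (Suc k) - Y n k) \<le> C * (LINT x:{h n * (real k - 1)<..h n * (real k + 1)}|lborel. \<theta> x)"
          "h n * g (\<tau> n k) \<le> (LINT x:{h n * (real k - 1)<..h n * (real k + 1)}|lborel. \<theta> x)"
          "h n \<le> (LINT x:{h n * (real k - 1)<..h n * (real k + 1)}|lborel. \<theta> x)"
          using P'[of n] by blast+
      qed (use t in auto)
      then show "x t \<in> sv_dom (F t) \<and>
        (\<exists>v. (x has_vector_derivative v) (at t within {0..T}) \<and> - v \<in> F t (x t))"
        using has_vector_derivative_at_within[OF D] by (auto simp: sv_dom_def)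
    qed
  qed
  then have "AE t in lborel. t \<in> {0..T} \<longrightarrow> x t \<in> sv_dom (F t) \<and>
        (\<exists>v. (x has_vector_derivative v) (at t within {0..T}) \<and> - v \<in> F t (x t))"
    by (rule AE_less_endpoints)
  moreover have "absolutely_continuous_on_interval 0 T x"
    using dom by (rule absolutely_continuous_of_dominated[OF \<theta>C])
  ultimately show ?thesis using x00 by (auto simp: is_solution_def)
qed

theorem theorem11:
  fixes T :: real and F :: "real \<Rightarrow> 'a::euclidean_space \<Rightarrow> 'a set"
  assumes T_pos: "T > 0"
    and A1: "\<forall>t\<in>{0..T}. maximal_monotone (F t)"
    and A2: "\<exists>\<phi> :: real \<Rightarrow> real. mono_on {0..T} \<phi> \<and> absolutely_continuous_on_interval 0 T \<phi> \<and>
               (\<forall>s t. 0 \<le> s \<and> s \<le> t \<and> t \<le> T \<longrightarrow>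
                  (\<forall>z\<in>sv_dom (F s). infdist z (sv_dom (F t)) \<le> \<phi> t - \<phi> s))"
    and A3: "\<forall>r>0. \<exists>\<sigma> :: real \<Rightarrow> real. \<sigma> absolutely_integrable_on {0..T} \<and>
               (\<forall>t\<in>{0..T}. 0 \<le> \<sigma> t) \<and>
               (\<forall>t\<in>{0..T}. \<forall>x\<in>cball 0 r \<inter> sv_dom (F t).
                  norm (min_section F t x) \<le> \<sigma> t * (1 + norm x))"
    and A4: "graph_osc_on T F"
    and x0: "x0 \<in> closure (sv_dom (F 0))"
  shows "\<exists>x. is_solution T F x0 x \<and>
           (\<forall>y. is_solution T F x0 y \<longrightarrow> (\<forall>t\<in>{0..T}. y t = x t))"
proof -
  obtain x where x: "is_solution T F x0 x"
    using is_solution_exists[OF T_pos A1 A2 A3 A4 x0] by blast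
  then show ?thesis using is_solution_unique[OF A1] by blast
qed

end
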